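(* Let $\mathbf z_1,\dots,\mathbf z_n$ be a random sample from the distribution of a random vector $\mathbf z\in\mathbb R^p$ with mutually independent components having mean $0$ and variance $1$. Notation is as in the context; in particular $\hat{\mathbf V}$ denotes the sample standardizing matrix, and in each part it is assumed that $\sqrt n(\hat{\mathbf V}-\mathbf I_p)=O_P(1)$. (i) Suppose $\mathbf z$ has finite sixth moments and $\gamma_1,\dots,\gamma_p$ are distinct. Then there exists a sequence of compound cumulant solutions $\hat{\mathbf W}$ based on skewness (that is, $\alpha=1$) such that $\hat{\mathbf W}\to_P\mathbf I_p$ and $$\sqrt n(\hat w_{kk}-1)=-\tfrac12\sqrt n(\hat s_{kk}-1)+o_P(1),\qquad \sqrt n\,\hat w_{kl}=\frac{\sqrt n\,\hat\psi_{1kl}}{\gamma_k-\gamma_l}+o_P(1),\quad k\ne l,$$ where $\hat\psi_{1kl}=\hat r_{kl}+\hat r_{lk}+\sum_{m\ne k,l}\hat r_{mkl}-\gamma_k\hat s_{kl}$. (ii) Suppose $\mathbf z$ has finite eighth moments and $\kappa_1,\dots,\kappa_p$ are distinct. Then there exists a sequence of compound cumulant solutions $\hat{\mathbf W}$ based on kurtosis (that is, $\alpha=0$) such that $\hat{\mathbf W}\to_P\mathbf I_p$ and $$\sqrt n(\hat w_{kk}-1)=-\tfrac12\sqrt n(\hat s_{kk}-1)+o_P(1),\qquad \sqrt n\,\hat w_{kl}=\frac{\sqrt n\,\hat\psi_{2kl}}{\kappa_k-\kappa_l}+o_P(1),\quad k\ne l,$$ where $\hat\psi_{2kl}=\hat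 q_{kl}+\hat q_{lk}+\sum_{m\ne k,l}\hat q_{mkl}-(\kappa_k+p+4)\hat s_{kl}$. (iii) Suppose $\mathbf z$ has finite eighth moments and there is no pair $k\ne l$ with $\gamma_k=\gamma_l$ and $\kappa_k=\kappa_l$. Then there exists a sequence of compound cumulant solutions $\hat{\mathbf W}$ based on both skewness and kurtosis such that $\hat{\mathbf W}\to_P\mathbf I_p$ and $$\sqrt n(\hat w_{kk}-1)=-\tfrac12\sqrt n(\hat s_{kk}-1)+o_P(1),$$ $$\sqrt n\,\hat w_{kl}=\frac{\alpha(\gamma_k-\gamma_l)\sqrt n\,\hat\psi_{1kl}+(1-\alpha)(\kappa_k-\kappa_l)\sqrt n\,\hat\psi_{2kl}}{\alpha(\gamma_k-\gamma_l)^2+(1-\alpha)(\kappa_k-\kappa_l)^2}+o_P(1),\quad k\ne l,$$ where $\alpha\in[0,1]$ is the proportion of weight given to skewness, and $\hat\psi_{1kl}$ and $\hat\psi_{2kl}$ are as in (i) and (ii).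
   Context: Moments: $\gamma_k=E(z_k^3)$, $\beta_k=E(z_k^4)$, $\kappa_k=\beta_k-3$, where $z_k$ is the $k$th component of $\mathbf z$. Write $\mathbf z_i=(z_{i1},\dots,z_{ip})^T$ and $$\hat s_{kl}=\frac1n\sum_i z_{ik}z_{il},\quad \hat r_{kl}=\frac1n\sum_i(z_{ik}^2-1)z_{il},\quad \hat r_{mkl}=\frac1n\sum_i z_{im}z_{ik}z_{il},$$ $$\hat q_{kl}=\frac1n\sum_i(z_{ik}^3-\gamma_k)z_{il},\quad \hat q_{mkl}=\frac1n\sum_i z_{im}^2z_{ik}z_{il}.$$ Cumulant matrices: for a random $p$-vector $\mathbf x$ with mean zero, $\mathbf C^{3i}(\mathbf x)=E[x_i\mathbf x\mathbf x^T]$, $\mathbf C^{4ij}(\mathbf x)=E[x_ix_j\mathbf x\mathbf x^T]-E(x_ix_j)E(\mathbf x\mathbf x^T)-E(x_i\mathbf x)E(x_j\mathbf x^T)-E(x_j\mathbf x)E(x_i\mathbf x^T)$, and the compound cumulant matrices are $\mathbf C^3(\mathbf x)=\sum_{i=1}^p\mathbf C^{3i}(\mathbf x)$, $\mathbf C^4(\mathbf x)=\sum_{i=1}^p\mathbf C^{4ii}(\mathbf x)$. Compound cumulant estimate: let $\bar{\mathbf z}=\frac1n\sum_i\mathbf z_i$ and $\hat{\boldsymbol\Sigma}=\frac1n\sum_i(\mathbf z_i-\bar{\mathbf z})(\mathbf z_i-\bar{\mathbf z})^T$ (nonsingular with probability tending to one). The data are first standardized by the sample version $\hat{\mathbf V}=\hat{\mathbf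 U}^*\hat{\boldsymbol\Sigma}^{-1/2}$, with $\hat{\mathbf U}^*$ orthogonal, of an arbitrary independent component functional $(\boldsymbol\Sigma^* )^{-1/2}=\mathbf U^*\boldsymbol\Sigma^{-1/2}$ ($\mathbf U^*$ orthogonal, $\boldsymbol\Sigma$ the covariance matrix); an independent component functional is an affine equivariant functional (up to permutation and sign changes of rows) that transforms $\mathbf x$ to independent components whenever $\mathbf x=\boldsymbol\mu+\boldsymbol\Omega\mathbf z$ with $\boldsymbol\Omega$ nonsingular and $\mathbf z$ having independent standardized components, at most one of them normal. Let $\hat{\mathbf C}^3,\hat{\mathbf C}^4$ be the matrices $\mathbf C^3,\mathbf C^4$ of the empirical distribution of $\hat{\mathbf V}(\mathbf z_i-\bar{\mathbf z})$, $i=1,\dots,n$. A compound cumulant solution with weight $\alpha\in[0,1]$ is $\hat{\mathbf W}=(\hat w_{kl})=\hat{\mathbf U}\hat{\mathbf V}$, where $\hat{\mathbf U}$ maximizes $\alpha\|\mathrm{diag}(\mathbf U\hat{\mathbf C}^3\mathbf U^T)\|^2+(1-\alpha)\|\mathrm{diag}(\mathbf U\hat{\mathbf C}^4\mathbf U^T)\|^2$ over orthogonal $\mathbf U$; here $\mathrm{diag}(\mathbf A)$ is the diagonal matrix with the diagonal of $\mathbf A$ and $\|\cdot\|$ is the Frobenius norm. Limits are as $n\to\infty$.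
   Formalization: In (iii), α∈[0,1] is restricted to values for which all displayed denominators α(γ_k−γ_l)²+(1−α)(κ_k−κ_l)² are nonzero; this is automatic for 0<α<1 and excludes only α=1 with equal skewnesses or α=0 with equal kurtoses, where the formula divides by zero. *)

theory Defs
  imports "HOL-Probability.Probability"
begin

text \<open>Stochastic order symbols, for sequences of random variables on \<open>M\<close>.\<close>

definition oP1 :: "'a measure \<Rightarrow> (nat \<Rightarrow> 'a \<Rightarrow> 'b::real_normed_vector) \<Rightarrow> bool" where
  "oP1 M X \<longleftrightarrow>
     (\<forall>\<epsilon>>0. (\<lambda>n. measure M {\<omega> \<in> space M. norm (X n \<omega>) > \<epsilon>}) \<longlonglongrightarrow> 0)"

definition OP1 :: "'a measure \<Rightarrow> (nat \<Rightarrow> 'a \<Rightarrow> 'b::real_normed_vector) \<Rightarrow> bool" where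
  "OP1 M X \<longleftrightarrow>
     (\<forall>\<epsilon>>0. \<exists>K. \<forall>\<^sub>F n in sequentially. measure M {\<omega> \<in> space M. norm (X n \<omega>) > K} < \<epsilon>)"

definition tendsto_in_prob ::
    "'a measure \<Rightarrow> (nat \<Rightarrow> 'a \<Rightarrow> 'b::real_normed_vector) \<Rightarrow> 'b \<Rightarrow> bool" where
  "tendsto_in_prob M X c \<longleftrightarrow> oP1 M (\<lambda>n \<omega>. X n \<omega> - c)"

text \<open>
  Functionals of the distribution of a random vector are functions of its law, a measure on the
  Borel sets of \<open>real^'p\<close>. Their sample versions are their values at the empirical distribution.
\<close>

definition square_integrable_law :: "(real^'p) measure \<Rightarrow> bool" where
  "square_integrable_law P \<longleftrightarrow>
     prob_space P \<and> sets P = sets borel \<and> (\<forall>k. integrable P (\<lambda>x. (x$k)^2))"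

definition mean_vec :: "(real^'p) measure \<Rightarrow> real^'p" where
  "mean_vec P = (\<integral>x. x \<partial>P)"

definition cov_mat :: "(real^'p) measure \<Rightarrow> real^'p^'p" where
  "cov_mat P = (\<chi> k l. \<integral>x. (x$k - mean_vec P$k) * (x$l - mean_vec P$l) \<partial>P)"

text \<open>The observations \<open>z\<^sub>1, \<dots>, z\<^sub>n\<close> are \<open>x 0, \<dots>, x (n - 1)\<close>.\<close>

definition empirical :: "nat \<Rightarrow> (nat \<Rightarrow> real^'p) \<Rightarrow> (real^'p) measure" where
  "empirical n x = distr (uniform_count_measure {..<n}) borel x"

text \<open>\<open>inverse_sqrt_of S R\<close>: the matrix \<open>R\<close> is the symmetric positive definite \<open>S\<^sup>-\<^sup>1\<^sup>/\<^sup>2\<close>.\<close>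

definition inverse_sqrt_of :: "real^'p^'p \<Rightarrow> real^'p^'p \<Rightarrow> bool" where
  "inverse_sqrt_of S R \<longleftrightarrow>
     invertible S \<and> transpose R = R \<and> (\<forall>x. x \<noteq> 0 \<longrightarrow> x \<bullet> (R *v x) > 0) \<and>
     R ** R = matrix_inv S"

definition signed_permutation_matrix :: "real^'p^'p \<Rightarrow> bool" where
  "signed_permutation_matrix J \<longleftrightarrow>
     (\<exists>\<pi> s. \<pi> permutes (UNIV :: 'p set) \<and> (\<forall>k. s k \<in> {-1, 1}) \<and>
            J = (\<chi> k l. if l = \<pi> k then s k else 0))"

definition affine_image :: "real^'p^'p \<Rightarrow> real^'p \<Rightarrow> (real^'p) measure \<Rightarrow> (real^'p) measure" where
  "affine_image A b P = distr P borel (\<lambda>x. A *v x + b)"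

definition independent_components :: "(real^'p) measure \<Rightarrow> bool" where
  "independent_components P \<longleftrightarrow> prob_space.indep_vars P (\<lambda>_. borel) (\<lambda>k x. x$k) UNIV"

definition standardized_independent :: "(real^'p) measure \<Rightarrow> bool" where
  "standardized_independent P \<longleftrightarrow>
     square_integrable_law P \<and> independent_components P \<and>
     (\<forall>k. (\<integral>x. x$k \<partial>P) = 0) \<and> (\<forall>k. (\<integral>x. (x$k)^2 \<partial>P) = 1)"

text \<open>Laws of \<open>\<mu> + \<Omega> z\<close> in the independent component model.\<close>

definition ic_model :: "(real^'p) measure \<Rightarrow> bool" where
  "ic_model P \<longleftrightarrow>
     (\<exists>Q \<Omega> \<mu>. standardized_independent Q \<and>
        (\<forall>k l. distributed Q lborel (\<lambda>x. x$k) std_normal_density \<and>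
               distributed Q lborel (\<lambda>x. x$l) std_normal_density \<longrightarrow> k = l) \<and>
        invertible \<Omega> \<and> P = affine_image \<Omega> \<mu> Q)"

text \<open>
  \<open>F\<close> is an independent component functional with domain \<open>D\<close>. A domain is needed: no functional
  is affine equivariant, up to signs and order of rows, on all laws with nonsingular covariance
  matrix, since for a law \<open>P\<close> invariant under a linear map \<open>A\<close> equivariance forces
  \<open>F P ** matrix_inv A = J ** F P\<close> with \<open>J\<close> a signed permutation matrix. In the plane this fails
  for spherical laws, and also for empirical distributions of three points. Outside \<open>D\<close> the
  functional only has to standardize, so that its sample version may be taken at any empirical
  distribution with nonsingular covariance matrix.
\<close>

definition ic_functional ::
    "(real^'p) measure set \<Rightarrow> ((real^'p) measure \<Rightarrow> real^'p^'p) \<Rightarrow> bool" where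
  "ic_functional D F \<longleftrightarrow>
     (\<forall>P. square_integrable_law P \<and> invertible (cov_mat P) \<longrightarrow>
        (\<exists>U R. orthogonal_matrix U \<and> inverse_sqrt_of (cov_mat P) R \<and> F P = U ** R)) \<and>
     (\<forall>P\<in>D. square_integrable_law P \<and> invertible (cov_mat P)) \<and>
     (\<forall>P\<in>D. \<forall>A b. invertible A \<longrightarrow>
        affine_image A b P \<in> D \<and>
        (\<exists>J. signed_permutation_matrix J \<and> F (affine_image A b P) = J ** F P ** matrix_inv A)) \<and>
     (\<forall>P\<in>D. ic_model P \<longrightarrow> independent_components (affine_image (F P) 0 P))"

text \<open>Cumulant matrices of the law of a random vector with mean zero.\<close>

definition C3i :: "'p \<Rightarrow> (real^'p) measure \<Rightarrow> real^'p^'p" where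
  "C3i i P = (\<chi> k l. \<integral>x. x$i * (x$k * x$l) \<partial>P)"

definition C4ij :: "'p \<Rightarrow> 'p \<Rightarrow> (real^'p) measure \<Rightarrow> real^'p^'p" where
  "C4ij i j P = (\<chi> k l.
     (\<integral>x. x$i * x$j * (x$k * x$l) \<partial>P)
     - (\<integral>x. x$i * x$j \<partial>P) * (\<integral>x. x$k * x$l \<partial>P)
     - (\<integral>x. x$i * x$k \<partial>P) * (\<integral>x. x$j * x$l \<partial>P)
     - (\<integral>x. x$j * x$k \<partial>P) * (\<integral>x. x$i * x$l \<partial>P))"

definition C3 :: "(real^'p) measure \<Rightarrow> real^'p^'p" where
  "C3 P = (\<Sum>i\<in>UNIV. C3i i P)"

definition C4 :: "(real^'p) measure \<Rightarrow> real^'p^'p" where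
  "C4 P = (\<Sum>i\<in>UNIV. C4ij i i P)"

definition diag_part :: "real^'p^'p \<Rightarrow> real^'p^'p" where
  "diag_part A = (\<chi> i j. if i = j then A$i$j else 0)"

text \<open>On \<open>real^'p^'p\<close> the function \<open>norm\<close> is the Frobenius norm.\<close>

definition cc_objective ::
    "real \<Rightarrow> real^'p^'p \<Rightarrow> real^'p^'p \<Rightarrow> real^'p^'p \<Rightarrow> real" where
  "cc_objective \<alpha> A B U =
     \<alpha> * (norm (diag_part (U ** A ** transpose U)))^2 +
     (1 - \<alpha>) * (norm (diag_part (U ** B ** transpose U)))^2"

definition standardized_law ::
    "((real^'p) measure \<Rightarrow> real^'p^'p) \<Rightarrow> (real^'p) measure \<Rightarrow> (real^'p) measure" where
  "standardized_law F P = distr P borel (\<lambda>x. F P *v (x - mean_vec P))"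

definition compound_cumulant_solution ::
    "real \<Rightarrow> ((real^'p) measure \<Rightarrow> real^'p^'p) \<Rightarrow> (real^'p) measure \<Rightarrow> real^'p^'p \<Rightarrow> bool" where
  "compound_cumulant_solution \<alpha> F P W \<longleftrightarrow>
     (let obj = cc_objective \<alpha> (C3 (standardized_law F P)) (C4 (standardized_law F P))
      in \<exists>U. orthogonal_matrix U \<and> (\<forall>U'. orthogonal_matrix U' \<longrightarrow> obj U' \<le> obj U) \<and>
             W = U ** F P)"

text \<open>
  Estimators are random matrices. The defining property is imposed where the sample covariance
  matrix is nonsingular, as the standardization is undefined elsewhere.
\<close>

definition cc_solution_sequence ::
    "real \<Rightarrow> ((real^'p) measure \<Rightarrow> real^'p^'p) \<Rightarrow> 'a measure \<Rightarrow> (nat \<Rightarrow> 'a \<Rightarrow> real^'p) \<Rightarrow>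
     (nat \<Rightarrow> 'a \<Rightarrow> real^'p^'p) \<Rightarrow> bool" where
  "cc_solution_sequence \<alpha> F M z W \<longleftrightarrow>
     (\<forall>n. W n \<in> borel_measurable M \<and>
        (\<forall>\<omega>\<in>space M. invertible (cov_mat (empirical n (\<lambda>i. z i \<omega>))) \<longrightarrow>
           compound_cumulant_solution \<alpha> F (empirical n (\<lambda>i. z i \<omega>)) (W n \<omega>)))"

definition skew :: "(real^'p) measure \<Rightarrow> 'p \<Rightarrow> real" where
  "skew P k = (\<integral>x. (x$k)^3 \<partial>P)"

definition kurt :: "(real^'p) measure \<Rightarrow> 'p \<Rightarrow> real" where
  "kurt P k = (\<integral>x. (x$k)^4 \<partial>P) - 3"

definition s_hat :: "nat \<Rightarrow> (nat \<Rightarrow> real^'p) \<Rightarrow> 'p \<Rightarrow> 'p \<Rightarrow> real" where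
  "s_hat n x k l = (1 / real n) * (\<Sum>i<n. x i$k * x i$l)"

definition r_hat :: "nat \<Rightarrow> (nat \<Rightarrow> real^'p) \<Rightarrow> 'p \<Rightarrow> 'p \<Rightarrow> real" where
  "r_hat n x k l = (1 / real n) * (\<Sum>i<n. ((x i$k)^2 - 1) * x i$l)"

definition r_hat3 :: "nat \<Rightarrow> (nat \<Rightarrow> real^'p) \<Rightarrow> 'p \<Rightarrow> 'p \<Rightarrow> 'p \<Rightarrow> real" where
  "r_hat3 n x m k l = (1 / real n) * (\<Sum>i<n. x i$m * x i$k * x i$l)"

definition q_hat :: "(real^'p) measure \<Rightarrow> nat \<Rightarrow> (nat \<Rightarrow> real^'p) \<Rightarrow> 'p \<Rightarrow> 'p \<Rightarrow> real" where
  "q_hat P n x k l = (1 / real n) * (\<Sum>i<n. ((x i$k)^3 - skew P k) * x i$l)"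

definition q_hat3 :: "nat \<Rightarrow> (nat \<Rightarrow> real^'p) \<Rightarrow> 'p \<Rightarrow> 'p \<Rightarrow> 'p \<Rightarrow> real" where
  "q_hat3 n x m k l = (1 / real n) * (\<Sum>i<n. (x i$m)^2 * x i$k * x i$l)"

definition psi1_hat :: "(real^'p) measure \<Rightarrow> nat \<Rightarrow> (nat \<Rightarrow> real^'p) \<Rightarrow> 'p \<Rightarrow> 'p \<Rightarrow> real" where
  "psi1_hat P n x k l =
     r_hat n x k l + r_hat n x l k + (\<Sum>m\<in>UNIV - {k, l}. r_hat3 n x m k l)
     - skew P k * s_hat n x k l"

definition psi2_hat :: "(real^'p) measure \<Rightarrow> nat \<Rightarrow> (nat \<Rightarrow> real^'p) \<Rightarrow> 'p \<Rightarrow> 'p \<Rightarrow> real" where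
  "psi2_hat P n x k l =
     q_hat P n x k l + q_hat P n x l k + (\<Sum>m\<in>UNIV - {k, l}. q_hat3 n x m k l)
     - (kurt P k + real CARD('p) + 4) * s_hat n x k l"

end

theory Submission
  imports Defs "HOL-Library.Landau_Symbols"
begin

text \<open>
  Let \<open>\<Phi>\<close> be the filter of pairs \<open>(n, \<omega>)\<close> with \<open>n \<rightarrow> \<infinity>\<close> along which the root-\<open>n\<close> scaled errors of
  \<open>V\<close> and of the sample moments are at most \<open>K\<close>. These errors are tight by Chebyshev's inequality,
  so an expansion with remainder \<open>o(n\<^sup>-\<^sup>1\<^sup>/\<^sup>2)\<close> along \<open>\<Phi>\<close> for each \<open>K\<close> gives one with remainder
  \<open>o\<^sub>P(n\<^sup>-\<^sup>1\<^sup>/\<^sup>2)\<close>, and the argument becomes deterministic. Expanding the cumulant matrices \<open>C\<close> of the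
  standardized data shows that to first order their off-diagonal entries are
  \<open>\<psi>\<^sub>k\<^sub>l - (c\<^sub>k - c\<^sub>l) V\<^sub>k\<^sub>l\<close>, where \<open>c\<close> is \<open>\<gamma>\<close> or \<open>\<kappa>\<close>; here whiteness of the standardized data relates \<open>V\<^sub>k\<^sub>l + V\<^sub>l\<^sub>k\<close> to the sample
  covariance. Stationarity of the objective under plane rotations, linearized at the identity,
  determines \<open>U\<^sub>k\<^sub>l\<close>, and in \<open>W\<^sub>k\<^sub>l = V\<^sub>k\<^sub>l + U\<^sub>k\<^sub>l + o(n\<^sup>-\<^sup>1\<^sup>/\<^sup>2)\<close> the contribution of \<open>V\<close> cancels.

  The objective does not change under signed permutations of the rows of \<open>U\<close>, and in the limit
  only signed permutation matrices maximize it. Hence the maximizer nearest to the identity is consistent, and it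
  can be chosen measurably.
\<close>

subsection \<open>First order expansions\<close>

text \<open>About \<open>V\<close> only the rate and the exact whitening are available. Whitening
  fixes the symmetric part of \<open>V - I\<close> to first order; the antisymmetric part stays
  arbitrary, and it is \<open>U\<close> that has to undo it. Stationarity says that off-diagonal
  entries of \<open>U C U\<^sup>T\<close>, multiplied by differences of diagonal entries and by the
  weights, sum to zero. In the limit these differences are \<open>c\<^sub>k - c\<^sub>l\<close>, and
  each off-diagonal entry of \<open>C\<close> contains
  \<open>- (c\<^sub>k - c\<^sub>l) V\<^sub>k\<^sub>l\<close>. Hence the total coefficient of
  \<open>V\<^sub>k\<^sub>l\<close> is minus the denominator of the claim, and division leaves
  exactly \<open>- V\<^sub>k\<^sub>l\<close>.

  The obstacle is that consistency gives no rate for \<open>U\<close>. The linearization is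
  therefore carried out with an error gauge that contains the unknown error of \<open>U\<close>
  itself, and this gauge is afterwards shown to be of order
  \<open>n\<^sup>-\<^sup>1\<^sup>/\<^sup>2\<close>.

  The moment conditions are of order \<open>2*d\<close>, where \<open>d\<close> is the largest
  degree of the sample moments that occur, 3 for \<open>C3\<close> and 4 for \<open>C4\<close>:
  Chebyshev's inequality needs their variances.\<close>

definition first_order ::
    "'i filter \<Rightarrow> ('i \<Rightarrow> real) \<Rightarrow> ('i \<Rightarrow> real) \<Rightarrow> real \<Rightarrow> ('i \<Rightarrow> real) \<Rightarrow> bool" where
  "first_order F \<eta> f a d \<longleftrightarrow> (\<lambda>i. f i - a - d i) \<in> o[F](\<eta>) \<and> d \<in> O[F](\<eta>)"

lemma first_orderI: "(\<lambda>i. f i - a) \<in> O[F](\<eta>) \<Longrightarrow> first_order F \<eta> f a (\<lambda>i. f i - a)"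
  by (simp add: first_order_def)

lemma first_order_const: "first_order F \<eta> (\<lambda>_. a) a (\<lambda>_. 0)"
  by (simp add: first_order_def)

text \<open>The differential matters only modulo o(\<open>\<eta>\<close>), and the function only
  eventually along \<open>F\<close>.\<close>

lemma first_order_cong:
  assumes "first_order F \<eta> f a d" "eventually (\<lambda>i. f i = g i) F" "(\<lambda>i. d i - e i) \<in> o[F](\<eta>)" "a = b"
  shows "first_order F \<eta> g b e"
proof -
  have "(\<lambda>i. f i - a - d i + (d i - e i)) \<in> o[F](\<eta>)"
    using assms(1,3) by (intro sum_in_smallo(1)) (auto simp: first_order_def)
  then have "(\<lambda>i. g i - b - e i) \<in> o[F](\<eta>)"
    by (rule landau_o.small.in_cong[THEN iffD1, rotated])
       (use assms(2,4) in \<open>auto elim: eventually_mono\<close>)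
  moreover have "(\<lambda>i. d i - (d i - e i)) \<in> O[F](\<eta>)"
    by (rule sum_in_bigo(2))
       (use assms(1,3) in \<open>auto simp: first_order_def intro: landau_o.small_imp_big\<close>)
  ultimately show ?thesis by (simp add: first_order_def)
qed

lemma first_order_add:
  assumes "first_order F \<eta> f a d" "first_order F \<eta> g b e"
  shows "first_order F \<eta> (\<lambda>i. f i + g i) (a + b) (\<lambda>i. d i + e i)"
proof -
  have "(\<lambda>i. (f i - a - d i) + (g i - b - e i)) \<in> o[F](\<eta>)"
    using assms by (intro sum_in_smallo(1)) (auto simp: first_order_def)
  also have "(\<lambda>i. (f i - a - d i) + (g i - b - e i)) = (\<lambda>i. f i + g i - (a + b) - (d i + e i))"
    by auto
  finally show ?thesis
    using assms by (auto simp: first_order_def intro!: sum_in_bigo(1))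
qed

lemma first_order_sum:
  assumes "\<And>j. j \<in> J \<Longrightarrow> first_order F \<eta> (f j) (a j) (d j)"
  shows "first_order F \<eta> (\<lambda>i. \<Sum>j\<in>J. f j i) (\<Sum>j\<in>J. a j) (\<lambda>i. \<Sum>j\<in>J. d j i)"
  using assms
  by (induction J rule: infinite_finite_induct)
     (auto intro!: first_order_const first_order_add)

lemma first_order_bounded:
  assumes "first_order F \<eta> f a d" "\<eta> \<in> o[F](\<lambda>_. 1)"
  shows "f \<in> O[F](\<lambda>_. 1)"
proof -
  have d: "d \<in> O[F](\<lambda>_. 1)" and r: "(\<lambda>i. f i - a - d i) \<in> O[F](\<lambda>_. 1)"
    using assms unfolding first_order_def
    by (metis landau_o.big_small_trans landau_o.small_imp_big)
       (metis assms first_order_def landau_o.small_trans landau_o.small_imp_big)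
  have "(\<lambda>i. f i - a - d i + a + d i) \<in> O[F](\<lambda>_. 1)"
    by (intro sum_in_bigo(1) d r bigo_const)
  then show ?thesis by simp
qed

text \<open>The Leibniz rule. The product of the differentials is o(\<open>\<eta>\<close>), because
  one factor is O(\<open>\<eta>\<close>) and the other tends to 0; the remainders are multiplied by
  bounded functions only.\<close>

lemma first_order_mult:
  assumes f: "first_order F \<eta> f a d" and g: "first_order F \<eta> g b e" and \<eta>: "\<eta> \<in> o[F](\<lambda>_. 1)"
  shows "first_order F \<eta> (\<lambda>i. f i * g i) (a * b) (\<lambda>i. a * e i + d i * b)"
proof -
  let ?rf = "\<lambda>i. f i - a - d i" and ?rg = "\<lambda>i. g i - b - e i"
  have de: "d \<in> O[F](\<eta>)" "e \<in> O[F](\<eta>)" "?rf \<in> o[F](\<eta>)" "?rg \<in> o[F](\<eta>)"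
    using f g by (auto simp: first_order_def)
  have e1: "e \<in> o[F](\<lambda>_. 1)" using de \<eta> by (metis landau_o.big_small_trans)
  have "(\<lambda>i. d i * e i) \<in> o[F](\<eta>)"
    using landau_o.big_small_mult[OF de(1) e1] by simp
  moreover have "(\<lambda>i. f i * ?rg i) \<in> o[F](\<eta>)"
    using landau_o.big_small_mult[OF first_order_bounded[OF f \<eta>] de(4)] by simp
  moreover have "(\<lambda>i. ?rf i * (b + e i)) \<in> o[F](\<eta>)"
  proof -
    have "(\<lambda>i. b + e i) \<in> O[F](\<lambda>_. 1)"
      using e1 by (intro sum_in_bigo(1) bigo_const landau_o.small_imp_big)
    from landau_o.small_big_mult[OF de(3) this] show ?thesis by simp
  qed
  ultimately have "(\<lambda>i. d i * e i + f i * ?rg i + ?rf i * (b + e i)) \<in> o[F](\<eta>)"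
    by (intro sum_in_smallo(1))
  also have "(\<lambda>i. d i * e i + f i * ?rg i + ?rf i * (b + e i)) =
             (\<lambda>i. f i * g i - a * b - (a * e i + d i * b))"
    by (rule ext) (simp add: algebra_simps)
  finally show ?thesis
    using de by (auto simp: first_order_def intro!: sum_in_bigo(1))
qed

lemma first_order_cmult:
  assumes "first_order F \<eta> f a d"
  shows "first_order F \<eta> (\<lambda>i. c * f i) (c * a) (\<lambda>i. c * d i)"
proof -
  have "(\<lambda>i. c * (f i - a - d i)) \<in> o[F](\<eta>)" using assms by (simp add: first_order_def)
  then show ?thesis using assms by (simp add: first_order_def algebra_simps)
qed

lemma first_order_diff:
  assumes "first_order F \<eta> f a d" "first_order F \<eta> g b e"
  shows "first_order F \<eta> (\<lambda>i. f i - g i) (a - b) (\<lambda>i. d i - e i)"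
  using first_order_add[OF assms(1) first_order_cmult[OF assms(2), of "-1"]] by simp

text \<open>This turns exact identities into linear ones: expanding both sides of whiteness,
  orthogonality or stationarity gives two differentials of the same function.\<close>

lemma first_order_unique:
  assumes "first_order F \<eta> f a d" "first_order F \<eta> f a e"
  shows "(\<lambda>i. d i - e i) \<in> o[F](\<eta>)"
proof -
  have "(\<lambda>i. (f i - a - e i) - (f i - a - d i)) \<in> o[F](\<eta>)"
    by (rule sum_in_smallo(2)) (use assms in \<open>auto simp: first_order_def\<close>)
  then show ?thesis by simp
qed

lemma first_order_bigo:
  assumes "first_order F \<eta> f a d"
  shows "(\<lambda>i. f i - a) \<in> O[F](\<eta>)"
proof -
  have "(\<lambda>i. (f i - a - d i) + d i) \<in> O[F](\<eta>)"
    using assms by (intro sum_in_bigo(1)) (auto simp: first_order_def intro: landau_o.small_imp_big)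
  then show ?thesis by simp
qed

text \<open>
  Adding the constant coordinate \<open>None\<close> to the data absorbs the centering at the sample mean into
  the linear transformation.
\<close>

definition coord :: "real^'p \<Rightarrow> 'p option \<Rightarrow> real" where
  "coord v a = (case a of None \<Rightarrow> 1 | Some k \<Rightarrow> v$k)"

text \<open>Lists with repetition instead of exponents, so that a product of linear forms can be
  expanded by recursion, one factor at a time.\<close>

definition monomial :: "real^'p \<Rightarrow> 'p option list \<Rightarrow> real" where
  "monomial v as = prod_list (map (coord v) as)"

definition emp_moment :: "nat \<Rightarrow> (nat \<Rightarrow> real^'p) \<Rightarrow> 'p option list \<Rightarrow> real" where
  "emp_moment n x as = (1 / real n) * (\<Sum>t<n. monomial (x t) as)"

definition pop_moment :: "(real^'p) measure \<Rightarrow> 'p option list \<Rightarrow> real" where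
  "pop_moment P as = (\<integral>v. monomial v as \<partial>P)"

text \<open>Row \<open>k\<close> of the affine map sending \<open>v\<close> to \<open>V\<close>
  applied to \<open>v\<close> minus the sample mean, written in the augmented coordinates.\<close>

definition centering :: "nat \<Rightarrow> (nat \<Rightarrow> real^'p) \<Rightarrow> real^'p^'p \<Rightarrow> 'p \<Rightarrow> 'p option \<Rightarrow> real" where
  "centering n x V k a =
     (case a of None \<Rightarrow> - (\<Sum>j\<in>UNIV. V$k$j * emp_moment n x [Some j]) | Some j \<Rightarrow> V$k$j)"

text \<open>The list \<open>ks\<close> holds the factors still to be expanded in the rows of
  \<open>A\<close>, the list \<open>as\<close> the raw coordinates already split off. With both
  present, the expansion of a product is a recursion on \<open>ks\<close>.\<close>

definition mixed_moment ::
    "nat \<Rightarrow> (nat \<Rightarrow> real^'p) \<Rightarrow> ('p \<Rightarrow> 'p option \<Rightarrow> real) \<Rightarrow> 'p list \<Rightarrow> 'p option list \<Rightarrow> real" where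
  "mixed_moment n x A ks as =
     (1 / real n) * (\<Sum>t<n. prod_list (map (\<lambda>k. \<Sum>a\<in>UNIV. A k a * coord (x t) a) ks) * monomial (x t) as)"

lemma mixed_moment_Nil [simp]: "mixed_moment n x A [] as = emp_moment n x as"
  by (simp add: mixed_moment_def emp_moment_def)

lemma mixed_moment_Cons:
  "mixed_moment n x A (k # ks) as = (\<Sum>a\<in>UNIV. A k a * mixed_moment n x A ks (a # as))"
proof -
  let ?R = "\<lambda>t. prod_list (map (\<lambda>k. \<Sum>a\<in>UNIV. A k a * coord (x t) a) ks)"
  have "(\<Sum>t<n. ((\<Sum>a\<in>UNIV. A k a * coord (x t) a) * ?R t) * monomial (x t) as) =
        (\<Sum>t<n. \<Sum>a\<in>UNIV. A k a * (?R t * (coord (x t) a * monomial (x t) as)))"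
    by (intro sum.cong refl) (simp add: sum_distrib_left sum_distrib_right mult_ac)
  also have "\<dots> = (\<Sum>a\<in>UNIV. \<Sum>t<n. A k a * (?R t * (coord (x t) a * monomial (x t) as)))"
    by (rule sum.swap)
  finally show ?thesis
    by (simp add: mixed_moment_def monomial_def sum_distrib_left mult.left_commute)
qed

text \<open>The derivative of the mixed moment at the point where row \<open>k\<close> of
  \<open>A\<close> picks coordinate \<open>k\<close> and the moments are \<open>\<mu>\<close>:
  either the moments vary, or a single row does while every other factor keeps its own coordinate.
  The reversal appears because factors are moved one by one to the front of
  \<open>as\<close>.\<close>

fun moment_differential ::
    "('p option list \<Rightarrow> real) \<Rightarrow> ('p option list \<Rightarrow> real) \<Rightarrow> ('p \<Rightarrow> 'p option \<Rightarrow> real) \<Rightarrow>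
     'p list \<Rightarrow> ('p::finite) option list \<Rightarrow> real" where
  "moment_differential \<mu> d\<mu> dA [] as = d\<mu> as"
| "moment_differential \<mu> d\<mu> dA (k # ks) as =
     moment_differential \<mu> d\<mu> dA ks (Some k # as) + (\<Sum>a\<in>UNIV. dA k a * \<mu> (map Some (rev ks) @ a # as))"

lemma pop_moment_perm: "mset as = mset bs \<Longrightarrow> pop_moment P as = pop_moment P bs"
  unfolding pop_moment_def monomial_def by (simp flip: prod_mset_prod_list)

text \<open>Each induction step is the product rule for one row, whose limit
  \<open>of_bool (a = Some k)\<close> selects a single coordinate. The total length of the two lists
  is constant, so only moments of degree at most \<open>d\<close> are met.\<close>

lemma first_order_mixed_moment:
  assumes \<eta>: "\<eta> \<in> o[F](\<lambda>_. 1)"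
    and A: "\<And>k a. first_order F \<eta> (\<lambda>i. A i k a) (of_bool (a = Some k)) (\<lambda>i. dA i k a)"
    and m: "\<And>as. length as \<le> d \<Longrightarrow>
       first_order F \<eta> (\<lambda>i. emp_moment (N i) (x i) as) (pop_moment P as) (\<lambda>i. dm i as)"
    and "length ks + length as \<le> d"
  shows "first_order F \<eta> (\<lambda>i. mixed_moment (N i) (x i) (A i) ks as)
     (pop_moment P (map Some (rev ks) @ as))
     (\<lambda>i. moment_differential (pop_moment P) (dm i) (dA i) ks as)"
  using assms(4)
proof (induction ks arbitrary: as)
  case Nil
  then show ?case using m[of as] by simp
next
  case (Cons k ks)
  have "first_order F \<eta>
     (\<lambda>i. \<Sum>a\<in>UNIV. A i k a * mixed_moment (N i) (x i) (A i) ks (a # as))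
     (\<Sum>a\<in>UNIV. of_bool (a = Some k) * pop_moment P (map Some (rev ks) @ a # as))
     (\<lambda>i. \<Sum>a\<in>UNIV. of_bool (a = Some k) * moment_differential (pop_moment P) (dm i) (dA i) ks (a # as)
        + dA i k a * pop_moment P (map Some (rev ks) @ a # as))"
    by (intro first_order_sum first_order_mult A Cons.IH \<eta>) (use Cons.prems in auto)
  then show ?case
    by (simp add: mixed_moment_Cons sum.distrib)
qed

subsection \<open>Moments\<close>

lemma borel_measurable_vec_nth [measurable (raw)]:
  fixes f :: "'a \<Rightarrow> ('b::euclidean_space)^'n"
  assumes "f \<in> borel_measurable M"
  shows "(\<lambda>x. f x $ i) \<in> borel_measurable M"
  by (rule borel_measurable_continuous_on[OF _ assms]) (intro continuous_intros)

lemma borel_measurable_coord [measurable]: "(\<lambda>v. coord v a) \<in> borel_measurable borel"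
  unfolding coord_def by (cases a) simp_all

lemma borel_measurable_monomial [measurable]: "(\<lambda>v. monomial v as) \<in> borel_measurable borel"
  unfolding monomial_def by (induction as) simp_all

text \<open>Reduces all integrability questions to the marginal moments of order \<open>2*d\<close>.
  With \<open>b\<close> the maximum of 1 and the absolute coordinates, the monomial is at most
  \<open>b ^ d\<close> in absolute value, and \<open>b ^ (2*d)\<close> is either 1 or one of the
  summands on the right.\<close>

lemma monomial_square_le:
  assumes "length as \<le> d"
  shows "(monomial v as)\<^sup>2 \<le> 1 + (\<Sum>k\<in>UNIV. (v$k)^(2*d))"
proof -
  define b where "b = Max (insert 1 (range (\<lambda>k. \<bar>v$k\<bar>)))"
  have b1: "1 \<le> b" and bk: "\<bar>v$k\<bar> \<le> b" for k unfolding b_def by (rule Max_ge; simp)+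
  have b: "\<bar>coord v a\<bar> \<le> b" for a
    using b1 bk by (auto simp: coord_def split: option.split)
  have "\<bar>monomial v as\<bar> \<le> b ^ length as"
  proof (induction as)
    case (Cons a as)
    have "\<bar>coord v a\<bar> * \<bar>monomial v as\<bar> \<le> b * b ^ length as"
      by (rule mult_mono[OF b Cons.IH]) (use b1 in auto)
    then show ?case by (simp add: monomial_def abs_mult)
  qed (simp add: monomial_def)
  also have "b ^ length as \<le> b ^ d" using assms b1 by (rule power_increasing)
  finally have "(monomial v as)\<^sup>2 \<le> (b ^ d)\<^sup>2"
    by (simp add: abs_le_square_iff[symmetric])
  also have "\<dots> = b ^ (2*d)" by (simp add: power_mult[symmetric] mult.commute)
  also have "\<dots> \<le> 1 + (\<Sum>k\<in>UNIV. (v$k)^(2*d))"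
  proof -
    have nn: "0 \<le> (v$k)^(2*d)" for k by (simp add: power_mult)
    have "b \<in> insert 1 (range (\<lambda>k. \<bar>v$k\<bar>))" unfolding b_def by (rule Max_in) auto
    then consider "b = 1" | k where "b = \<bar>v$k\<bar>" by auto
    then show ?thesis
    proof cases
      case 1
      then show ?thesis using nn by (simp add: sum_nonneg)
    next
      case 2
      have "b ^ (2*d) = (v$k)^(2*d)" using 2 by (simp add: power_mult)
      also have "\<dots> \<le> (\<Sum>k\<in>UNIV. (v$k)^(2*d))" using nn by (intro member_le_sum) auto
      finally show ?thesis by simp
    qed
  qed
  finally show ?thesis .
qed

lemma monomial_eq_prod: "monomial v as = (\<Prod>k\<in>UNIV. (v$k) ^ count_list as (Some k))"
proof (induction as)
  case Nil
  then show ?case by (simp add: monomial_def)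
next
  case (Cons a as)
  show ?case
  proof (cases a)
    case None
    then show ?thesis using Cons by (simp add: monomial_def coord_def)
  next
    case (Some j)
    have "(\<Prod>k\<in>UNIV. (v$k) ^ count_list (a # as) (Some k)) =
          (\<Prod>k\<in>UNIV. (if j = k then v$k else 1) * (v$k) ^ count_list as (Some k))"
      by (intro prod.cong) (auto simp: Some)
    also have "\<dots> = v$j * monomial v as"
      using Cons by (simp add: prod.distrib)
    finally show ?thesis using Some by (simp add: monomial_def coord_def)
  qed
qed

context
  fixes P :: "(real^'p) measure" and d :: nat
  assumes P: "standardized_independent P" and mom: "\<And>k. integrable P (\<lambda>x. (x$k)^(2*d))"
begin

lemma law_facts: "prob_space P" "sets P = sets borel" "independent_components P"
    "(\<integral>x. x$k \<partial>P) = 0" "(\<integral>x. (x$k)\<^sup>2 \<partial>P) = 1"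
  using P by (auto simp: standardized_independent_def square_integrable_law_def)

lemma law_measurable [measurable_cong]: "sets P = sets borel"
  by (rule law_facts)

lemma integrable_monomial_square:
  assumes "length as \<le> d"
  shows "integrable P (\<lambda>v. (monomial v as)\<^sup>2)"
proof -
  interpret P: prob_space P by (rule law_facts)
  show ?thesis
  proof (rule Bochner_Integration.integrable_bound)
    show "integrable P (\<lambda>v. 1 + (\<Sum>k\<in>UNIV. (v$k)^(2*d)))"
      using mom by (intro Bochner_Integration.integrable_add Bochner_Integration.integrable_sum) auto
    show "AE v in P. norm ((monomial v as)\<^sup>2) \<le> norm (1 + (\<Sum>k\<in>UNIV. (v$k)^(2*d)))"
      using monomial_square_le[OF assms] by (auto intro!: AE_I2 order_trans[OF _ abs_ge_self])
  qed measurable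
qed

lemma integrable_monomial:
  assumes "length as \<le> d"
  shows "integrable P (\<lambda>v. monomial v as)"
proof -
  interpret P: prob_space P by (rule law_facts)
  show ?thesis
    by (rule P.square_integrable_imp_integrable[OF _ integrable_monomial_square[OF assms]]) measurable
qed

lemma pop_moment_eq_prod:
  assumes "length as \<le> d"
  shows "pop_moment P as = (\<Prod>k\<in>UNIV. \<integral>x. (x$k) ^ count_list as (Some k) \<partial>P)"
proof -
  interpret P: prob_space P by (rule law_facts)
  have "P.indep_vars (\<lambda>_. borel) (\<lambda>k x. (x$k) ^ count_list as (Some k)) UNIV"
    using law_facts(3) unfolding independent_components_def
    by (rule P.indep_vars_compose2) measurable
  moreover have "integrable P (\<lambda>x. (x$k) ^ count_list as (Some k))" for k
  proof -
    have "(\<lambda>x. (x$k) ^ count_list as (Some k)) = (\<lambda>v. monomial v (replicate (count_list as (Some k)) (Some k)))"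
      by (auto simp: monomial_def coord_def prod_list_replicate)
    moreover have "count_list as (Some k) \<le> d" using assms count_le_length[of as "Some k"] by linarith
    ultimately show ?thesis using integrable_monomial by (metis length_replicate)
  qed
  ultimately show ?thesis
    unfolding pop_moment_def monomial_eq_prod by (intro P.indep_vars_lebesgue_integral) auto
qed

end

text \<open>Chebyshev's inequality: the summands \<open>X t\<close> are centred and pairwise
  uncorrelated, so the square of the scaled error has the same expectation \<open>v\<close> for
  every positive \<open>n\<close>.\<close>

lemma (in prob_space) OP1_sample_mean:
  fixes z :: "nat \<Rightarrow> 'a \<Rightarrow> 'b::topological_space" and g :: "'b \<Rightarrow> real"
  assumes ind: "indep_vars (\<lambda>_. borel) z UNIV" and law: "\<And>t. distr M borel (z t) = P"
    and g [measurable]: "g \<in> borel_measurable borel" and sq: "integrable P (\<lambda>v. (g v)\<^sup>2)"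
  shows "OP1 M (\<lambda>n \<omega>. sqrt (real n) * ((1 / real n) * (\<Sum>t<n. g (z t \<omega>)) - (\<integral>v. g v \<partial>P)))"
proof -
  have z [measurable]: "z t \<in> borel_measurable M" for t using ind by (auto simp: indep_vars_def)
  define \<mu> where "\<mu> = (\<integral>v. g v \<partial>P)"
  define X where "X t \<omega> = g (z t \<omega>) - \<mu>" for t \<omega>
  have X [measurable]: "X t \<in> borel_measurable M" for t unfolding X_def by measurable
  have sqz: "integrable M (\<lambda>\<omega>. (g (z t \<omega>))\<^sup>2)" for t
    using sq unfolding law[of t, symmetric] by (subst (asm) integrable_distr_eq) auto
  have gz: "integrable M (\<lambda>\<omega>. g (z t \<omega>))" for t
    by (rule square_integrable_imp_integrable[OF _ sqz]) measurable
  have \<mu>: "(\<integral>\<omega>. g (z t \<omega>) \<partial>M) = \<mu>" for t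
    unfolding \<mu>_def law[of t, symmetric] by (subst integral_distr) auto
  have Xi: "integrable M (X t)" and X0: "(\<integral>\<omega>. X t \<omega> \<partial>M) = 0" for t
    using gz \<mu> by (auto simp: X_def[abs_def] prob_space)
  have Xsq: "integrable M (\<lambda>\<omega>. (X t \<omega>)\<^sup>2)" for t
    unfolding X_def power2_diff using sqz gz by auto
  have indX: "indep_vars (\<lambda>_. borel) X UNIV"
    unfolding X_def using ind by (rule indep_vars_compose2) measurable
  have XX: "integrable M (\<lambda>\<omega>. X s \<omega> * X t \<omega>)" "(\<integral>\<omega>. X s \<omega> * X t \<omega> \<partial>M) = 0" if "s \<noteq> t" for s t
    using indep_vars_lebesgue_integral[of "{s, t}" X] indep_vars_integrable[of "{s, t}" X]
      indep_vars_subset[OF indX, of "{s, t}"] that Xi X0 by auto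
  have XX': "integrable M (\<lambda>\<omega>. X s \<omega> * X t \<omega>)" for s t
    using XX(1)[of s t] Xsq[of s] by (cases "s = t") (auto simp: power2_eq_square)
  define v where "v = (\<integral>w. (g w - \<mu>)\<^sup>2 \<partial>P)"
  have v: "(\<integral>\<omega>. X t \<omega> * X t \<omega> \<partial>M) = v" for t
    unfolding v_def law[of t, symmetric] X_def by (subst integral_distr) (auto simp: power2_eq_square)
  have Sq: "(\<lambda>\<omega>. (\<Sum>t<n. X t \<omega>)\<^sup>2) = (\<lambda>\<omega>. \<Sum>s<n. \<Sum>t<n. X s \<omega> * X t \<omega>)" for n
    by (simp add: power2_eq_square sum_product)
  have Si: "integrable M (\<lambda>\<omega>. (\<Sum>t<n. X t \<omega>)\<^sup>2)" for n
    unfolding Sq using XX' by auto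
  have Sv: "(\<integral>\<omega>. (\<Sum>t<n. X t \<omega>)\<^sup>2 \<partial>M) = real n * v" for n
  proof -
    have "(\<integral>\<omega>. (\<Sum>t<n. X t \<omega>)\<^sup>2 \<partial>M) = (\<Sum>s<n. \<Sum>t<n. \<integral>\<omega>. X s \<omega> * X t \<omega> \<partial>M)"
      unfolding Sq using XX' by simp
    also have "\<dots> = (\<Sum>s<n. \<Sum>t<n. if s = t then v else 0)"
      using XX(2) v by (intro sum.cong) auto
    finally show ?thesis by simp
  qed
  have v0: "0 \<le> v" unfolding v_def by simp
  show ?thesis
    unfolding OP1_def \<mu>_def[symmetric]
  proof (intro allI impI)
    fix \<epsilon> :: real assume \<epsilon>: "0 < \<epsilon>"
    \<comment> \<open>The added 1 keeps \<open>K\<close> positive when \<open>v = 0\<close> and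
      makes \<open>v / K\<^sup>2 < \<epsilon>\<close> strict.\<close>
    define K where "K = sqrt ((v + 1) / \<epsilon>)"
    have K: "0 < K" "v / K\<^sup>2 < \<epsilon>" using \<epsilon> v0 by (auto simp: K_def field_simps)
    have "measure M {\<omega>\<in>space M. norm (sqrt (real n) * ((1 / real n) * (\<Sum>t<n. g (z t \<omega>)) - \<mu>)) > K} < \<epsilon>"
      if n: "0 < n" for n
    proof -
      have eq: "(sqrt (real n) * ((1 / real n) * (\<Sum>t<n. g (z t \<omega>)) - \<mu>))\<^sup>2 = (\<Sum>t<n. X t \<omega>)\<^sup>2 / real n" for \<omega>
      proof -
        have "(1 / real n) * (\<Sum>t<n. g (z t \<omega>)) - \<mu> = (\<Sum>t<n. X t \<omega>) / real n"
          using n by (simp add: X_def sum_subtractf field_simps)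
        then show ?thesis using n
          by (simp add: power_mult_distrib power_divide) (simp add: power2_eq_square[of "real n"])
      qed
      have "measure M {\<omega>\<in>space M. norm (sqrt (real n) * ((1 / real n) * (\<Sum>t<n. g (z t \<omega>)) - \<mu>)) > K}
          \<le> measure M {\<omega>\<in>space M. (\<Sum>t<n. X t \<omega>)\<^sup>2 / real n \<ge> K\<^sup>2}"
      proof (rule finite_measure_mono)
        show "{\<omega>\<in>space M. norm (sqrt (real n) * ((1 / real n) * (\<Sum>t<n. g (z t \<omega>)) - \<mu>)) > K}
            \<subseteq> {\<omega>\<in>space M. (\<Sum>t<n. X t \<omega>)\<^sup>2 / real n \<ge> K\<^sup>2}"
        proof clarify
          fix \<omega> assume "norm (sqrt (real n) * ((1 / real n) * (\<Sum>t<n. g (z t \<omega>)) - \<mu>)) > K"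
          then have "K\<^sup>2 \<le> (sqrt (real n) * ((1 / real n) * (\<Sum>t<n. g (z t \<omega>)) - \<mu>))\<^sup>2"
            using K(1) by (metis abs_le_square_iff abs_of_pos less_imp_le real_norm_def)
          then show "K\<^sup>2 \<le> (\<Sum>t<n. X t \<omega>)\<^sup>2 / real n" unfolding eq .
        qed
      qed measurable
      also have "\<dots> \<le> (\<integral>\<omega>. (\<Sum>t<n. X t \<omega>)\<^sup>2 / real n \<partial>M) / K\<^sup>2"
        by (rule integral_Markov_inequality_measure[where A = "{}"])
           (use Si K in \<open>auto intro!: Bochner_Integration.integrable_divide\<close>)
      also have "\<dots> = v / K\<^sup>2" using n Sv by simp
      finally show ?thesis using K by simp
    qed
    then show "\<exists>K. \<forall>\<^sub>F n in sequentially. measure M {\<omega>\<in>space M. norm (sqrt (real n) * ((1 / real n) * (\<Sum>t<n. g (z t \<omega>)) - \<mu>)) > K} < \<epsilon>"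
      by (intro exI[of _ K]) (rule eventually_mono[OF eventually_gt_at_top[of 0]])
  qed
qed

section \<open>Population moments up to order four\<close>

context
  fixes P :: "(real^'p) measure" and d :: nat
  assumes P: "standardized_independent P" and mom: "\<And>k. integrable P (\<lambda>x. (x$k)^(2*d))"
begin

text \<open>By independence, the mean of a coordinate that occurs exactly once splits off as a
  factor.\<close>

lemma pop_moment_zero:
  assumes "length as \<le> d" "count_list as (Some k) = 1"
  shows "pop_moment P as = 0"
proof -
  have "(\<integral>x. (x$k) ^ count_list as (Some k) \<partial>P) = 0"
    using law_facts(4)[OF P mom] assms(2) by simp
  then show ?thesis unfolding pop_moment_eq_prod[OF P mom assms(1)] by (intro prod_zero) auto
qed

lemma pop_moment_one:
  assumes "length as \<le> d" "set as \<subseteq> {None, Some k}" and m: "count_list as (Some k) = m"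
  shows "pop_moment P as = (\<integral>x. (x$k) ^ m \<partial>P)"
proof -
  interpret P: prob_space P by (rule law_facts[OF P mom])
  have "(\<integral>x. (x$j) ^ count_list as (Some j) \<partial>P) = (if j = k then (\<integral>x. (x$k) ^ m \<partial>P) else 1)" for j
  proof (cases "j = k")
    case False
    then have "count_list as (Some j) = 0" using assms(2) by (auto simp: count_list_0_iff)
    then show ?thesis using False by (simp add: P.prob_space)
  qed (simp add: m)
  then show ?thesis unfolding pop_moment_eq_prod[OF P mom assms(1)] by simp
qed

lemma pop_moment_two:
  assumes "length as \<le> d" "k \<noteq> l" "set as \<subseteq> {None, Some k, Some l}"
    "count_list as (Some k) = 2" "count_list as (Some l) = 2"
  shows "pop_moment P as = 1"
proof -
  interpret P: prob_space P by (rule law_facts[OF P mom])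
  have "(\<integral>x. (x$j) ^ count_list as (Some j) \<partial>P) = 1" for j
  proof (cases "j = k \<or> j = l")
    case False
    then have "count_list as (Some j) = 0" using assms(3) by (auto simp: count_list_0_iff)
    then show ?thesis by (simp add: P.prob_space)
  next
    case True
    then show ?thesis using assms law_facts(5)[OF P mom] by auto
  qed
  then show ?thesis unfolding pop_moment_eq_prod[OF P mom assms(1)] by simp
qed

lemma pop_moment_mean: "1 \<le> d \<Longrightarrow> pop_moment P [Some k] = 0"
  by (rule pop_moment_zero[where k = k]) auto

lemma pop_moment_cov:
  assumes "2 \<le> d"
  shows "pop_moment P [Some l, Some k] = of_bool (k = l)"
proof (cases "k = l")
  case True
  have "pop_moment P [Some l, Some k] = (\<integral>x. (x$k) ^ 2 \<partial>P)"
    by (rule pop_moment_one) (use assms True in auto)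
  then show ?thesis using True law_facts(5)[OF P mom] by simp
next
  case False
  have "pop_moment P [Some l, Some k] = 0"
    by (rule pop_moment_zero[where k = k]) (use assms False in auto)
  then show ?thesis using False by simp
qed

text \<open>The slot \<open>a\<close> is the place of a perturbed row in
  \<open>moment_differential\<close>; the other two slots hold the coordinates of unperturbed
  factors.\<close>

lemma pop_moment_third:
  assumes d: "3 \<le> d"
  shows "pop_moment P [Some l, a, Some j] =
    (if j = l then (case a of None \<Rightarrow> 1 | Some b \<Rightarrow> of_bool (b = l) * skew P l) else 0)"
proof -
  consider (1) "j = l" "a = None" | (2) "j = l" "a = Some l" | (3) b where "j = l" "a = Some b" "b \<noteq> l"
    | (4) "j \<noteq> l" "a = Some l" | (5) "j \<noteq> l" "a \<noteq> Some l"
    by (cases a) auto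
  then show ?thesis
  proof cases
    case 1
    have "pop_moment P [Some l, a, Some j] = (\<integral>x. (x$l) ^ 2 \<partial>P)"
      by (rule pop_moment_one) (use d 1 in auto)
    then show ?thesis using 1 law_facts(5)[OF P mom] by simp
  next
    case 2
    have "pop_moment P [Some l, a, Some j] = (\<integral>x. (x$l) ^ 3 \<partial>P)"
      by (rule pop_moment_one) (use d 2 in auto)
    then show ?thesis using 2 by (simp add: skew_def)
  next
    case (3 b)
    have "pop_moment P [Some l, a, Some j] = 0"
      by (rule pop_moment_zero[where k = b]) (use d 3 in auto)
    then show ?thesis using 3 by simp
  next
    case 4
    have "pop_moment P [Some l, a, Some j] = 0"
      by (rule pop_moment_zero[where k = j]) (use d 4 in auto)
    then show ?thesis using 4 by simp
  next
    case 5
    have "pop_moment P [Some l, a, Some j] = 0"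
      by (rule pop_moment_zero[where k = l]) (use d 5 in auto)
    then show ?thesis using 5 by simp
  qed
qed

lemma pop_moment_fourth:
  assumes d: "4 \<le> d"
  shows "pop_moment P [Some l, a, Some j, Some j] =
    (case a of None \<Rightarrow> of_bool (j = l) * skew P l
     | Some b \<Rightarrow> of_bool (b = l) * (if j = l then kurt P l + 3 else 1))"
proof -
  consider (1) "j = l" "a = None" | (2) "j = l" "a = Some l" | (3) b where "j = l" "a = Some b" "b \<noteq> l"
    | (4) "j \<noteq> l" "a = Some l" | (5) "j \<noteq> l" "a \<noteq> Some l"
    by (cases a) auto
  then show ?thesis
  proof cases
    case 1
    have "pop_moment P [Some l, a, Some j, Some j] = (\<integral>x. (x$l) ^ 3 \<partial>P)"
      by (rule pop_moment_one) (use d 1 in auto)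
    then show ?thesis using 1 by (simp add: skew_def)
  next
    case 2
    have "pop_moment P [Some l, a, Some j, Some j] = (\<integral>x. (x$l) ^ 4 \<partial>P)"
      by (rule pop_moment_one) (use d 2 in auto)
    then show ?thesis using 2 by (simp add: kurt_def)
  next
    case (3 b)
    have "pop_moment P [Some l, a, Some j, Some j] = 0"
      by (rule pop_moment_zero[where k = b]) (use d 3 in auto)
    then show ?thesis using 3 by simp
  next
    case 4
    have "pop_moment P [Some l, a, Some j, Some j] = 1"
      by (rule pop_moment_two[where k = l and l = j]) (use d 4 in auto)
    then show ?thesis using 4 by simp
  next
    case 5
    have "pop_moment P [Some l, a, Some j, Some j] = 0"
      by (rule pop_moment_zero[where k = l]) (use d 5 in auto)
    then show ?thesis using 5 by (auto split: option.split)
  qed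
qed

text \<open>Here the perturbed row is one of the two factors \<open>j\<close> in the fourth moment.
  As \<open>k \<noteq> l\<close>, the moment survives only if \<open>a\<close> and \<open>j\<close>
  pair off with \<open>k\<close> and \<open>l\<close>.\<close>

lemma pop_moment_fourth_mixed:
  assumes "4 \<le> d" "k \<noteq> l"
  shows "pop_moment P [Some l, Some k, a, Some j] = of_bool (j = k \<and> a = Some l) + of_bool (j = l \<and> a = Some k)"
proof -
  let ?as = "[Some l, Some k, a, Some j]"
  have kl: "l \<noteq> k" using assms by blast
  consider (1) "j = k" "a = Some l" | (2) "j = l" "a = Some k" | (3) "j = k" "a \<noteq> Some l"
    | (4) "j = l" "a \<noteq> Some k" | (5) "j \<noteq> k" "j \<noteq> l" "a = Some k" | (6) "j \<noteq> k" "j \<noteq> l" "a \<noteq> Some k"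
    by blast
  then show ?thesis
  proof cases
    case 1
    have "pop_moment P ?as = 1"
      by (rule pop_moment_two[where k = k and l = l]) (use assms kl 1 in simp_all)
    then show ?thesis using 1 kl by simp
  next
    case 2
    have "pop_moment P ?as = 1"
      by (rule pop_moment_two[where k = k and l = l]) (use assms kl 2 in simp_all)
    then show ?thesis using 2 kl by simp
  next
    case 3
    have "pop_moment P ?as = 0"
      by (rule pop_moment_zero[where k = l]) (use assms kl 3 in simp_all)
    then show ?thesis using 3 kl by simp
  next
    case 4
    have "pop_moment P ?as = 0"
      by (rule pop_moment_zero[where k = k]) (use assms kl 4 in simp_all)
    then show ?thesis using 4 kl by simp
  next
    case 5
    have "pop_moment P ?as = 0"
      by (rule pop_moment_zero[where k = l]) (use assms kl 5 in simp_all)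
    then show ?thesis using 5 kl by simp
  next
    case 6
    have "pop_moment P ?as = 0"
      by (rule pop_moment_zero[where k = k]) (use assms kl 6 in simp_all)
    then show ?thesis using 6 kl by simp
  qed
qed

end

section \<open>The linearizing statistics in terms of raw sample moments\<close>

lemma sum_option_UNIV: "(\<Sum>a\<in>UNIV. f a) = f None + (\<Sum>j\<in>UNIV. f (Some j))" for f :: "'p::finite option \<Rightarrow> real"
  by (simp add: UNIV_option_conv sum.reindex)

lemma sum_split_two:
  fixes f :: "'p::finite \<Rightarrow> real"
  assumes "k \<noteq> l"
  shows "(\<Sum>j\<in>UNIV. f j) = f k + f l + (\<Sum>j\<in>UNIV - {k, l}. f j)"
proof -
  have "UNIV - {k} - {l} = UNIV - {k, l}" by auto
  then show ?thesis
    using assms sum.remove[of UNIV k f] sum.remove[of "UNIV - {k}" l f] by auto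
qed

lemma s_hat_eq: "s_hat n x k l = emp_moment n x [Some l, Some k]"
  by (simp add: s_hat_def emp_moment_def monomial_def coord_def mult_ac)

text \<open>The terms \<open>j = k\<close> and \<open>j = l\<close> of the full sum are uncentred
  versions of \<open>r_hat n x k l\<close> and \<open>r_hat n x l k\<close>; the centring by 1 in
  these produces the two first moments.\<close>

lemma psi1_hat_eq:
  assumes "k \<noteq> l"
  shows "psi1_hat P n x k l = (\<Sum>j\<in>UNIV. emp_moment n x [Some l, Some k, Some j])
    - emp_moment n x [Some k] - emp_moment n x [Some l] - skew P k * emp_moment n x [Some l, Some k]"
proof -
  have "(\<Sum>j\<in>UNIV. emp_moment n x [Some l, Some k, Some j]) =
    emp_moment n x [Some l, Some k, Some k] + emp_moment n x [Some l, Some k, Some l] +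
    (\<Sum>j\<in>UNIV - {k, l}. emp_moment n x [Some l, Some k, Some j])"
    by (rule sum_split_two[OF assms])
  moreover have "r_hat n x k l = emp_moment n x [Some l, Some k, Some k] - emp_moment n x [Some l]"
    "r_hat n x l k = emp_moment n x [Some l, Some k, Some l] - emp_moment n x [Some k]"
    by (simp_all add: r_hat_def emp_moment_def monomial_def coord_def sum_subtractf algebra_simps power2_eq_square)
  moreover have "r_hat3 n x j k l = emp_moment n x [Some l, Some k, Some j]" for j
    by (simp add: r_hat3_def emp_moment_def monomial_def coord_def mult_ac)
  ultimately show ?thesis by (simp add: psi1_hat_def s_hat_eq)
qed

text \<open>The same regrouping; the centring is now by the skewness, which becomes the coefficient
  of the first moments.\<close>

lemma psi2_hat_eq:
  fixes P :: "(real^'p) measure"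
  assumes "k \<noteq> l"
  shows "psi2_hat P n x k l = (\<Sum>j\<in>UNIV. emp_moment n x [Some l, Some k, Some j, Some j])
    - skew P k * emp_moment n x [Some l] - skew P l * emp_moment n x [Some k]
    - (kurt P k + real CARD('p) + 4) * emp_moment n x [Some l, Some k]"
proof -
  have "(\<Sum>j\<in>UNIV. emp_moment n x [Some l, Some k, Some j, Some j]) =
    emp_moment n x [Some l, Some k, Some k, Some k] + emp_moment n x [Some l, Some k, Some l, Some l] +
    (\<Sum>j\<in>UNIV - {k, l}. emp_moment n x [Some l, Some k, Some j, Some j])"
    by (rule sum_split_two[OF assms])
  moreover have "q_hat P n x k l = emp_moment n x [Some l, Some k, Some k, Some k] - skew P k * emp_moment n x [Some l]"
    "q_hat P n x l k = emp_moment n x [Some l, Some k, Some l, Some l] - skew P l * emp_moment n x [Some k]"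
    by (simp_all add: q_hat_def emp_moment_def monomial_def coord_def sum_subtractf sum_distrib_left algebra_simps power3_eq_cube)
  moreover have "q_hat3 n x j k l = emp_moment n x [Some l, Some k, Some j, Some j]" for j
    by (simp add: q_hat3_def emp_moment_def monomial_def coord_def mult_ac power2_eq_square)
  ultimately show ?thesis by (simp add: psi2_hat_def s_hat_eq)
qed

subsection \<open>Expansion of the cumulant matrices\<close>

definition emp_C3 :: "nat \<Rightarrow> (nat \<Rightarrow> real^'p) \<Rightarrow> ('p \<Rightarrow> 'p option \<Rightarrow> real) \<Rightarrow> 'p \<Rightarrow> 'p \<Rightarrow> real" where
  "emp_C3 n x A k l = (\<Sum>j\<in>UNIV. mixed_moment n x A [j, k, l] [])"

definition emp_C4 :: "nat \<Rightarrow> (nat \<Rightarrow> real^'p) \<Rightarrow> ('p \<Rightarrow> 'p option \<Rightarrow> real) \<Rightarrow> 'p \<Rightarrow> 'p \<Rightarrow> real" where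
  "emp_C4 n x A k l = (\<Sum>j\<in>UNIV. mixed_moment n x A [j, j, k, l] []
     - mixed_moment n x A [j, j] [] * mixed_moment n x A [k, l] []
     - mixed_moment n x A [j, k] [] * mixed_moment n x A [j, l] []
     - mixed_moment n x A [j, k] [] * mixed_moment n x A [j, l] [])"

lemma sum_of_bool_single:
  fixes c :: real
  shows "(\<Sum>j\<in>UNIV. f j * (of_bool ((j::'p::finite) = l) * c)) = f l * c"
    and "(\<Sum>j\<in>UNIV. of_bool ((j::'p::finite) = l) * c) = c"
proof -
  have "(\<Sum>j\<in>UNIV. f j * (of_bool (j = l) * c)) = (\<Sum>j\<in>UNIV. if j = l then f l * c else 0)"
    "(\<Sum>j\<in>UNIV. of_bool (j = l) * c) = (\<Sum>j\<in>UNIV. if j = l then c else 0)"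
    by (intro sum.cong; simp)+
  then show "(\<Sum>j\<in>UNIV. f j * (of_bool (j = l) * c)) = f l * c"
    "(\<Sum>j\<in>UNIV. of_bool (j = l) * c) = c" by simp_all
qed

text \<open>The deterministic part, over an arbitrary filter and error scale. That \<open>V\<close>
  comes from a standardization enters only through \<open>white\<close>, an exact identity that
  holds eventually.\<close>

locale moment_expansion =
  fixes P :: "(real^'p) measure" and d :: nat and F :: "'i filter" and \<eta> :: "'i \<Rightarrow> real"
    and N :: "'i \<Rightarrow> nat" and x :: "'i \<Rightarrow> nat \<Rightarrow> real^'p" and V :: "'i \<Rightarrow> real^'p^'p"
  assumes P: "standardized_independent P" and mom: "\<And>k. integrable P (\<lambda>x. (x$k)^(2*d))"
    and d3: "3 \<le> d"
    and \<eta>: "\<eta> \<in> o[F](\<lambda>_. 1)"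
    and V: "\<And>k l. (\<lambda>i. V i$k$l - of_bool (k = l)) \<in> O[F](\<eta>)"
    and m: "\<And>as. length as \<le> d \<Longrightarrow> (\<lambda>i. emp_moment (N i) (x i) as - pop_moment P as) \<in> O[F](\<eta>)"
    and white: "\<And>k l. eventually (\<lambda>i. mixed_moment (N i) (x i) (centering (N i) (x i) (V i)) [k, l] [] = of_bool (k = l)) F"
begin

abbreviation (input) A where "A i \<equiv> centering (N i) (x i) (V i)"
abbreviation (input) em where "em i as \<equiv> emp_moment (N i) (x i) as"
abbreviation (input) dm where "dm i as \<equiv> em i as - pop_moment P as"

text \<open>The differential of \<open>centering\<close>. In the constant coordinate the matrix
  \<open>V\<close> disappears: the sample mean is itself a first order quantity, so replacing
  \<open>V\<close> by the identity there costs only a second order term.\<close>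

definition dA :: "'i \<Rightarrow> 'p \<Rightarrow> 'p option \<Rightarrow> real" where
  "dA i k a = (case a of None \<Rightarrow> - em i [Some k] | Some j \<Rightarrow> V i$k$j - of_bool (k = j))"

lemma first_order_V: "first_order F \<eta> (\<lambda>i. V i$k$l) (of_bool (k = l)) (\<lambda>i. V i$k$l - of_bool (k = l))"
  by (rule first_orderI[OF V])

lemma first_order_emp_moment: "length as \<le> d \<Longrightarrow> first_order F \<eta> (\<lambda>i. em i as) (pop_moment P as) (\<lambda>i. dm i as)"
  by (rule first_orderI[OF m])

lemma first_order_centering: "first_order F \<eta> (\<lambda>i. A i k a) (of_bool (a = Some k)) (\<lambda>i. dA i k a)"
proof (cases a)
  case None
  have pm: "pop_moment P [Some j] = 0" for j using pop_moment_mean[OF P mom] d3 by simp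
  have "first_order F \<eta> (\<lambda>i. \<Sum>j\<in>UNIV. V i$k$j * em i [Some j])
      (\<Sum>j\<in>UNIV. of_bool (k = j) * pop_moment P [Some j])
      (\<lambda>i. \<Sum>j\<in>UNIV. of_bool (k = j) * dm i [Some j] + (V i$k$j - of_bool (k = j)) * pop_moment P [Some j])"
    by (intro first_order_sum first_order_mult[OF _ _ \<eta>] first_order_V first_order_emp_moment) (use d3 in auto)
  then have "first_order F \<eta> (\<lambda>i. \<Sum>j\<in>UNIV. V i$k$j * em i [Some j]) 0 (\<lambda>i. em i [Some k])"
    by (simp add: pm)
  from first_order_cmult[OF this, of "-1"] show ?thesis
    using None by (simp add: centering_def dA_def)
next
  case (Some j)
  then show ?thesis using first_order_V[of k j] by (auto simp: centering_def dA_def)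
qed

lemma first_order_moment:
  "length ks \<le> d \<Longrightarrow> first_order F \<eta> (\<lambda>i. mixed_moment (N i) (x i) (A i) ks [])
     (pop_moment P (map Some (rev ks))) (\<lambda>i. moment_differential (pop_moment P) (dm i) (dA i) ks [])"
  using first_order_mixed_moment[OF \<eta> first_order_centering first_order_emp_moment, where as = "[]" and d = d]
  by simp

text \<open>The exact covariance identity has the constant differential 0; comparing it with the
  differential of the second mixed moment gives the relation between \<open>V$k$l + V$l$k\<close>
  and the sample covariance.\<close>

lemma white_differential:
  "(\<lambda>i. dA i k (Some l) + dA i l (Some k) + (em i [Some l, Some k] - of_bool (k = l))) \<in> o[F](\<eta>)"
proof -
  have cov: "pop_moment P [Some l, Some k] = of_bool (k = l)" for k l
    by (rule pop_moment_cov[OF P mom]) (use d3 in simp)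
  have pm: "pop_moment P [Some l, a] = of_bool (a = Some l)" for a l
  proof (cases a)
    case None
    have "pop_moment P [Some l, None] = 0"
      by (rule pop_moment_zero[OF P mom, where k = l]) (use d3 in simp_all)
    then show ?thesis using None by simp
  qed (simp add: cov)
  have pm': "pop_moment P [a, Some k] = of_bool (a = Some k)" for a
    using pm[of k a] pop_moment_perm[of "[a, Some k]" "[Some k, a]" P] by (simp add: add_mset_commute)
  have 1: "first_order F \<eta> (\<lambda>i. mixed_moment (N i) (x i) (A i) [k, l] []) (of_bool (k = l))
      (\<lambda>i. em i [Some l, Some k] - of_bool (k = l) + dA i l (Some k) + dA i k (Some l))"
    using first_order_moment[of "[k, l]"] d3 by (simp add: pm pm' cov eq_commute[of l k])
  have 2: "first_order F \<eta> (\<lambda>i. mixed_moment (N i) (x i) (A i) [k, l] []) (of_bool (k = l)) (\<lambda>_. 0)"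
    by (rule first_order_cong[OF first_order_const[of F \<eta> "of_bool (k = l)"]])
       (use white[of k l] in \<open>auto elim: eventually_mono\<close>)
  show ?thesis
    using first_order_unique[OF 1 2] by (simp add: algebra_simps)
qed

text \<open>The diagonal case of the whiteness relation. It supplies the whole diagonal expansion of
  the solution, because orthogonality makes \<open>U$k$k - 1\<close> negligible.\<close>

lemma first_order_V_diagonal:
  "(\<lambda>i. V i$k$k - 1 + (s_hat (N i) (x i) k k - 1) / 2) \<in> o[F](\<eta>)"
proof -
  have "(\<lambda>i. (dA i k (Some k) + dA i k (Some k) + (em i [Some k, Some k] - of_bool (k = k))) / 2) \<in> o[F](\<eta>)"
    using white_differential[of k k] by simp
  then show ?thesis by (simp add: dA_def s_hat_eq field_simps)
qed

text \<open>Off the diagonal, varying row \<open>k\<close> contributes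
  \<open>\<gamma>\<^sub>l V\<^sub>k\<^sub>l\<close>, varying row \<open>l\<close> contributes
  \<open>\<gamma>\<^sub>k V\<^sub>l\<^sub>k\<close>, and the constant coordinates supply the first
  moments contained in \<open>psi1_hat\<close>. Whiteness then eliminates
  \<open>V\<^sub>l\<^sub>k\<close>.\<close>

lemma first_order_C3:
  shows "k = l \<Longrightarrow> \<exists>e. first_order F \<eta> (\<lambda>i. emp_C3 (N i) (x i) (A i) k l) (skew P k) e"
    and "k \<noteq> l \<Longrightarrow> first_order F \<eta> (\<lambda>i. emp_C3 (N i) (x i) (A i) k l) 0
      (\<lambda>i. psi1_hat P (N i) (x i) k l - (skew P k - skew P l) * V i$k$l)"
proof -
  have 1: "first_order F \<eta> (\<lambda>i. emp_C3 (N i) (x i) (A i) k l)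
     (\<Sum>j\<in>UNIV. pop_moment P [Some l, Some k, Some j])
     (\<lambda>i. \<Sum>j\<in>UNIV. moment_differential (pop_moment P) (dm i) (dA i) [j, k, l] [])"
    unfolding emp_C3_def
    by (intro first_order_sum) (use first_order_moment[of "[j, k, l]" for j] d3 in simp)
  have T: "pop_moment P [Some l, a, Some j] =
    (if j = l then (case a of None \<Rightarrow> 1 | Some b \<Rightarrow> of_bool (b = l) * skew P l) else 0)" for l a j
    by (rule pop_moment_third[OF P mom d3])
  have T': "pop_moment P [a, Some l, Some j] = pop_moment P [Some l, a, Some j]" for l a j
    by (rule pop_moment_perm) simp
  have z: "(\<Sum>j\<in>UNIV. pop_moment P [Some l, Some k, Some j]) = of_bool (k = l) * skew P k"
    by (simp add: T)
  show "\<exists>e. first_order F \<eta> (\<lambda>i. emp_C3 (N i) (x i) (A i) k l) (skew P k) e" if "k = l"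
    using 1 z that by auto
  show "first_order F \<eta> (\<lambda>i. emp_C3 (N i) (x i) (A i) k l) 0
      (\<lambda>i. psi1_hat P (N i) (x i) k l - (skew P k - skew P l) * V i$k$l)" if kl: "k \<noteq> l"
  proof (rule first_order_cong[OF 1])
    \<comment> \<open>Consequently a variation of the summed factor \<open>j\<close> has no first
      order effect, and only the rows \<open>k\<close> and \<open>l\<close> matter.\<close>
    have T0: "pop_moment P [Some l, Some k, a] = 0" for a
    proof -
      have "pop_moment P [Some l, Some k, a] = pop_moment P [Some l, a, Some k]"
        by (rule pop_moment_perm) simp
      then show ?thesis using kl by (simp add: T)
    qed
    have "(\<Sum>j\<in>UNIV. moment_differential (pop_moment P) (dm i) (dA i) [j, k, l] []) =
      (\<Sum>j\<in>UNIV. em i [Some l, Some k, Some j]) + (dA i l None + dA i l (Some k) * skew P k)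
        + (dA i k None + dA i k (Some l) * skew P l)" for i
    proof -
      have s: "(\<Sum>j\<in>UNIV. \<Sum>a\<in>UNIV. dA i k a * pop_moment P [Some l, a, Some j]) = dA i k None + dA i k (Some l) * skew P l" for k l
        by (subst sum.swap) (simp add: T sum_option_UNIV sum_of_bool_single flip: sum_distrib_left)
      have s': "(\<Sum>j\<in>UNIV. \<Sum>a\<in>UNIV. dA i k a * pop_moment P [a, Some l, Some j]) = dA i k None + dA i k (Some l) * skew P l" for k l
        by (simp only: T' s)
      show ?thesis
        by (simp add: sum.distrib s s' T0)
    qed
    \<comment> \<open>The discrepancy is exactly \<open>skew P k\<close> times the left side of the
      whiteness relation; this is the origin of the term \<open>- skew P k * s_hat n x k l\<close>
      in \<open>psi1_hat\<close>.\<close>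
    then have eq: "(\<Sum>j\<in>UNIV. moment_differential (pop_moment P) (dm i) (dA i) [j, k, l] [])
        - (psi1_hat P (N i) (x i) k l - (skew P k - skew P l) * V i$k$l)
        = skew P k * (dA i k (Some l) + dA i l (Some k) + em i [Some l, Some k])" for i
      using kl by (simp add: psi1_hat_eq dA_def algebra_simps)
    show "(\<lambda>i. (\<Sum>j\<in>UNIV. moment_differential (pop_moment P) (dm i) (dA i) [j, k, l] [])
        - (psi1_hat P (N i) (x i) k l - (skew P k - skew P l) * V i$k$l)) \<in> o[F](\<eta>)"
      unfolding eq using white_differential[of k l] kl by simp
  qed (use z kl in auto)
qed

text \<open>The pattern of the third order case, with two additional effects: the moments
  \<open>E(x\<^sub>j\<^sup>2 x\<^sub>l\<^sup>2) = 1\<close> for \<open>j \<noteq> l\<close>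
  contribute \<open>p - 1\<close>, and varying the two factors \<open>j\<close> no longer cancels
  out.\<close>

lemma first_order_C4:
  assumes d4: "4 \<le> d"
  shows "k = l \<Longrightarrow> \<exists>e. first_order F \<eta> (\<lambda>i. emp_C4 (N i) (x i) (A i) k l) (kurt P k) e"
    and "k \<noteq> l \<Longrightarrow> first_order F \<eta> (\<lambda>i. emp_C4 (N i) (x i) (A i) k l) 0
      (\<lambda>i. psi2_hat P (N i) (x i) k l - (kurt P k - kurt P l) * V i$k$l)"
proof -
  have ev: "eventually (\<lambda>i. \<forall>k l. mixed_moment (N i) (x i) (A i) [k, l] [] = of_bool (k = l)) F"
    by (intro eventually_all_finite white)
  have Q: "pop_moment P [Some l, a, Some j, Some j] =
    (case a of None \<Rightarrow> of_bool (j = l) * skew P l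
     | Some b \<Rightarrow> of_bool (b = l) * (if j = l then kurt P l + 3 else 1))" for l a j
    by (rule pop_moment_fourth[OF P mom d4])
  have Q': "pop_moment P [a, Some l, Some j, Some j] = pop_moment P [Some l, a, Some j, Some j]" for l a j
    by (rule pop_moment_perm) simp
  have c: "(\<Sum>j\<in>UNIV. if j = l then kurt P l + 3 else 1) = kurt P l + real CARD('p) + 2" for l
    by (subst sum.remove[of UNIV l]) auto
  have 0: "first_order F \<eta> (\<lambda>i. \<Sum>j\<in>UNIV. mixed_moment (N i) (x i) (A i) [j, j, k, l] [])
     (\<Sum>j\<in>UNIV. pop_moment P [Some l, Some k, Some j, Some j])
     (\<lambda>i. \<Sum>j\<in>UNIV. moment_differential (pop_moment P) (dm i) (dA i) [j, j, k, l] [])"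
    by (intro first_order_sum) (use first_order_moment[of "[j, j, k, l]" for j] d4 in simp)
  have z: "(\<Sum>j\<in>UNIV. pop_moment P [Some l, Some k, Some j, Some j]) = of_bool (k = l) * (kurt P k + real CARD('p) + 2)"
    by (auto simp: Q c)
  \<comment> \<open>On white data the subtracted products are deterministic: the first one sums to
    \<open>p\<close> on the diagonal and the other two to 1 each, which gives \<open>p + 2\<close>
    for \<open>k = l\<close> and 0 otherwise.\<close>
  have 1: "first_order F \<eta> (\<lambda>i. emp_C4 (N i) (x i) (A i) k l) (of_bool (k = l) * kurt P k)
     (\<lambda>i. \<Sum>j\<in>UNIV. moment_differential (pop_moment P) (dm i) (dA i) [j, j, k, l] [])"
  proof (rule first_order_cong[OF first_order_diff[OF 0 first_order_const[of F \<eta> "of_bool (k = l) * (real CARD('p) + 2)"]]])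
    show "\<forall>\<^sub>F i in F. (\<Sum>j\<in>UNIV. mixed_moment (N i) (x i) (A i) [j, j, k, l] []) - of_bool (k = l) * (real CARD('p) + 2)
        = emp_C4 (N i) (x i) (A i) k l"
      using ev
    proof eventually_elim
      case (elim i)
      have "emp_C4 (N i) (x i) (A i) k l = (\<Sum>j\<in>UNIV. mixed_moment (N i) (x i) (A i) [j, j, k, l] []
          - of_bool (k = l) - 2 * (if j = k then of_bool (k = l) else 0))"
        unfolding emp_C4_def using elim by (intro sum.cong) auto
      then show ?case by (simp add: sum_subtractf flip: sum_distrib_left)
    qed
  qed (auto simp: z)
  show "\<exists>e. first_order F \<eta> (\<lambda>i. emp_C4 (N i) (x i) (A i) k l) (kurt P k) e" if "k = l"
    using 1 that by auto
  show "first_order F \<eta> (\<lambda>i. emp_C4 (N i) (x i) (A i) k l) 0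
      (\<lambda>i. psi2_hat P (N i) (x i) k l - (kurt P k - kurt P l) * V i$k$l)" if kl: "k \<noteq> l"
  proof (rule first_order_cong[OF 1])
    have Qm: "pop_moment P [Some l, Some k, a, Some j] = of_bool (j = k \<and> a = Some l) + of_bool (j = l \<and> a = Some k)" for a j
      by (rule pop_moment_fourth_mixed[OF P mom d4 kl])
    have Qm': "pop_moment P [Some l, Some k, Some j, a] = pop_moment P [Some l, Some k, a, Some j]" for a j
      by (rule pop_moment_perm) simp
    \<comment> \<open>The rows \<open>k\<close> and \<open>l\<close> carry the coefficients kurtosis
      \<open>+ p + 2\<close>; the final summand, from the two factors \<open>j\<close>, raises
      \<open>p + 2\<close> to the \<open>p + 4\<close> in \<open>psi2_hat\<close>.\<close>
    have "(\<Sum>j\<in>UNIV. moment_differential (pop_moment P) (dm i) (dA i) [j, j, k, l] []) =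
      (\<Sum>j\<in>UNIV. em i [Some l, Some k, Some j, Some j])
        + (dA i l None * skew P k + dA i l (Some k) * (kurt P k + real CARD('p) + 2))
        + (dA i k None * skew P l + dA i k (Some l) * (kurt P l + real CARD('p) + 2))
        + 2 * (dA i k (Some l) + dA i l (Some k))" for i
    proof -
      have s: "(\<Sum>j\<in>UNIV. \<Sum>a\<in>UNIV. dA i k a * pop_moment P [Some l, a, Some j, Some j]) =
          dA i k None * skew P l + dA i k (Some l) * (kurt P l + real CARD('p) + 2)" for k l
        by (subst sum.swap) (simp add: Q sum_option_UNIV c sum_of_bool_single flip: sum_distrib_left)
      have s2: "(\<Sum>j\<in>UNIV. \<Sum>a\<in>UNIV. dA i k a * pop_moment P [a, Some l, Some j, Some j]) =
          dA i k None * skew P l + dA i k (Some l) * (kurt P l + real CARD('p) + 2)" for k l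
        by (simp only: Q' s)
      have s': "(\<Sum>j\<in>UNIV. \<Sum>a\<in>UNIV. dA i j a * pop_moment P [Some l, Some k, a, Some j]) =
          dA i k (Some l) + dA i l (Some k)"
      proof -
        have "(\<Sum>a\<in>UNIV. dA i j a * pop_moment P [Some l, Some k, a, Some j]) =
            (if j = k then dA i j (Some l) else 0) + (if j = l then dA i j (Some k) else 0)" for j
          using kl by (cases "j = k"; cases "j = l") (simp_all add: Qm)
        then show ?thesis by (simp add: sum.distrib)
      qed
      have s3: "(\<Sum>j\<in>UNIV. \<Sum>a\<in>UNIV. dA i j a * pop_moment P [Some l, Some k, Some j, a]) =
          dA i k (Some l) + dA i l (Some k)"
        by (simp only: Qm' s')
      have "pop_moment P [Some l, Some k, Some j, Some j] = 0" for j
        using kl by (simp add: Q)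
      then show ?thesis
        by (simp add: sum.distrib s s2 s' s3)
    qed
    then have eq: "(\<Sum>j\<in>UNIV. moment_differential (pop_moment P) (dm i) (dA i) [j, j, k, l] [])
        - (psi2_hat P (N i) (x i) k l - (kurt P k - kurt P l) * V i$k$l)
        = (kurt P k + real CARD('p) + 4) * (dA i k (Some l) + dA i l (Some k) + em i [Some l, Some k])" for i
      using kl by (simp add: psi2_hat_eq dA_def algebra_simps)
    show "(\<lambda>i. (\<Sum>j\<in>UNIV. moment_differential (pop_moment P) (dm i) (dA i) [j, j, k, l] [])
        - (psi2_hat P (N i) (x i) k l - (kurt P k - kurt P l) * V i$k$l)) \<in> o[F](\<eta>)"
      unfolding eq using white_differential[of k l] kl by simp
  qed (use kl in auto)
qed

end

subsection \<open>First order condition\<close>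

lemma sum_of_bool_pick:
  fixes f :: "'p::finite \<Rightarrow> real"
  shows "(\<Sum>a\<in>UNIV. of_bool (k = a) * f a) = f k" "(\<Sum>a\<in>UNIV. f a * of_bool (k = a)) = f k"
proof -
  have "(\<Sum>a\<in>UNIV. of_bool (k = a) * f a) = (\<Sum>a\<in>UNIV. if a = k then f k else 0)"
    "(\<Sum>a\<in>UNIV. f a * of_bool (k = a)) = (\<Sum>a\<in>UNIV. if a = k then f k else 0)"
    by (intro sum.cong; simp)+
  then show "(\<Sum>a\<in>UNIV. of_bool (k = a) * f a) = f k" "(\<Sum>a\<in>UNIV. f a * of_bool (k = a)) = f k"
    by simp_all
qed

section \<open>Quadratic forms, orthogonal matrices and the objective\<close>

definition bil :: "real^'p^'p \<Rightarrow> real^'p \<Rightarrow> real^'p \<Rightarrow> real" where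
  "bil A u v = u \<bullet> (A *v v)"

lemma bil_eq_sum: "bil A u v = (\<Sum>a\<in>UNIV. \<Sum>b\<in>UNIV. u$a * (A$a$b * v$b))"
  by (simp add: bil_def inner_vec_def matrix_vector_mult_def sum_distrib_left)

lemma bil_sym: "transpose A = A \<Longrightarrow> bil A u v = bil A v u"
  by (metis bil_def dot_lmul_matrix inner_commute vector_transpose_matrix)

lemma bil_linear:
  "bil A (u + v) w = bil A u w + bil A v w" "bil A u (v + w) = bil A u v + bil A u w"
  "bil A (u - v) w = bil A u w - bil A v w" "bil A u (v - w) = bil A u v - bil A u w"
  "bil A (c *\<^sub>R u) v = c * bil A u v" "bil A u (c *\<^sub>R v) = c * bil A u v"
  by (simp_all add: bil_def inner_add_left inner_add_right inner_diff_left inner_diff_right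
      matrix_vector_right_distrib matrix_vector_mult_diff_distrib
      matrix_vector_mult_scaleR)

text \<open>Each summand depends on one row only and is even in it. A plane rotation therefore
  changes two summands, and a signed reindexing of the rows merely permutes them.\<close>

lemma cc_objective_eq:
  fixes U :: "real^'p^'p"
  shows "cc_objective \<alpha> A B U = (\<Sum>k\<in>UNIV. \<alpha> * (bil A (U$k) (U$k))\<^sup>2 + (1 - \<alpha>) * (bil B (U$k) (U$k))\<^sup>2)"
proof -
  have d: "(norm (diag_part X))\<^sup>2 = (\<Sum>k\<in>UNIV. (X$k$k)\<^sup>2)" for X :: "real^'p^'p"
  proof -
    have "(norm (diag_part X))\<^sup>2 = (\<Sum>k\<in>UNIV. \<Sum>l\<in>UNIV. if k = l then (X$k$l)\<^sup>2 else 0)"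
      unfolding power2_norm_eq_inner inner_vec_def diag_part_def
      by (intro sum.cong refl) (simp add: power2_eq_square)
    then show ?thesis by simp
  qed
  have "(U ** A ** transpose U)$k$k = bil A (U$k) (U$k)" for A :: "real^'p^'p" and k
  proof -
    have "(U ** A ** transpose U)$k$k = (\<Sum>b\<in>UNIV. \<Sum>a\<in>UNIV. U$k$a * (A$a$b * U$k$b))"
      by (simp add: matrix_matrix_mult_def transpose_def sum_distrib_left sum_distrib_right mult_ac)
    also have "\<dots> = bil A (U$k) (U$k)" unfolding bil_eq_sum by (rule sum.swap)
    finally show ?thesis .
  qed
  then show ?thesis
    unfolding cc_objective_def d by (simp add: sum.distrib sum_distrib_left)
qed

lemma orthogonal_matrix_rows:
  fixes U :: "real^'p^'p"
  shows "orthogonal_matrix U \<longleftrightarrow> (\<forall>k l. U$k \<bullet> U$l = of_bool (k = l))"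
  unfolding orthogonal_matrix_orthonormal_rows
  by (auto simp: row_def norm_eq_1 orthogonal_def)

lemma orthogonal_matrix_cols:
  fixes U :: "real^'p^'p"
  assumes "orthogonal_matrix U"
  shows "(\<Sum>k\<in>UNIV. (U$k$a)\<^sup>2) = 1"
proof -
  have "norm (column a U) = 1" using assms unfolding orthogonal_matrix_orthonormal_columns by blast
  then show ?thesis by (simp add: norm_eq_1 column_def inner_vec_def power2_eq_square)
qed

lemma orthogonal_matrix_entry_le: "orthogonal_matrix U \<Longrightarrow> \<bar>U$k$a\<bar> \<le> 1" for U :: "real^'p^'p"
  using component_le_norm_cart[of "U$k" a] by (simp add: orthogonal_matrix_rows norm_eq_1[THEN iffD2])

lemma compact_orthogonal_matrices: "compact {U :: real^'p^'p. orthogonal_matrix U}"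
proof -
  have "{U :: real^'p^'p. orthogonal_matrix U} = (\<Inter>k. \<Inter>l. {U. U$k \<bullet> U$l = of_bool (k = l)})"
    by (auto simp: orthogonal_matrix_rows)
  then have "closed {U :: real^'p^'p. orthogonal_matrix U}"
    by (auto intro!: closed_INT closed_Collect_eq continuous_intros)
  moreover have "bounded {U :: real^'p^'p. orthogonal_matrix U}"
    unfolding bounded_iff
  proof (intro exI ballI)
    fix U :: "real^'p^'p" assume "U \<in> {U. orthogonal_matrix U}"
    then have n: "norm (U$k) = 1" for k by (simp add: orthogonal_matrix_rows norm_eq_1)
    have "norm U \<le> (\<Sum>k\<in>UNIV. norm (U$k))" unfolding norm_vec_def by (rule L2_set_le_sum) simp
    then show "norm U \<le> real CARD('p)" by (simp add: n)
  qed
  ultimately show ?thesis by (simp add: compact_eq_bounded_closed)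
qed

lemma continuous_on_cc_objective: "continuous_on S (cc_objective \<alpha> A B)"
  unfolding cc_objective_eq[abs_def] bil_eq_sum by (intro continuous_intros)

text \<open>Rotations in the plane of rows \<open>k\<close> and \<open>l\<close> give the first order condition.\<close>

lemma cc_maximizer_stationary:
  fixes U :: "real^'p^'p"
  assumes U: "orthogonal_matrix U" and max: "\<And>U'. orthogonal_matrix U' \<Longrightarrow> cc_objective \<alpha> A B U' \<le> cc_objective \<alpha> A B U"
    and sym: "transpose A = A" "transpose B = B" and kl: "k \<noteq> l"
  shows "\<alpha> * (bil A (U$k) (U$l) * (bil A (U$k) (U$k) - bil A (U$l) (U$l))) +
    (1 - \<alpha>) * (bil B (U$k) (U$l) * (bil B (U$k) (U$k) - bil B (U$l) (U$l))) = 0"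
proof -
  define R :: "real \<Rightarrow> real^'p^'p" where "R t = (\<chi> i. if i = k then cos t *\<^sub>R U$k + sin t *\<^sub>R U$l
      else if i = l then (- sin t) *\<^sub>R U$k + cos t *\<^sub>R U$l else U$i)" for t
  have row: "U$i \<bullet> U$j = of_bool (i = j)" for i j using U by (simp add: orthogonal_matrix_rows)
  have sc: "sin t * sin t + cos t * cos t = 1" for t :: real
    using sin_cos_squared_add[of t] by (simp add: power2_eq_square)
  have R: "orthogonal_matrix (R t)" for t
    unfolding orthogonal_matrix_rows
    using kl sc[of t] by (auto simp: R_def inner_add_left inner_add_right inner_diff_left inner_diff_right row add.commute)
  define q where "q A t = (cos t)\<^sup>2 * bil A (U$k) (U$k) + 2 * (cos t * sin t) * bil A (U$k) (U$l) + (sin t)\<^sup>2 * bil A (U$l) (U$l)" for A t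
  define r where "r A t = (sin t)\<^sup>2 * bil A (U$k) (U$k) - 2 * (cos t * sin t) * bil A (U$k) (U$l) + (cos t)\<^sup>2 * bil A (U$l) (U$l)" for A t
  have q: "bil A (R t $ k) (R t $ k) = q A t" "bil A (R t $ l) (R t $ l) = r A t" if "transpose A = A" for A t
    using kl bil_sym[OF that, of "U$l" "U$k"]
    by (simp_all add: R_def q_def r_def bil_linear power2_eq_square algebra_simps)
  define h where "h t = \<alpha> * ((q A t)\<^sup>2 + (r A t)\<^sup>2) + (1 - \<alpha>) * ((q B t)\<^sup>2 + (r B t)\<^sup>2)" for t
  have obj: "cc_objective \<alpha> A B (R t) = h t + (\<Sum>i\<in>UNIV - {k, l}. \<alpha> * (bil A (U$i) (U$i))\<^sup>2 + (1 - \<alpha>) * (bil B (U$i) (U$i))\<^sup>2)" for t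
  proof -
    have "(\<Sum>i\<in>UNIV - {k, l}. \<alpha> * (bil A (R t $ i) (R t $ i))\<^sup>2 + (1 - \<alpha>) * (bil B (R t $ i) (R t $ i))\<^sup>2) =
      (\<Sum>i\<in>UNIV - {k, l}. \<alpha> * (bil A (U$i) (U$i))\<^sup>2 + (1 - \<alpha>) * (bil B (U$i) (U$i))\<^sup>2)"
      by (intro sum.cong) (auto simp: R_def)
    then show ?thesis
      unfolding cc_objective_eq by (subst sum_split_two[OF kl]) (simp add: q sym h_def algebra_simps)
  qed
  have "R 0 = U" using kl by (auto simp: R_def vec_eq_iff)
  then have h0: "h t \<le> h 0" for t
    using max[OF R[of t]] obj[of t] obj[of 0] by simp
  \<comment> \<open>At 0 the squares of sine and cosine have derivative 0 and their product has
    derivative 1, so the two diagonal entries move with opposite speeds, twice the off-diagonal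
    entry in absolute value.\<close>
  define D where "D = \<alpha> * (2 * q A 0 * (2 * bil A (U$k) (U$l)) + 2 * r A 0 * (- 2 * bil A (U$k) (U$l))) +
    (1 - \<alpha>) * (2 * q B 0 * (2 * bil B (U$k) (U$l)) + 2 * r B 0 * (- 2 * bil B (U$k) (U$l)))"
  have q': "(q A has_real_derivative 2 * bil A (U$k) (U$l)) (at 0)" for A
    unfolding q_def[abs_def] by (auto intro!: derivative_eq_intros)
  have r': "(r A has_real_derivative - 2 * bil A (U$k) (U$l)) (at 0)" for A
    unfolding r_def[abs_def] by (auto intro!: derivative_eq_intros)
  have "(h has_real_derivative D) (at 0)"
    unfolding h_def[abs_def] D_def
    by (rule derivative_eq_intros q' r' refl)+ (simp add: algebra_simps)
  then have "D = 0"
    by (rule DERIV_local_max[where d = 1]) (use h0 in auto)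
  then have "4 * (\<alpha> * (bil A (U$k) (U$l) * (bil A (U$k) (U$k) - bil A (U$l) (U$l))) +
    (1 - \<alpha>) * (bil B (U$k) (U$l) * (bil B (U$k) (U$k) - bil B (U$l) (U$l)))) = 0"
    by (simp add: D_def q_def r_def algebra_simps)
  then show ?thesis by simp
qed

text \<open>The maximizer is assumed consistent, without a rate, so its equations cannot be
  linearized at scale \<open>\<epsilon>\<close> directly. They are linearized at the scale
  \<open>\<eta>\<close>, which dominates the unknown error by construction. This gives the error as
  an explicit O(\<open>\<epsilon>\<close>) term plus o(\<open>\<eta>\<close>), and the latter is
  absorbed to obtain \<open>\<eta>\<close> in O(\<open>\<epsilon>\<close>).\<close>

lemma first_order_matrix_bootstrap:
  fixes U A B :: "'i \<Rightarrow> real^'p^'p" and \<epsilon> :: "'i \<Rightarrow> real" and \<gamma> \<kappa> :: "'p \<Rightarrow> real"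
  assumes \<epsilon>: "\<epsilon> \<in> o[F](\<lambda>_. 1)"
    and A: "\<And>k l. (\<lambda>i. A i$k$l - of_bool (k = l) * \<gamma> k) \<in> O[F](\<epsilon>)"
    and B: "\<And>k l. (\<lambda>i. B i$k$l - of_bool (k = l) * \<kappa> k) \<in> O[F](\<epsilon>)"
    and U: "eventually (\<lambda>i. orthogonal_matrix (U i)) F"
    and cons: "\<And>k l. (\<lambda>i. U i$k$l - of_bool (k = l)) \<in> o[F](\<lambda>_. 1)"
    and foc: "\<And>k l. k \<noteq> l \<Longrightarrow> eventually (\<lambda>i.
      \<alpha> * (bil (A i) (U i$k) (U i$l) * (bil (A i) (U i$k) (U i$k) - bil (A i) (U i$l) (U i$l))) +
      (1 - \<alpha>) * (bil (B i) (U i$k) (U i$l) * (bil (B i) (U i$k) (U i$k) - bil (B i) (U i$l) (U i$l))) = 0) F"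
    and sep: "\<And>k l. k \<noteq> l \<Longrightarrow> \<alpha> * (\<gamma> k - \<gamma> l)\<^sup>2 + (1 - \<alpha>) * (\<kappa> k - \<kappa> l)\<^sup>2 \<noteq> 0"
  shows "(\<lambda>i. U i$k$k - 1) \<in> o[F](\<epsilon>)"
    and "k \<noteq> l \<Longrightarrow> (\<lambda>i. U i$k$l - (\<alpha> * (\<gamma> k - \<gamma> l) * A i$k$l + (1 - \<alpha>) * (\<kappa> k - \<kappa> l) * B i$k$l) /
        (\<alpha> * (\<gamma> k - \<gamma> l)\<^sup>2 + (1 - \<alpha>) * (\<kappa> k - \<kappa> l)\<^sup>2)) \<in> o[F](\<epsilon>)"
proof -
  define \<Delta> where "\<Delta> i k l = U i$k$l - of_bool (k = l)" for i k l
  \<comment> \<open>Including the entries of \<open>\<Delta>\<close> makes their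
    O(\<open>\<eta>\<close>) bound trivial, while consistency still gives \<open>\<eta>\<close> in
    o(1).\<close>
  define \<eta> where "\<eta> i = \<bar>\<epsilon> i\<bar> + (\<Sum>k\<in>UNIV. \<Sum>l\<in>UNIV. \<bar>\<Delta> i k l\<bar>)" for i
  have \<eta>0: "0 \<le> \<eta> i" for i unfolding \<eta>_def by (simp add: sum_nonneg)
  have \<eta>: "\<eta> \<in> o[F](\<lambda>_. 1)"
    unfolding \<eta>_def[abs_def] using \<epsilon> cons
    by (intro sum_in_smallo(1) big_sum_in_smallo) (simp_all add: \<Delta>_def)
  have \<epsilon>\<eta>: "\<epsilon> \<in> O[F](\<eta>)"
    by (intro landau_o.bigI[of 1] always_eventually) (auto simp: \<eta>_def sum_nonneg)
  have \<Delta>\<eta>: "(\<lambda>i. \<Delta> i k l) \<in> O[F](\<eta>)" for k l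
  proof (intro landau_o.bigI[of 1] always_eventually allI)
    fix i
    have "\<bar>\<Delta> i k l\<bar> \<le> (\<Sum>l\<in>UNIV. \<bar>\<Delta> i k l\<bar>)" by (rule member_le_sum) auto
    also have "\<dots> \<le> (\<Sum>k\<in>UNIV. \<Sum>l\<in>UNIV. \<bar>\<Delta> i k l\<bar>)"
      by (rule member_le_sum[where f = "\<lambda>k. \<Sum>l\<in>UNIV. \<bar>\<Delta> i k l\<bar>"]) (auto intro: sum_nonneg)
    finally show "norm (\<Delta> i k l) \<le> 1 * norm (\<eta> i)" using \<eta>0[of i] by (simp add: \<eta>_def)
  qed simp
  have fU: "first_order F \<eta> (\<lambda>i. U i$k$l) (of_bool (k = l)) (\<lambda>i. \<Delta> i k l)" for k l
    using first_orderI[of "\<lambda>i. U i$k$l" "of_bool (k = l)" F \<eta>] \<Delta>\<eta>[of k l] by (simp add: \<Delta>_def)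
  \<comment> \<open>Orthogonality linearized at the identity: the deviation is antisymmetric to
    first order. For \<open>k = l\<close> this says that diagonal errors are negligible.\<close>
  have skewsym: "(\<lambda>i. \<Delta> i k l + \<Delta> i l k) \<in> o[F](\<eta>)" for k l
  proof -
    have "first_order F \<eta> (\<lambda>i. \<Sum>a\<in>UNIV. U i$k$a * U i$l$a) (\<Sum>a\<in>UNIV. of_bool (k = a) * of_bool (l = a))
      (\<lambda>i. \<Sum>a\<in>UNIV. of_bool (k = a) * \<Delta> i l a + \<Delta> i k a * of_bool (l = a))"
      by (intro first_order_sum first_order_mult fU \<eta>)
    then have 1: "first_order F \<eta> (\<lambda>i. \<Sum>a\<in>UNIV. U i$k$a * U i$l$a) (of_bool (l = k)) (\<lambda>i. \<Delta> i k l + \<Delta> i l k)"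
      by (simp only: sum.distrib sum_of_bool_pick add.commute[of "\<Delta> _ l k"])
    have 2: "first_order F \<eta> (\<lambda>i. \<Sum>a\<in>UNIV. U i$k$a * U i$l$a) (of_bool (l = k)) (\<lambda>_. 0)"
      by (rule first_order_cong[OF first_order_const[of F \<eta> "of_bool (l = k)"]])
         (use U in \<open>auto simp: orthogonal_matrix_rows inner_vec_def elim!: eventually_mono\<close>)
    show ?thesis using first_order_unique[OF 1 2] by simp
  qed
  have bil: "first_order F \<eta> (\<lambda>i. bil (A i) (U i$k) (U i$l)) (of_bool (k = l) * \<gamma> k)
     (\<lambda>i. (A i$k$l - of_bool (k = l) * \<gamma> k) + \<gamma> k * \<Delta> i l k + \<gamma> l * \<Delta> i k l)"
    if A: "\<And>k l. (\<lambda>i. A i$k$l - of_bool (k = l) * \<gamma> k) \<in> O[F](\<epsilon>)" for A :: "'i \<Rightarrow> real^'p^'p" and \<gamma> k l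
  proof -
    have fA: "first_order F \<eta> (\<lambda>i. A i$k$l) (of_bool (k = l) * \<gamma> k) (\<lambda>i. A i$k$l - of_bool (k = l) * \<gamma> k)" for k l
      by (rule first_orderI[OF landau_o.big_trans[OF A \<epsilon>\<eta>]])
    have eq: "bil (A i) (U i$k) (U i$l) = (\<Sum>a\<in>UNIV. U i$k$a * (\<Sum>b\<in>UNIV. A i$a$b * U i$l$b))" for i
      by (simp add: bil_eq_sum sum_distrib_left)
    have 1: "first_order F \<eta> (\<lambda>i. bil (A i) (U i$k) (U i$l))
      (\<Sum>a\<in>UNIV. of_bool (k = a) * (\<Sum>b\<in>UNIV. of_bool (a = b) * \<gamma> a * of_bool (l = b)))
      (\<lambda>i. \<Sum>a\<in>UNIV. of_bool (k = a) * (\<Sum>b\<in>UNIV. of_bool (a = b) * \<gamma> a * \<Delta> i l b + (A i$a$b - of_bool (a = b) * \<gamma> a) * of_bool (l = b))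
         + \<Delta> i k a * (\<Sum>b\<in>UNIV. of_bool (a = b) * \<gamma> a * of_bool (l = b)))"
      unfolding eq by (intro first_order_sum first_order_mult fU fA \<eta>)
    have z: "(\<Sum>b\<in>UNIV. of_bool (a = b) * \<gamma> a * of_bool (l = b)) = of_bool (l = a) * \<gamma> a" for a
    proof -
      have "(\<Sum>b\<in>UNIV. of_bool (a = b) * \<gamma> a * of_bool (l = b)) = (\<Sum>b\<in>UNIV. if b = a then of_bool (l = a) * \<gamma> a else 0)"
        by (intro sum.cong) auto
      then show ?thesis by simp
    qed
    have d: "(\<Sum>a\<in>UNIV. of_bool (k = a) * (\<Sum>b\<in>UNIV. of_bool (a = b) * \<gamma> a * \<Delta> i l b + (A i$a$b - of_bool (a = b) * \<gamma> a) * of_bool (l = b))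
         + \<Delta> i k a * (\<Sum>b\<in>UNIV. of_bool (a = b) * \<gamma> a * of_bool (l = b))) =
      (A i$k$l - of_bool (k = l) * \<gamma> k) + \<gamma> k * \<Delta> i l k + \<gamma> l * \<Delta> i k l" for i
    proof -
      have "(\<Sum>b\<in>UNIV. of_bool (k = b) * \<gamma> k * \<Delta> i l b + (A i$k$b - of_bool (k = b) * \<gamma> k) * of_bool (l = b)) =
          \<gamma> k * \<Delta> i l k + (A i$k$l - of_bool (k = l) * \<gamma> k)"
        by (simp only: sum.distrib sum_of_bool_pick mult.assoc)
      moreover have "(\<Sum>a\<in>UNIV. \<Delta> i k a * (of_bool (l = a) * \<gamma> a)) = \<gamma> l * \<Delta> i k l"
        by (simp only: sum_of_bool_pick mult.left_commute[of _ "of_bool _"] mult.commute[of _ "\<gamma> l"])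
      ultimately show ?thesis
        unfolding z by (simp only: sum.distrib[where h = "\<lambda>a. \<Delta> i k a * _ a"] sum_of_bool_pick)
    qed
    have "(\<Sum>a\<in>UNIV. of_bool (k = a) * (\<Sum>b\<in>UNIV. of_bool (a = b) * \<gamma> a * of_bool (l = b))) = of_bool (k = l) * \<gamma> k"
      by (simp only: z sum_of_bool_pick eq_commute[of l k])
    then show ?thesis using 1 unfolding d by (simp only:)
  qed
  \<comment> \<open>Linearized stationarity. The off-diagonal form has limit 0, so the difference of
    the diagonal forms enters only through its own limit.\<close>
  have key: "(\<lambda>i. (\<alpha> * (\<gamma> k - \<gamma> l)\<^sup>2 + (1 - \<alpha>) * (\<kappa> k - \<kappa> l)\<^sup>2) * \<Delta> i k l -
     (\<alpha> * (\<gamma> k - \<gamma> l) * A i$k$l + (1 - \<alpha>) * (\<kappa> k - \<kappa> l) * B i$k$l)) \<in> o[F](\<eta>)" if kl: "k \<noteq> l" for k l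
  proof -
    let ?LA = "\<lambda>i. A i$k$l + \<gamma> k * \<Delta> i l k + \<gamma> l * \<Delta> i k l" and ?LB = "\<lambda>i. B i$k$l + \<kappa> k * \<Delta> i l k + \<kappa> l * \<Delta> i k l"
    have parts: "\<exists>e. first_order F \<eta> (\<lambda>i. bil (A i) (U i$k) (U i$k) - bil (A i) (U i$l) (U i$l)) (\<gamma> k - \<gamma> l) e"
      "first_order F \<eta> (\<lambda>i. bil (A i) (U i$k) (U i$l)) 0 (\<lambda>i. A i$k$l + \<gamma> k * \<Delta> i l k + \<gamma> l * \<Delta> i k l)"
      if A: "\<And>k l. (\<lambda>i. A i$k$l - of_bool (k = l) * \<gamma> k) \<in> O[F](\<epsilon>)" for A :: "'i \<Rightarrow> real^'p^'p" and \<gamma>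
      using first_order_diff[OF bil[OF A, of k k] bil[OF A, of l l]] bil[OF A, of k l] kl by auto
    obtain e e' where
      "first_order F \<eta> (\<lambda>i. bil (A i) (U i$k) (U i$k) - bil (A i) (U i$l) (U i$l)) (\<gamma> k - \<gamma> l) e"
      "first_order F \<eta> (\<lambda>i. bil (B i) (U i$k) (U i$k) - bil (B i) (U i$l) (U i$l)) (\<kappa> k - \<kappa> l) e'"
      using parts(1)[OF A] parts(1)[OF B] by blast
    then have 1: "first_order F \<eta> (\<lambda>i.
      \<alpha> * (bil (A i) (U i$k) (U i$l) * (bil (A i) (U i$k) (U i$k) - bil (A i) (U i$l) (U i$l))) +
      (1 - \<alpha>) * (bil (B i) (U i$k) (U i$l) * (bil (B i) (U i$k) (U i$k) - bil (B i) (U i$l) (U i$l))))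
      (\<alpha> * (0 * (\<gamma> k - \<gamma> l)) + (1 - \<alpha>) * (0 * (\<kappa> k - \<kappa> l)))
      (\<lambda>i. \<alpha> * (0 * e i + ?LA i * (\<gamma> k - \<gamma> l)) + (1 - \<alpha>) * (0 * e' i + ?LB i * (\<kappa> k - \<kappa> l)))"
      using parts(2)[OF A] parts(2)[OF B] by (intro first_order_add first_order_cmult first_order_mult \<eta>)
    have 2: "first_order F \<eta> (\<lambda>i.
      \<alpha> * (bil (A i) (U i$k) (U i$l) * (bil (A i) (U i$k) (U i$k) - bil (A i) (U i$l) (U i$l))) +
      (1 - \<alpha>) * (bil (B i) (U i$k) (U i$l) * (bil (B i) (U i$k) (U i$k) - bil (B i) (U i$l) (U i$l))))
      (\<alpha> * (0 * (\<gamma> k - \<gamma> l)) + (1 - \<alpha>) * (0 * (\<kappa> k - \<kappa> l))) (\<lambda>_. 0)"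
      by (rule first_order_cong[OF first_order_const[of F \<eta> 0]]) (use foc[OF kl] in \<open>auto elim!: eventually_mono\<close>)
    \<comment> \<open>Antisymmetry replaces \<open>\<Delta> i l k\<close> by
      \<open>- \<Delta> i k l\<close>, after which the coefficient of \<open>\<Delta> i k l\<close>
      is the separation constant.\<close>
    have 3: "(\<lambda>i. (\<alpha> * (\<gamma> k - \<gamma> l) * \<gamma> k + (1 - \<alpha>) * (\<kappa> k - \<kappa> l) * \<kappa> k) * (\<Delta> i k l + \<Delta> i l k)) \<in> o[F](\<eta>)"
      using skewsym[of k l] by simp
    have "(\<lambda>i. (\<alpha> * (\<gamma> k - \<gamma> l) * \<gamma> k + (1 - \<alpha>) * (\<kappa> k - \<kappa> l) * \<kappa> k) * (\<Delta> i k l + \<Delta> i l k) -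
       (\<alpha> * (0 * e i + ?LA i * (\<gamma> k - \<gamma> l)) + (1 - \<alpha>) * (0 * e' i + ?LB i * (\<kappa> k - \<kappa> l)) - 0)) \<in> o[F](\<eta>)"
      by (rule sum_in_smallo(2)[OF 3 first_order_unique[OF 1 2]])
    moreover have "(\<alpha> * (\<gamma> k - \<gamma> l) * \<gamma> k + (1 - \<alpha>) * (\<kappa> k - \<kappa> l) * \<kappa> k) * (\<Delta> i k l + \<Delta> i l k) -
       (\<alpha> * (0 * e i + ?LA i * (\<gamma> k - \<gamma> l)) + (1 - \<alpha>) * (0 * e' i + ?LB i * (\<kappa> k - \<kappa> l)) - 0) =
      (\<alpha> * (\<gamma> k - \<gamma> l)\<^sup>2 + (1 - \<alpha>) * (\<kappa> k - \<kappa> l)\<^sup>2) * \<Delta> i k l -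
     (\<alpha> * (\<gamma> k - \<gamma> l) * A i$k$l + (1 - \<alpha>) * (\<kappa> k - \<kappa> l) * B i$k$l)" for i
      by (simp add: power2_eq_square algebra_simps)
    ultimately show ?thesis by simp
  qed
  define R where "R i k l = (if k = l then 0 else (\<alpha> * (\<gamma> k - \<gamma> l) * A i$k$l + (1 - \<alpha>) * (\<kappa> k - \<kappa> l) * B i$k$l) /
        (\<alpha> * (\<gamma> k - \<gamma> l)\<^sup>2 + (1 - \<alpha>) * (\<kappa> k - \<kappa> l)\<^sup>2))" for i k l
  have RO: "(\<lambda>i. R i k l) \<in> O[F](\<epsilon>)" for k l
  proof (cases "k = l")
    case False
    have "(\<lambda>i. \<alpha> * (\<gamma> k - \<gamma> l) * A i$k$l + (1 - \<alpha>) * (\<kappa> k - \<kappa> l) * B i$k$l) \<in> O[F](\<epsilon>)"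
      using A[of k l] B[of k l] False by (intro sum_in_bigo(1)) simp_all
    then show ?thesis using False sep[OF False] by (simp add: R_def)
  qed (simp add: R_def)
  have rem: "(\<lambda>i. \<Delta> i k l - R i k l) \<in> o[F](\<eta>)" for k l
  proof (cases "k = l")
    case True
    have "(\<lambda>i. 2 * \<Delta> i k k) \<in> o[F](\<eta>)" using skewsym[of k k] by (simp only: mult_2)
    then show ?thesis using True by (simp add: R_def)
  next
    case False
    let ?D = "\<alpha> * (\<gamma> k - \<gamma> l)\<^sup>2 + (1 - \<alpha>) * (\<kappa> k - \<kappa> l)\<^sup>2"
    have "(\<lambda>i. (?D * \<Delta> i k l - (\<alpha> * (\<gamma> k - \<gamma> l) * A i$k$l + (1 - \<alpha>) * (\<kappa> k - \<kappa> l) * B i$k$l)) / ?D) \<in> o[F](\<eta>)"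
      using key[OF False] sep[OF False] by simp
    then show ?thesis using False sep[OF False] by (simp add: R_def diff_divide_distrib)
  qed
  \<comment> \<open>Absorption: eventually \<open>\<eta>\<close> is at most
    \<open>\<bar>\<epsilon>\<bar>\<close> plus the entries of \<open>R\<close> plus half of
    \<open>\<eta>\<close>.\<close>
  have \<eta>\<epsilon>: "\<eta> \<in> O[F](\<epsilon>)"
  proof -
    have "(\<lambda>i. \<Sum>k\<in>UNIV. \<Sum>l\<in>UNIV. \<bar>\<Delta> i k l - R i k l\<bar>) \<in> o[F](\<eta>)"
      using rem by (intro big_sum_in_smallo) simp
    from landau_o.smallD[OF this, of "1/2"]
    have "eventually (\<lambda>i. (\<Sum>k\<in>UNIV. \<Sum>l\<in>UNIV. \<bar>\<Delta> i k l - R i k l\<bar>) \<le> \<eta> i / 2) F"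
      using \<eta>0 by (auto elim!: eventually_mono)
    then have ev: "eventually (\<lambda>i. norm (\<eta> i) \<le> 2 * norm (\<bar>\<epsilon> i\<bar> + (\<Sum>k\<in>UNIV. \<Sum>l\<in>UNIV. \<bar>R i k l\<bar>))) F"
    proof eventually_elim
      case (elim i)
      have "(\<Sum>k\<in>UNIV. \<Sum>l\<in>UNIV. \<bar>\<Delta> i k l\<bar>) \<le> (\<Sum>k\<in>UNIV. \<Sum>l\<in>UNIV. \<bar>\<Delta> i k l - R i k l\<bar> + \<bar>R i k l\<bar>)"
        by (intro sum_mono) auto
      then show ?case using elim \<eta>0[of i] by (simp add: sum.distrib \<eta>_def sum_nonneg)
    qed
    have "\<eta> \<in> O[F](\<lambda>i. \<bar>\<epsilon> i\<bar> + (\<Sum>k\<in>UNIV. \<Sum>l\<in>UNIV. \<bar>R i k l\<bar>))"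
      by (rule landau_o.bigI[OF _ ev]) simp
    also have "(\<lambda>i. \<bar>\<epsilon> i\<bar> + (\<Sum>k\<in>UNIV. \<Sum>l\<in>UNIV. \<bar>R i k l\<bar>)) \<in> O[F](\<epsilon>)"
      using RO by (intro sum_in_bigo(1) big_sum_in_bigo) simp_all
    finally show ?thesis .
  qed
  have fin: "(\<lambda>i. \<Delta> i k l - R i k l) \<in> o[F](\<epsilon>)" for k l
    by (rule landau_o.small_big_trans[OF rem \<eta>\<epsilon>])
  show "(\<lambda>i. U i$k$k - 1) \<in> o[F](\<epsilon>)" using fin[of k k] by (simp add: \<Delta>_def R_def)
  show "(\<lambda>i. U i$k$l - (\<alpha> * (\<gamma> k - \<gamma> l) * A i$k$l + (1 - \<alpha>) * (\<kappa> k - \<kappa> l) * B i$k$l) /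
        (\<alpha> * (\<gamma> k - \<gamma> l)\<^sup>2 + (1 - \<alpha>) * (\<kappa> k - \<kappa> l)\<^sup>2)) \<in> o[F](\<epsilon>)" if "k \<noteq> l"
    using fin[of k l] that by (simp add: \<Delta>_def R_def)
qed

subsection \<open>Consistency\<close>

definition diagonal_matrix :: "('p \<Rightarrow> real) \<Rightarrow> real^'p^'p" where
  "diagonal_matrix \<gamma> = (\<chi> k l. of_bool (k = l) * \<gamma> k)"

lemma bil_diagonal: "bil (diagonal_matrix \<gamma>) u u = (\<Sum>a\<in>UNIV. \<gamma> a * (u$a)\<^sup>2)"
proof -
  have "bil (diagonal_matrix \<gamma>) u u = (\<Sum>a\<in>UNIV. \<Sum>b\<in>UNIV. of_bool (a = b) * (\<gamma> a * (u$a * u$b)))"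
    unfolding bil_eq_sum diagonal_matrix_def by (simp add: mult_ac)
  then show ?thesis by (simp only: sum_of_bool_pick power2_eq_square)
qed

definition signed_reindex :: "('p \<Rightarrow> 'p) \<Rightarrow> ('p \<Rightarrow> real) \<Rightarrow> real^'p^'p \<Rightarrow> real^'p^'p" where
  "signed_reindex \<pi> s U = (\<chi> j. s j *\<^sub>R U$(\<pi> j))"

lemma orthogonal_signed_reindex:
  assumes "bij \<pi>" "\<And>j. \<bar>s j\<bar> = 1" "orthogonal_matrix U"
  shows "orthogonal_matrix (signed_reindex \<pi> s U)"
proof -
  have "s j * s j = 1" for j using assms(2)[of j] by (metis abs_mult_self_eq mult_1)
  then show ?thesis
    using assms(1,3) by (auto simp: orthogonal_matrix_rows signed_reindex_def bij_def inj_eq)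
qed

lemma cc_objective_signed_reindex:
  assumes "bij \<pi>" "\<And>j. \<bar>s j\<bar> = 1"
  shows "cc_objective \<alpha> A B (signed_reindex \<pi> s U) = cc_objective \<alpha> A B U"
proof -
  have s: "s j * s j = 1" for j using assms(2)[of j] by (metis abs_mult_self_eq mult_1)
  have b: "bil A (s j *\<^sub>R u) (s j *\<^sub>R u) = bil A u u" for A u j
    using s[of j] by (simp add: bil_linear mult.assoc[symmetric])
  show ?thesis
    unfolding cc_objective_eq signed_reindex_def
    using sum.reindex_bij_betw[OF assms(1), of "\<lambda>k. \<alpha> * (bil A (U$k) (U$k))\<^sup>2 + (1 - \<alpha>) * (bil B (U$k) (U$k))\<^sup>2"]
    by (simp add: b)
qed

text \<open>
  Since the squared entries of a row of \<open>U\<close> are probability weights, the defect of the objective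
  from its maximal value is a sum of weighted variances.
\<close>

lemma cc_objective_diagonal_defect:
  fixes U :: "real^'p^'p" and \<gamma> \<kappa> :: "'p \<Rightarrow> real"
  assumes U: "orthogonal_matrix U"
  shows "(\<Sum>a\<in>UNIV. \<alpha> * (\<gamma> a)\<^sup>2 + (1 - \<alpha>) * (\<kappa> a)\<^sup>2)
      - cc_objective \<alpha> (diagonal_matrix \<gamma>) (diagonal_matrix \<kappa>) U =
    (\<Sum>k\<in>UNIV. \<Sum>a\<in>UNIV. \<Sum>b\<in>UNIV. (U$k$a)\<^sup>2 * (U$k$b)\<^sup>2 * (\<alpha> * (\<gamma> a - \<gamma> b)\<^sup>2 + (1 - \<alpha>) * (\<kappa> a - \<kappa> b)\<^sup>2)) / 2"
proof -
  have row: "(\<Sum>a\<in>UNIV. (U$k$a)\<^sup>2) = 1" for k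
    using U by (simp add: orthogonal_matrix_rows inner_vec_def power2_eq_square)
  have v: "(\<Sum>a\<in>UNIV. \<Sum>b\<in>UNIV. (U$k$a)\<^sup>2 * (U$k$b)\<^sup>2 * (\<gamma> a - \<gamma> b)\<^sup>2)
      = 2 * ((\<Sum>a\<in>UNIV. (\<gamma> a)\<^sup>2 * (U$k$a)\<^sup>2) - (bil (diagonal_matrix \<gamma>) (U$k) (U$k))\<^sup>2)" for \<gamma> k
  proof -
    let ?w = "\<lambda>a. (U$k$a)\<^sup>2"
    have "(\<Sum>a\<in>UNIV. \<Sum>b\<in>UNIV. ?w a * ?w b * (\<gamma> a - \<gamma> b)\<^sup>2) =
      (\<Sum>a\<in>UNIV. \<Sum>b\<in>UNIV. ((\<gamma> a)\<^sup>2 * ?w a) * ?w b) + (\<Sum>a\<in>UNIV. \<Sum>b\<in>UNIV. ?w a * ((\<gamma> b)\<^sup>2 * ?w b))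
       - 2 * (\<Sum>a\<in>UNIV. \<Sum>b\<in>UNIV. (\<gamma> a * ?w a) * (\<gamma> b * ?w b))"
      unfolding sum_distrib_left sum.distrib[symmetric] sum_subtractf[symmetric]
      by (intro sum.cong refl) (simp add: power2_eq_square algebra_simps)
    also have "\<dots> = (\<Sum>a\<in>UNIV. (\<gamma> a)\<^sup>2 * ?w a) * (\<Sum>b\<in>UNIV. ?w b) + (\<Sum>a\<in>UNIV. ?w a) * (\<Sum>b\<in>UNIV. (\<gamma> b)\<^sup>2 * ?w b)
       - 2 * ((\<Sum>a\<in>UNIV. \<gamma> a * ?w a) * (\<Sum>b\<in>UNIV. \<gamma> b * ?w b))"
      by (simp only: sum_product)
    finally show ?thesis
      unfolding row bil_diagonal by (simp add: power2_eq_square[of "\<Sum>a\<in>UNIV. \<gamma> a * ?w a"])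
  qed
  \<comment> \<open>The columns of \<open>U\<close> are unit vectors too, so the second moments
    summed over the rows do not depend on \<open>U\<close>.\<close>
  have c: "(\<Sum>k\<in>UNIV. \<Sum>a\<in>UNIV. (\<gamma> a)\<^sup>2 * (U$k$a)\<^sup>2) = (\<Sum>a\<in>UNIV. (\<gamma> a)\<^sup>2)" for \<gamma>
    by (subst sum.swap) (simp add: orthogonal_matrix_cols[OF U] flip: sum_distrib_left)
  have "(\<Sum>k\<in>UNIV. \<Sum>a\<in>UNIV. \<Sum>b\<in>UNIV. (U$k$a)\<^sup>2 * (U$k$b)\<^sup>2 * (\<alpha> * (\<gamma> a - \<gamma> b)\<^sup>2 + (1 - \<alpha>) * (\<kappa> a - \<kappa> b)\<^sup>2))
     = (\<Sum>k\<in>UNIV. \<alpha> * (\<Sum>a\<in>UNIV. \<Sum>b\<in>UNIV. (U$k$a)\<^sup>2 * (U$k$b)\<^sup>2 * (\<gamma> a - \<gamma> b)\<^sup>2)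
        + (1 - \<alpha>) * (\<Sum>a\<in>UNIV. \<Sum>b\<in>UNIV. (U$k$a)\<^sup>2 * (U$k$b)\<^sup>2 * (\<kappa> a - \<kappa> b)\<^sup>2))"
    unfolding sum_distrib_left sum.distrib[symmetric]
    by (intro sum.cong refl) (simp add: algebra_simps)
  also have "\<dots> = 2 * ((\<Sum>a\<in>UNIV. \<alpha> * (\<gamma> a)\<^sup>2 + (1 - \<alpha>) * (\<kappa> a)\<^sup>2)
      - cc_objective \<alpha> (diagonal_matrix \<gamma>) (diagonal_matrix \<kappa>) U)"
    unfolding v cc_objective_eq
    by (simp add: sum.distrib sum_subtractf right_diff_distrib c mult.left_commute[of _ 2] flip: sum_distrib_left)
  finally show ?thesis by simp
qed

text \<open>With zero defect every term of the nonnegative sum vanishes, so by separation a row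
  cannot have two nonzero entries. Orthonormality then places the single entries in distinct columns
  and makes them signs.\<close>

lemma cc_diagonal_maximizer:
  fixes U :: "real^'p^'p" and \<gamma> \<kappa> :: "'p \<Rightarrow> real"
  assumes U: "orthogonal_matrix U" and \<alpha>: "0 \<le> \<alpha>" "\<alpha> \<le> 1"
    and sep: "\<And>k l. k \<noteq> l \<Longrightarrow> \<alpha> * (\<gamma> k - \<gamma> l)\<^sup>2 + (1 - \<alpha>) * (\<kappa> k - \<kappa> l)\<^sup>2 \<noteq> 0"
    and max: "(\<Sum>a\<in>UNIV. \<alpha> * (\<gamma> a)\<^sup>2 + (1 - \<alpha>) * (\<kappa> a)\<^sup>2)
      \<le> cc_objective \<alpha> (diagonal_matrix \<gamma>) (diagonal_matrix \<kappa>) U"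
  obtains \<pi> s where "bij \<pi>" "\<And>j. \<bar>s j\<bar> = 1" "signed_reindex \<pi> s U = mat 1"
proof -
  let ?t = "\<lambda>k a b. (U$k$a)\<^sup>2 * (U$k$b)\<^sup>2 * (\<alpha> * (\<gamma> a - \<gamma> b)\<^sup>2 + (1 - \<alpha>) * (\<kappa> a - \<kappa> b)\<^sup>2)"
  have nn: "0 \<le> ?t k a b" for k a b using \<alpha> by simp
  have "(\<Sum>k\<in>UNIV. \<Sum>a\<in>UNIV. \<Sum>b\<in>UNIV. ?t k a b) \<le> 0"
    using cc_objective_diagonal_defect[OF U, of \<alpha> \<gamma> \<kappa>] max by simp
  then have "(\<Sum>k\<in>UNIV. \<Sum>a\<in>UNIV. \<Sum>b\<in>UNIV. ?t k a b) = 0"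
    using nn by (simp add: antisym sum_nonneg)
  then have "?t k a b = 0" for k a b
    using nn by (simp add: sum_nonneg_eq_0_iff sum_nonneg) blast
  then have one: "U$k$a = 0 \<or> U$k$b = 0" if "a \<noteq> b" for k a b
    using sep[OF that] by (metis mult_eq_0_iff power_eq_0_iff)
  have row: "U$k \<bullet> U$l = of_bool (k = l)" for k l using U by (simp add: orthogonal_matrix_rows)
  have "\<exists>a. U$k$a \<noteq> 0" for k
    using row[of k k] by (metis inner_zero_left of_bool_eq(2) vec_eq_iff zero_index zero_neq_one)
  then obtain \<rho> where \<rho>: "\<And>k. U$k$(\<rho> k) \<noteq> 0" by metis
  have z: "U$k$a = 0" if "a \<noteq> \<rho> k" for k a using one[OF that] \<rho>[of k] by blast
  have ip: "U$k \<bullet> U$l = U$k$(\<rho> k) * U$l$(\<rho> k)" for k l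
  proof -
    have "U$k \<bullet> U$l = (\<Sum>a\<in>UNIV. if a = \<rho> k then U$k$(\<rho> k) * U$l$(\<rho> k) else 0)"
      unfolding inner_vec_def using z by (intro sum.cong) auto
    then show ?thesis by simp
  qed
  have "inj \<rho>"
  proof (rule injI)
    fix k l assume "\<rho> k = \<rho> l"
    then have "U$k \<bullet> U$l \<noteq> 0" using ip[of k l] \<rho>[of k] \<rho>[of l] by simp
    then show "k = l" using row[of k l] by (simp split: if_splits)
  qed
  then have \<rho>b: "bij \<rho>" by (simp add: finite_UNIV_inj_surj bij_def)
  \<comment> \<open>Row \<open>\<pi> j\<close> is the one whose nonzero entry stands in column
    \<open>j\<close>.\<close>
  define \<pi> where "\<pi> = inv \<rho>"
  have \<pi>: "bij \<pi>" "\<rho> (\<pi> j) = j" for j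
    using \<rho>b by (simp_all add: \<pi>_def bij_imp_bij_inv bij_is_surj surj_f_inv_f)
  define s where "s j = U$(\<pi> j)$j" for j
  have ss: "s j * s j = 1" for j
    using ip[of "\<pi> j" "\<pi> j"] row[of "\<pi> j" "\<pi> j"] by (simp add: s_def \<pi>(2))
  show thesis
  proof (rule that[OF \<pi>(1)])
    show "\<bar>s j\<bar> = 1" for j
      using ss[of j] by (metis abs_mult_self_eq abs_ge_zero abs_of_nonneg mult_1 power2_eq_iff_nonneg power2_eq_square zero_le_one)
    show "signed_reindex \<pi> s U = mat 1"
      using ss z by (auto simp: signed_reindex_def mat_def vec_eq_iff \<pi>(2)) (simp_all add: s_def \<pi>(2))
  qed
qed

text \<open>A uniform version by compactness: on the orthogonal matrices all of whose signed
  reindexings stay at distance at least \<open>e\<close> from the identity, the maximum of the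
  objective is below its limit value, and \<open>\<delta>\<close> is this gap.\<close>

lemma cc_diagonal_near_maximizer:
  fixes \<gamma> \<kappa> :: "'p::finite \<Rightarrow> real"
  assumes \<alpha>: "0 \<le> \<alpha>" "\<alpha> \<le> 1"
    and sep: "\<And>k l. k \<noteq> l \<Longrightarrow> \<alpha> * (\<gamma> k - \<gamma> l)\<^sup>2 + (1 - \<alpha>) * (\<kappa> k - \<kappa> l)\<^sup>2 \<noteq> 0"
    and e: "0 < e"
  obtains \<delta> where "0 < \<delta>"
    "\<And>U. orthogonal_matrix U \<Longrightarrow> (\<Sum>a\<in>UNIV. \<alpha> * (\<gamma> a)\<^sup>2 + (1 - \<alpha>) * (\<kappa> a)\<^sup>2) - \<delta>
        < cc_objective \<alpha> (diagonal_matrix \<gamma>) (diagonal_matrix \<kappa>) U \<Longrightarrow>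
      \<exists>\<pi> s. bij \<pi> \<and> (\<forall>j. \<bar>s j\<bar> = 1) \<and> norm (signed_reindex \<pi> s U - mat 1) < e"
proof -
  let ?f = "cc_objective \<alpha> (diagonal_matrix \<gamma>) (diagonal_matrix \<kappa>)"
    and ?m = "\<Sum>a\<in>UNIV. \<alpha> * (\<gamma> a)\<^sup>2 + (1 - \<alpha>) * (\<kappa> a)\<^sup>2"
  define K where "K = {U :: real^'p^'p. orthogonal_matrix U} \<inter>
    (\<Inter>\<pi>\<in>{\<pi>. bij \<pi>}. \<Inter>s\<in>{s. \<forall>j. \<bar>s j\<bar> = 1}. {U. e \<le> norm (signed_reindex \<pi> s U - mat 1)})"
  have "closed {U :: real^'p^'p. e \<le> norm (signed_reindex \<pi> s U - mat 1)}" for \<pi> s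
    unfolding signed_reindex_def by (intro closed_Collect_le continuous_intros)
  then have "compact K"
    unfolding K_def by (intro compact_Int_closed compact_orthogonal_matrices closed_INT ballI) auto
  have K: "\<exists>\<pi> s. bij \<pi> \<and> (\<forall>j. \<bar>s j\<bar> = 1) \<and> norm (signed_reindex \<pi> s U - mat 1) < e"
    if "orthogonal_matrix U" "U \<notin> K" for U
    using that by (auto simp: K_def not_le)
  show thesis
  proof (cases "K = {}")
    case True
    then show ?thesis using K by (intro that[of 1]) auto
  next
    case False
    obtain U0 where U0: "U0 \<in> K" "\<And>U. U \<in> K \<Longrightarrow> ?f U \<le> ?f U0"
      using continuous_attains_sup[OF \<open>compact K\<close> False continuous_on_cc_objective] by blast
    have o: "orthogonal_matrix U0" using U0(1) by (simp add: K_def)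
    have "?f U0 < ?m"
    proof (rule ccontr)
      assume "\<not> ?f U0 < ?m"
      then have "?m \<le> ?f U0" by simp
      then obtain \<pi> s where r: "bij \<pi>" "\<And>j. \<bar>s j\<bar> = 1" "signed_reindex \<pi> s U0 = mat 1"
        using cc_diagonal_maximizer[where \<gamma> = \<gamma> and \<kappa> = \<kappa>, OF o \<alpha> sep] by blast
      then have "e \<le> norm (signed_reindex \<pi> s U0 - mat 1)" using U0(1) unfolding K_def by blast
      then show False using r(3) e by simp
    qed
    then show ?thesis
      using K U0(2) by (intro that[of "?m - ?f U0"]) (force simp: not_less)+
  qed
qed

text \<open>The maximizer nearly maximizes the limit objective, so some signed reindexing of it is
  close to the identity. That reindexing is again a maximizer of the perturbed objective, hence
  \<open>U\<close>, being the nearest one, is at least as close.\<close>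

lemma cc_maximizer_consistent:
  fixes U A B :: "'i \<Rightarrow> real^'p^'p" and \<gamma> \<kappa> :: "'p \<Rightarrow> real"
  assumes A: "\<And>k l. (\<lambda>i. A i$k$l - of_bool (k = l) * \<gamma> k) \<in> o[F](\<lambda>_. 1)"
    and B: "\<And>k l. (\<lambda>i. B i$k$l - of_bool (k = l) * \<kappa> k) \<in> o[F](\<lambda>_. 1)"
    and \<alpha>: "0 \<le> \<alpha>" "\<alpha> \<le> 1"
    and sep: "\<And>k l. k \<noteq> l \<Longrightarrow> \<alpha> * (\<gamma> k - \<gamma> l)\<^sup>2 + (1 - \<alpha>) * (\<kappa> k - \<kappa> l)\<^sup>2 \<noteq> 0"
    and U: "eventually (\<lambda>i. orthogonal_matrix (U i)) F"
    and max: "eventually (\<lambda>i. \<forall>U'. orthogonal_matrix U' \<longrightarrow> cc_objective \<alpha> (A i) (B i) U' \<le> cc_objective \<alpha> (A i) (B i) (U i)) F"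
    and near: "eventually (\<lambda>i. \<forall>U'. orthogonal_matrix U' \<and>
       (\<forall>U''. orthogonal_matrix U'' \<longrightarrow> cc_objective \<alpha> (A i) (B i) U'' \<le> cc_objective \<alpha> (A i) (B i) U') \<longrightarrow>
       norm (U i - mat 1) \<le> norm (U' - mat 1)) F"
  shows "(U \<longlongrightarrow> mat 1) F"
proof -
  let ?f = "cc_objective \<alpha> (diagonal_matrix \<gamma>) (diagonal_matrix \<kappa>)"
    and ?m = "\<Sum>a\<in>UNIV. \<alpha> * (\<gamma> a)\<^sup>2 + (1 - \<alpha>) * (\<kappa> a)\<^sup>2"
  have bil_close: "(\<lambda>i. (bil (A i) (W i$k) (W i$k))\<^sup>2 - (bil (diagonal_matrix \<gamma>) (W i$k) (W i$k))\<^sup>2) \<in> o[F](\<lambda>_. 1)"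
    if W: "eventually (\<lambda>i. orthogonal_matrix (W i)) F"
      and A: "\<And>k l. (\<lambda>i. A i$k$l - of_bool (k = l) * \<gamma> k) \<in> o[F](\<lambda>_. 1)" for A W :: "'i \<Rightarrow> real^'p^'p" and \<gamma> k
  proof -
    have w: "(\<lambda>i. W i$k$a) \<in> O[F](\<lambda>_. 1)" for k a
      by (rule landau_o.bigI[of 1])
        (use W orthogonal_matrix_entry_le in \<open>auto elim!: eventually_mono\<close>)
    have w2: "(\<lambda>i. W i$k$a * W i$k$b) \<in> O[F](\<lambda>_. 1)" for k a b
      using landau_o.big_mult[OF w w] by simp
    let ?x = "\<lambda>i. bil (A i) (W i$k) (W i$k)" and ?y = "\<lambda>i. bil (diagonal_matrix \<gamma>) (W i$k) (W i$k)"
    have "(\<lambda>i. \<Sum>a\<in>UNIV. \<Sum>b\<in>UNIV. (A i$a$b - of_bool (a = b) * \<gamma> a) * (W i$k$a * W i$k$b)) \<in> o[F](\<lambda>_. 1)"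
      using landau_o.small_big_mult[OF A w2] by (intro big_sum_in_smallo) simp
    also have "(\<lambda>i. \<Sum>a\<in>UNIV. \<Sum>b\<in>UNIV. (A i$a$b - of_bool (a = b) * \<gamma> a) * (W i$k$a * W i$k$b)) = (\<lambda>i. ?x i - ?y i)"
      unfolding bil_eq_sum diagonal_matrix_def sum_subtractf[symmetric]
      by (intro ext sum.cong refl) (simp add: algebra_simps)
    finally have xy: "(\<lambda>i. ?x i - ?y i) \<in> o[F](\<lambda>_. 1)" .
    have "?y \<in> O[F](\<lambda>_. 1)"
      unfolding bil_diagonal power2_eq_square using w2 by (intro big_sum_in_bigo) auto
    then have "(\<lambda>i. (?x i - ?y i) + 2 * ?y i) \<in> O[F](\<lambda>_. 1)"
      using xy by (intro sum_in_bigo(1)) (auto intro: landau_o.small_imp_big)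
    from landau_o.small_big_mult[OF xy this] show ?thesis
      by (simp add: power2_eq_square algebra_simps)
  qed
  \<comment> \<open>Stated for an arbitrary family of orthogonal matrices, in place of a supremum
    bound; it is applied to the maximizer and to the identity.\<close>
  have close: "(\<lambda>i. cc_objective \<alpha> (A i) (B i) (W i) - ?f (W i)) \<in> o[F](\<lambda>_. 1)"
    if W: "eventually (\<lambda>i. orthogonal_matrix (W i)) F" for W
  proof -
    have "(\<lambda>i. \<Sum>k\<in>UNIV. \<alpha> * ((bil (A i) (W i$k) (W i$k))\<^sup>2 - (bil (diagonal_matrix \<gamma>) (W i$k) (W i$k))\<^sup>2) +
        (1 - \<alpha>) * ((bil (B i) (W i$k) (W i$k))\<^sup>2 - (bil (diagonal_matrix \<kappa>) (W i$k) (W i$k))\<^sup>2)) \<in> o[F](\<lambda>_. 1)"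
      using bil_close[OF W A] bil_close[OF W B] by (intro big_sum_in_smallo sum_in_smallo(1)) simp_all
    also have "(\<lambda>i. \<Sum>k\<in>UNIV. \<alpha> * ((bil (A i) (W i$k) (W i$k))\<^sup>2 - (bil (diagonal_matrix \<gamma>) (W i$k) (W i$k))\<^sup>2) +
        (1 - \<alpha>) * ((bil (B i) (W i$k) (W i$k))\<^sup>2 - (bil (diagonal_matrix \<kappa>) (W i$k) (W i$k))\<^sup>2))
       = (\<lambda>i. cc_objective \<alpha> (A i) (B i) (W i) - ?f (W i))"
      unfolding cc_objective_eq sum_subtractf[symmetric] by (intro ext sum.cong refl) (simp add: algebra_simps)
    finally show ?thesis .
  qed
  have oI: "orthogonal_matrix (mat 1 :: real^'p^'p)" by (simp add: orthogonal_matrix)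
  have fI: "?f (mat 1) = ?m"
  proof -
    have "bil (diagonal_matrix \<gamma>) (mat 1 $ k) (mat 1 $ k) = \<gamma> k" for \<gamma> :: "'p \<Rightarrow> real" and k
    proof -
      have "(\<Sum>a\<in>UNIV. \<gamma> a * ((mat 1 :: real^'p^'p)$k$a)\<^sup>2) = (\<Sum>a\<in>UNIV. of_bool (k = a) * \<gamma> a)"
        by (intro sum.cong) (auto simp: mat_def)
      then show ?thesis by (simp only: bil_diagonal sum_of_bool_pick)
    qed
    then show ?thesis unfolding cc_objective_eq by simp
  qed
  show ?thesis
  proof (rule tendstoI)
    fix e :: real assume "0 < e"
    then obtain \<delta> where \<delta>: "0 < \<delta>"
      "\<And>U. orthogonal_matrix U \<Longrightarrow> ?m - \<delta> < ?f U \<Longrightarrow>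
        \<exists>\<pi> s. bij \<pi> \<and> (\<forall>j. \<bar>s j\<bar> = 1) \<and> norm (signed_reindex \<pi> s U - mat 1) < e"
      using cc_diagonal_near_maximizer[where \<gamma> = \<gamma> and \<kappa> = \<kappa>, OF \<alpha> sep] by blast
    \<comment> \<open>Two comparison errors of at most \<open>\<delta> / 3\<close> leave the
      required strict inequality.\<close>
    have 1: "eventually (\<lambda>i. \<bar>cc_objective \<alpha> (A i) (B i) (U i) - ?f (U i)\<bar> \<le> \<delta> / 3) F"
      using landau_o.smallD[OF close[OF U], of "\<delta> / 3"] \<delta>(1) by simp
    have 2: "eventually (\<lambda>i. \<bar>cc_objective \<alpha> (A i) (B i) (mat 1) - ?f (mat 1)\<bar> \<le> \<delta> / 3) F"
      using landau_o.smallD[OF close[of "\<lambda>_. mat 1"], of "\<delta> / 3"] \<delta>(1) oI by simp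
    show "eventually (\<lambda>i. dist (U i) (mat 1) < e) F"
      using 1 2 U max near
    proof eventually_elim
      case (elim i)
      have "cc_objective \<alpha> (A i) (B i) (mat 1) \<le> cc_objective \<alpha> (A i) (B i) (U i)" using elim(4) oI by blast
      then have "?m - \<delta> < ?f (U i)" using elim(1,2) \<delta>(1) unfolding fI abs_le_iff by linarith
      then obtain \<pi> s where r: "bij \<pi>" "\<And>j. \<bar>s j\<bar> = 1" "norm (signed_reindex \<pi> s (U i) - mat 1) < e"
        using \<delta>(2)[OF elim(3)] by blast
      have "norm (U i - mat 1) \<le> norm (signed_reindex \<pi> s (U i) - mat 1)"
        using elim(5) orthogonal_signed_reindex[OF r(1,2) elim(3)] elim(4)
        by (simp add: cc_objective_signed_reindex[OF r(1,2)])
      then show ?case using r(3) by (simp add: dist_norm)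
    qed
  qed
qed

subsection \<open>Measurable selection of maximizers\<close>

definition caratheodory_on :: "'a measure \<Rightarrow> 'b::topological_space set \<Rightarrow> ('a \<Rightarrow> 'b \<Rightarrow> real) \<Rightarrow> bool" where
  "caratheodory_on M K f \<longleftrightarrow>
     (\<forall>u\<in>K. (\<lambda>\<omega>. f \<omega> u) \<in> borel_measurable M) \<and> (\<forall>\<omega>\<in>space M. continuous_on K (f \<omega>))"

text \<open>By compactness the infimum is attained, and by continuity it is already the infimum over
  a countable dense subset; the existence of a zero thus becomes a countable condition.\<close>

lemma measurable_ex_zero:
  fixes K :: "'b::euclidean_space set"
  assumes f: "caratheodory_on M K f" and K: "compact K" and nn: "\<And>\<omega> u. \<omega> \<in> space M \<Longrightarrow> u \<in> K \<Longrightarrow> 0 \<le> f \<omega> u"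
  shows "{\<omega>\<in>space M. \<exists>u\<in>K. f \<omega> u = 0} \<in> sets M"
proof -
  obtain T where T: "countable T" "T \<subseteq> K" "K \<subseteq> closure T"
    using separable by blast
  have "(\<exists>u\<in>K. f \<omega> u = 0) \<longleftrightarrow> (\<forall>n::nat. \<exists>u\<in>T. f \<omega> u < 1 / Suc n)" if \<omega>: "\<omega> \<in> space M" for \<omega>
  proof
    assume "\<exists>u\<in>K. f \<omega> u = 0"
    then obtain u where u: "u \<in> K" "f \<omega> u = 0" by blast
    show "\<forall>n::nat. \<exists>u\<in>T. f \<omega> u < 1 / Suc n"
    proof
      fix n :: nat
      have "continuous_on K (f \<omega>)" using f \<omega> by (simp add: caratheodory_on_def)
      then obtain d where d: "d > 0" "\<And>v. v \<in> K \<Longrightarrow> dist v u < d \<Longrightarrow> dist (f \<omega> v) (f \<omega> u) < 1 / Suc n"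
        using u(1) unfolding continuous_on_iff
        by (elim ballE[of _ _ u] allE[of _ "1 / real (Suc n)"]) auto
      obtain v where v: "v \<in> T" "dist v u < d"
        using T(3) u(1) d(1) by (meson closure_approachable subsetD)
      then have "dist (f \<omega> v) (f \<omega> u) < 1 / Suc n" using d T by blast
      then show "\<exists>u\<in>T. f \<omega> u < 1 / Suc n" using v(1) u(2) by (auto simp: dist_real_def intro!: bexI[of _ v])
    qed
  next
    assume H: "\<forall>n::nat. \<exists>u\<in>T. f \<omega> u < 1 / Suc n"
    then have "K \<noteq> {}" using T by auto
    then obtain u where u: "u \<in> K" "\<And>v. v \<in> K \<Longrightarrow> f \<omega> u \<le> f \<omega> v"
      using continuous_attains_inf[OF K, of "f \<omega>"] f \<omega> by (auto simp: caratheodory_on_def)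
    have "f \<omega> u \<le> 0"
    proof (rule ccontr)
      assume "\<not> f \<omega> u \<le> 0"
      then obtain n where "inverse (real (Suc n)) < f \<omega> u"
        using reals_Archimedean[of "f \<omega> u"] by auto
      moreover obtain v where "v \<in> T" "f \<omega> v < 1 / Suc n" using H by blast
      ultimately show False using u(2)[of v] T by (auto simp: inverse_eq_divide)
    qed
    then show "\<exists>u\<in>K. f \<omega> u = 0" using nn[OF \<omega> u(1)] u(1) by force
  qed
  then have "{\<omega>\<in>space M. \<exists>u\<in>K. f \<omega> u = 0} = (\<Inter>n::nat. \<Union>u\<in>T. {\<omega>\<in>space M. f \<omega> u < 1 / Suc n})"
    by auto
  also have "\<dots> \<in> sets M"
  proof (rule sets.countable_INT')
    show "(\<lambda>n::nat. \<Union>u\<in>T. {\<omega>\<in>space M. f \<omega> u < 1 / Suc n}) ` UNIV \<subseteq> sets M"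
    proof (clarify intro!: sets.countable_UN'[OF T(1)])
      fix n u assume "u \<in> T"
      then have [measurable]: "(\<lambda>\<omega>. f \<omega> u) \<in> borel_measurable M" using f T by (auto simp: caratheodory_on_def)
      show "{\<omega>\<in>space M. f \<omega> u < 1 / Suc n} \<in> sets M" by measurable
    qed
  qed auto
  finally show ?thesis .
qed

text \<open>
  Zero sets of nonnegative Caratheodory functions play the role of compact-valued measurable
  multifunctions: minimizing \<open>h\<close> over one of them gives another one.
\<close>

lemma measurable_refine_argmin:
  fixes K :: "'b::euclidean_space set"
  assumes c: "caratheodory_on M K c" and h: "caratheodory_on M K h" and K: "compact K"
    and nn: "\<And>\<omega> u. \<omega> \<in> space M \<Longrightarrow> u \<in> K \<Longrightarrow> 0 \<le> c \<omega> u"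
    and ne: "\<And>\<omega>. \<omega> \<in> space M \<Longrightarrow> \<exists>u\<in>K. c \<omega> u = 0"
  obtains m c' where "m \<in> borel_measurable M" "caratheodory_on M K c'"
    "\<And>\<omega> u. \<omega> \<in> space M \<Longrightarrow> u \<in> K \<Longrightarrow> 0 \<le> c' \<omega> u"
    "\<And>\<omega>. \<omega> \<in> space M \<Longrightarrow> \<exists>u\<in>K. c' \<omega> u = 0"
    "\<And>\<omega> u. \<omega> \<in> space M \<Longrightarrow> u \<in> K \<Longrightarrow> c' \<omega> u = 0 \<longleftrightarrow> c \<omega> u = 0 \<and> h \<omega> u = m \<omega>"
    "\<And>\<omega> u. \<omega> \<in> space M \<Longrightarrow> u \<in> K \<Longrightarrow> c \<omega> u = 0 \<Longrightarrow> m \<omega> \<le> h \<omega> u"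
proof -
  have "\<exists>u\<in>K. c \<omega> u = 0 \<and> (\<forall>v\<in>K. c \<omega> v = 0 \<longrightarrow> h \<omega> u \<le> h \<omega> v)" if \<omega>: "\<omega> \<in> space M" for \<omega>
  proof -
    have "closed {u\<in>K. c \<omega> u = 0}"
      using c \<omega> K continuous_closed_preimage_constant[of K "c \<omega>" 0]
      by (auto simp: caratheodory_on_def compact_imp_closed)
    then have "compact {u\<in>K. c \<omega> u = 0}"
      using K compact_Int_closed[of K "{u\<in>K. c \<omega> u = 0}"] by (simp add: Collect_conj_eq Int_absorb1 flip: Int_assoc)
    moreover have "continuous_on {u\<in>K. c \<omega> u = 0} (h \<omega>)"
      using h \<omega> by (auto simp: caratheodory_on_def intro: continuous_on_subset)
    ultimately show ?thesis
      using continuous_attains_inf[of "{u\<in>K. c \<omega> u = 0}" "h \<omega>"] ne[OF \<omega>] by auto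
  qed
  \<comment> \<open>A pointwise choice without measurability. It defines the minimal value
    \<open>m\<close> and witnesses that this value is attained.\<close>
  then obtain s where s: "\<And>\<omega>. \<omega> \<in> space M \<Longrightarrow> s \<omega> \<in> K \<and> c \<omega> (s \<omega>) = 0 \<and> (\<forall>v\<in>K. c \<omega> v = 0 \<longrightarrow> h \<omega> (s \<omega>) \<le> h \<omega> v)"
    by (atomize_elim, intro choice) blast
  define m where "m \<omega> = h \<omega> (s \<omega>)" for \<omega>
  have m: "m \<in> borel_measurable M"
  proof (rule borel_measurableI_le)
    fix t
    \<comment> \<open>A zero of this function is a zero of \<open>c\<close> at which
      \<open>h\<close> is at most \<open>t\<close>, so the sublevel set of \<open>m\<close> is of
      the form covered by \<open>measurable_ex_zero\<close>.\<close>
    define f where "f \<omega> u = c \<omega> u + max 0 (h \<omega> u - t)" for \<omega> u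
    have "caratheodory_on M K f"
      using c h unfolding caratheodory_on_def f_def
      by (auto intro!: continuous_intros borel_measurable_add borel_measurable_max borel_measurable_diff)
    then have "{\<omega>\<in>space M. \<exists>u\<in>K. f \<omega> u = 0} \<in> sets M"
      by (rule measurable_ex_zero[OF _ K]) (auto simp: f_def nn)
    also have "{\<omega>\<in>space M. \<exists>u\<in>K. f \<omega> u = 0} = {\<omega>\<in>space M. m \<omega> \<le> t}"
    proof -
      have "(\<exists>u\<in>K. f \<omega> u = 0) \<longleftrightarrow> m \<omega> \<le> t" if \<omega>: "\<omega> \<in> space M" for \<omega>
      proof
        assume "\<exists>u\<in>K. f \<omega> u = 0"
        then obtain u where u: "u \<in> K" "f \<omega> u = 0" by blast
        then have "c \<omega> u = 0" "h \<omega> u \<le> t" using nn[OF \<omega> u(1)] by (auto simp: f_def)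
        then show "m \<omega> \<le> t" using s[OF \<omega>] u(1) by (force simp: m_def)
      next
        assume "m \<omega> \<le> t"
        then show "\<exists>u\<in>K. f \<omega> u = 0" using s[OF \<omega>] by (auto simp: m_def f_def intro!: bexI[of _ "s \<omega>"])
      qed
      then show ?thesis by auto
    qed
    finally show "{\<omega>\<in>space M. m \<omega> \<le> t} \<in> sets M" .
  qed
  define c' where "c' \<omega> u = c \<omega> u + \<bar>h \<omega> u - m \<omega>\<bar>" for \<omega> u
  have z: "c' \<omega> u = 0 \<longleftrightarrow> c \<omega> u = 0 \<and> h \<omega> u = m \<omega>" if "\<omega> \<in> space M" "u \<in> K" for \<omega> u
    using nn[OF that] by (auto simp: c'_def)
  show thesis
  proof (rule that[of m c'])
    show "caratheodory_on M K c'"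
      using c h m unfolding caratheodory_on_def c'_def
      by (auto intro!: continuous_intros borel_measurable_add borel_measurable_abs borel_measurable_diff)
    show "\<exists>u\<in>K. c' \<omega> u = 0" if "\<omega> \<in> space M" for \<omega>
      using s[OF that] z[OF that] by (auto simp: m_def)
  qed (use m z s nn in \<open>auto simp: m_def c'_def\<close>)
qed

text \<open>Minimizing the coordinates one after another shrinks the zero set until all coordinates
  are fixed. The remaining point is a lexicographic minimum, and its coordinates are the measurable
  minimal values.\<close>

lemma measurable_zero_selection:
  fixes K :: "'b::euclidean_space set"
  assumes c: "caratheodory_on M K c" and K: "compact K"
    and nn: "\<And>\<omega> u. \<omega> \<in> space M \<Longrightarrow> u \<in> K \<Longrightarrow> 0 \<le> c \<omega> u"
    and ne: "\<And>\<omega>. \<omega> \<in> space M \<Longrightarrow> \<exists>u\<in>K. c \<omega> u = 0"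
  obtains s where "s \<in> borel_measurable M" "\<And>\<omega>. \<omega> \<in> space M \<Longrightarrow> s \<omega> \<in> K \<and> c \<omega> (s \<omega>) = 0"
proof -
  have refine: "\<exists>c' m. caratheodory_on M K c' \<and> (\<forall>\<omega>\<in>space M. \<forall>u\<in>K. 0 \<le> c' \<omega> u) \<and>
      (\<forall>\<omega>\<in>space M. \<exists>u\<in>K. c' \<omega> u = 0) \<and>
      (\<forall>\<omega>\<in>space M. \<forall>u\<in>K. c' \<omega> u = 0 \<longrightarrow> c \<omega> u = 0 \<and> (\<forall>b\<in>B. u \<bullet> b = m b \<omega>)) \<and>
      (\<forall>b\<in>B. m b \<in> borel_measurable M)" if "finite B" for B :: "'b set"
    using that
  proof (induction B)
    case empty
    then show ?case using assms by auto
  next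
    case (insert b B)
    then obtain c' m where H: "caratheodory_on M K c'" "\<forall>\<omega>\<in>space M. \<forall>u\<in>K. 0 \<le> c' \<omega> u"
      "\<forall>\<omega>\<in>space M. \<exists>u\<in>K. c' \<omega> u = 0"
      "\<forall>\<omega>\<in>space M. \<forall>u\<in>K. c' \<omega> u = 0 \<longrightarrow> c \<omega> u = 0 \<and> (\<forall>b\<in>B. u \<bullet> b = m b \<omega>)"
      "\<forall>b\<in>B. m b \<in> borel_measurable M" by blast
    have "caratheodory_on M K (\<lambda>_ u. u \<bullet> b)"
      by (auto simp: caratheodory_on_def intro!: continuous_intros)
    have h: "caratheodory_on M K (\<lambda>_ u. u \<bullet> b)" by fact
    obtain m' c'' where
      "m' \<in> borel_measurable M" "caratheodory_on M K c''"
      "\<And>\<omega> u. \<omega> \<in> space M \<Longrightarrow> u \<in> K \<Longrightarrow> 0 \<le> c'' \<omega> u"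
      "\<And>\<omega>. \<omega> \<in> space M \<Longrightarrow> \<exists>u\<in>K. c'' \<omega> u = 0"
      "\<And>\<omega> u. \<omega> \<in> space M \<Longrightarrow> u \<in> K \<Longrightarrow> c'' \<omega> u = 0 \<longleftrightarrow> c' \<omega> u = 0 \<and> u \<bullet> b = m' \<omega>"
      by (rule measurable_refine_argmin[OF H(1) h K]) (use H(2,3) that in \<open>simp_all\<close>)
    then show ?case
      using H insert.hyps by (intro exI[of _ c''] exI[of _ "m(b := m')"]) auto
  qed
  obtain c' :: "'a \<Rightarrow> 'b \<Rightarrow> real" and m where H:
    "\<forall>\<omega>\<in>space M. \<exists>u\<in>K. c' \<omega> u = 0"
    "\<forall>\<omega>\<in>space M. \<forall>u\<in>K. c' \<omega> u = 0 \<longrightarrow> c \<omega> u = 0 \<and> (\<forall>b\<in>Basis. u \<bullet> b = m b \<omega>)"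
    "\<forall>b\<in>Basis. m b \<in> borel_measurable M"
    using refine[OF finite_Basis] by (elim exE conjE) (rule that)
  define s where "s \<omega> = (\<Sum>b\<in>Basis. m b \<omega> *\<^sub>R b)" for \<omega>
  show thesis
  proof (rule that[of s])
    show "s \<in> borel_measurable M" unfolding s_def
      using H(3) by (auto intro!: borel_measurable_sum borel_measurable_scaleR)
    show "s \<omega> \<in> K \<and> c \<omega> (s \<omega>) = 0" if \<omega>: "\<omega> \<in> space M" for \<omega>
    proof -
      obtain u where u: "u \<in> K" "c' \<omega> u = 0" using H \<omega> by blast
      then have "c \<omega> u = 0" "\<forall>b\<in>Basis. u \<bullet> b = m b \<omega>" using H(2) \<omega> by blast+
      moreover from this have "s \<omega> = u" unfolding s_def
        by (metis (no_types, lifting) euclidean_representation sum.cong)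
      ultimately show ?thesis using u by simp
    qed
  qed
qed

text \<open>Two refinements, the second breaking ties in the first, followed by a selection. The
  starting function is 0, whose zero set is all of \<open>K\<close>.\<close>

lemma measurable_argmax_argmin:
  fixes K :: "'b::euclidean_space set" and h :: "'b \<Rightarrow> real"
  assumes f: "caratheodory_on M K f" and h: "continuous_on K h" and K: "compact K" "K \<noteq> {}"
  obtains s where "s \<in> borel_measurable M"
    "\<And>\<omega>. \<omega> \<in> space M \<Longrightarrow> s \<omega> \<in> K"
    "\<And>\<omega> u. \<omega> \<in> space M \<Longrightarrow> u \<in> K \<Longrightarrow> f \<omega> u \<le> f \<omega> (s \<omega>)"
    "\<And>\<omega> u. \<omega> \<in> space M \<Longrightarrow> u \<in> K \<Longrightarrow> (\<forall>v\<in>K. f \<omega> v \<le> f \<omega> u) \<Longrightarrow> h (s \<omega>) \<le> h u"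
proof -
  have zero: "caratheodory_on M K (\<lambda>_ _. 0)" and f': "caratheodory_on M K (\<lambda>\<omega> u. - f \<omega> u)"
    and h': "caratheodory_on M K (\<lambda>_. h)"
    using f h by (auto simp: caratheodory_on_def intro!: continuous_intros)
  obtain m1 c1 where 1: "m1 \<in> borel_measurable M" "caratheodory_on M K c1"
    "\<And>\<omega> u. \<omega> \<in> space M \<Longrightarrow> u \<in> K \<Longrightarrow> 0 \<le> c1 \<omega> u"
    "\<And>\<omega>. \<omega> \<in> space M \<Longrightarrow> \<exists>u\<in>K. c1 \<omega> u = 0"
    "\<And>\<omega> u. \<omega> \<in> space M \<Longrightarrow> u \<in> K \<Longrightarrow> c1 \<omega> u = 0 \<longleftrightarrow> - f \<omega> u = m1 \<omega>"
    "\<And>\<omega> u. \<omega> \<in> space M \<Longrightarrow> u \<in> K \<Longrightarrow> m1 \<omega> \<le> - f \<omega> u"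
    by (rule measurable_refine_argmin[OF zero f' K(1)]) (use K(2) that in \<open>auto\<close>)
  obtain m2 c2 where 2: "m2 \<in> borel_measurable M" "caratheodory_on M K c2"
    "\<And>\<omega> u. \<omega> \<in> space M \<Longrightarrow> u \<in> K \<Longrightarrow> 0 \<le> c2 \<omega> u"
    "\<And>\<omega>. \<omega> \<in> space M \<Longrightarrow> \<exists>u\<in>K. c2 \<omega> u = 0"
    "\<And>\<omega> u. \<omega> \<in> space M \<Longrightarrow> u \<in> K \<Longrightarrow> c2 \<omega> u = 0 \<longleftrightarrow> c1 \<omega> u = 0 \<and> h u = m2 \<omega>"
    "\<And>\<omega> u. \<omega> \<in> space M \<Longrightarrow> u \<in> K \<Longrightarrow> c1 \<omega> u = 0 \<Longrightarrow> m2 \<omega> \<le> h u"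
    by (rule measurable_refine_argmin[OF 1(2) h' K(1) 1(3,4)]) (assumption | rule that)+
  obtain s where s: "s \<in> borel_measurable M" "\<And>\<omega>. \<omega> \<in> space M \<Longrightarrow> s \<omega> \<in> K \<and> c2 \<omega> (s \<omega>) = 0"
    by (rule measurable_zero_selection[OF 2(2) K(1) 2(3,4)]) (assumption | rule that)+
  have *: "s \<omega> \<in> K" "- f \<omega> (s \<omega>) = m1 \<omega>" "h (s \<omega>) = m2 \<omega>" if "\<omega> \<in> space M" for \<omega>
    using s(2)[OF that] 1(5)[OF that] 2(5)[OF that] by auto
  show thesis
  proof (rule that[of s])
    show "f \<omega> u \<le> f \<omega> (s \<omega>)" if "\<omega> \<in> space M" "u \<in> K" for \<omega> u
      using 1(6)[OF that] *(2)[OF that(1)] by simp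
    show "h (s \<omega>) \<le> h u" if "\<omega> \<in> space M" "u \<in> K" "\<forall>v\<in>K. f \<omega> v \<le> f \<omega> u" for \<omega> u
    proof -
      have "f \<omega> (s \<omega>) \<le> f \<omega> u" using that *(1) by blast
      then have "- f \<omega> u = m1 \<omega>" using *(2)[OF that(1)] 1(6)[OF that(1,2)] by simp
      then show ?thesis using 2(6)[OF that(1,2)] 1(5)[OF that(1,2)] *(3)[OF that(1)] by simp
    qed
  qed (use s in auto)
qed

subsection \<open>Stochastic order and the empirical law\<close>

text \<open>For large \<open>n\<close>, statements along this filter hold uniformly in
  \<open>\<omega>\<close> on the event that \<open>Y n\<close> is at most \<open>K\<close>; this
  uniformity is what yields bounds on probabilities.\<close>

definition tight_filter :: "'a measure \<Rightarrow> (nat \<Rightarrow> 'a \<Rightarrow> real) \<Rightarrow> real \<Rightarrow> (nat \<times> 'a) filter" where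
  "tight_filter M Y K = inf (filtercomap fst sequentially) (principal {(n, \<omega>). \<omega> \<in> space M \<and> Y n \<omega> \<le> K})"

lemma eventually_tight_filter:
  "eventually Q (tight_filter M Y K) \<longleftrightarrow> (\<exists>N. \<forall>n\<ge>N. \<forall>\<omega>\<in>space M. Y n \<omega> \<le> K \<longrightarrow> Q (n, \<omega>))"
  unfolding tight_filter_def eventually_inf_principal eventually_filtercomap eventually_sequentially
  by (auto simp: split_beta)

lemma filterlim_tight_filter: "filterlim fst sequentially (tight_filter M Y K)"
  unfolding tight_filter_def by (rule filterlim_mono[OF filterlim_filtercomap order_refl inf_le1])

text \<open>For large \<open>n\<close>, \<open>X n\<close> can exceed \<open>e\<close> only where
  \<open>Y n\<close> exceeds \<open>K\<close>, and tightness lets \<open>K\<close> be chosen so that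
  this has probability below \<open>r\<close>.\<close>

lemma (in prob_space) oP1_tight_filterI:
  fixes X :: "nat \<Rightarrow> 'a \<Rightarrow> 'b::real_normed_vector"
  assumes Y [measurable]: "\<And>n. Y n \<in> borel_measurable M" and tight: "OP1 M Y"
    and X: "\<And>K. ((\<lambda>(n, \<omega>). X n \<omega>) \<longlongrightarrow> 0) (tight_filter M Y K)"
  shows "oP1 M X"
  unfolding oP1_def
proof (intro allI impI LIMSEQ_I)
  fix e r :: real assume e: "0 < e" and r: "0 < r"
  obtain K where "\<forall>\<^sub>F n in sequentially. measure M {\<omega>\<in>space M. norm (Y n \<omega>) > K} < r"
    using tight r unfolding OP1_def by blast
  moreover obtain N where N: "\<And>n \<omega>. n \<ge> N \<Longrightarrow> \<omega> \<in> space M \<Longrightarrow> Y n \<omega> \<le> K \<Longrightarrow> norm (X n \<omega>) < e"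
    using tendstoD[OF X[of K] e] unfolding eventually_tight_filter by (auto simp: dist_norm)
  ultimately obtain N' where N': "\<And>n. n \<ge> N' \<Longrightarrow> measure M {\<omega>\<in>space M. norm (Y n \<omega>) > K} < r"
    unfolding eventually_sequentially by blast
  show "\<exists>no. \<forall>n\<ge>no. norm (measure M {\<omega>\<in>space M. e < norm (X n \<omega>)} - 0) < r"
  proof (intro exI[of _ "max N N'"] allI impI)
    fix n assume n: "max N N' \<le> n"
    have "measure M {\<omega>\<in>space M. e < norm (X n \<omega>)} \<le> measure M {\<omega>\<in>space M. norm (Y n \<omega>) > K}"
    proof (rule finite_measure_mono)
      show "{\<omega>\<in>space M. e < norm (X n \<omega>)} \<subseteq> {\<omega>\<in>space M. norm (Y n \<omega>) > K}"
      proof clarify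
        fix \<omega> assume "\<omega> \<in> space M" "e < norm (X n \<omega>)"
        then have "\<not> Y n \<omega> \<le> K" using N[of n \<omega>] n by auto
        then show "norm (Y n \<omega>) > K" by (simp add: abs_if)
      qed
    qed measurable
    then show "norm (measure M {\<omega>\<in>space M. e < norm (X n \<omega>)} - 0) < r"
      using N'[of n] n by simp
  qed
qed

lemma (in prob_space) OP1_add:
  fixes X :: "nat \<Rightarrow> 'a \<Rightarrow> real"
  assumes [measurable]: "\<And>n. X n \<in> borel_measurable M" "\<And>n. Y n \<in> borel_measurable M"
    and X: "OP1 M X" and Y: "OP1 M (Y :: nat \<Rightarrow> 'a \<Rightarrow> real)"
  shows "OP1 M (\<lambda>n \<omega>. X n \<omega> + Y n \<omega>)"
  unfolding OP1_def
proof (intro allI impI)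
  fix e :: real assume "0 < e"
  then have "0 < e / 2" by simp
  then obtain K L where K: "\<forall>\<^sub>F n in sequentially. measure M {\<omega>\<in>space M. norm (X n \<omega>) > K} < e / 2"
    and L: "\<forall>\<^sub>F n in sequentially. measure M {\<omega>\<in>space M. norm (Y n \<omega>) > L} < e / 2"
    using X Y unfolding OP1_def by blast
  show "\<exists>K. \<forall>\<^sub>F n in sequentially. measure M {\<omega>\<in>space M. norm (X n \<omega> + Y n \<omega>) > K} < e"
  proof (rule exI[of _ "K + L"], use K L in eventually_elim)
    case (elim n)
    have "measure M {\<omega>\<in>space M. norm (X n \<omega> + Y n \<omega>) > K + L}
      \<le> measure M ({\<omega>\<in>space M. norm (X n \<omega>) > K} \<union> {\<omega>\<in>space M. norm (Y n \<omega>) > L})"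
      by (rule finite_measure_mono) auto
    also have "\<dots> \<le> measure M {\<omega>\<in>space M. norm (X n \<omega>) > K} + measure M {\<omega>\<in>space M. norm (Y n \<omega>) > L}"
      by (rule measure_Un_le) auto
    finally show ?case using elim by simp
  qed
qed

lemma (in prob_space) OP1_sum:
  fixes X :: "'j \<Rightarrow> nat \<Rightarrow> 'a \<Rightarrow> real"
  assumes "finite J" "\<And>j n. j \<in> J \<Longrightarrow> X j n \<in> borel_measurable M" "\<And>j. j \<in> J \<Longrightarrow> OP1 M (X j)"
  shows "OP1 M (\<lambda>n \<omega>. \<Sum>j\<in>J. X j n \<omega>)"
  using assms
proof (induction J)
  case empty
  show ?case unfolding OP1_def by (auto intro!: exI[of _ 0])
next
  case (insert j J)
  have "OP1 M (\<lambda>n \<omega>. X j n \<omega> + (\<Sum>j\<in>J. X j n \<omega>))"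
    using insert by (intro OP1_add borel_measurable_sum) auto
  then show ?case using insert by simp
qed

lemma OP1_norm: "OP1 M X \<Longrightarrow> OP1 M (\<lambda>n \<omega>. norm (X n \<omega>))"
  by (simp add: OP1_def)

section \<open>Functionals evaluated at the empirical law\<close>

lemma sets_empirical [measurable_cong]: "sets (empirical n x) = sets borel"
  by (simp add: empirical_def)

lemma integral_empirical:
  fixes g :: "real^'p \<Rightarrow> 'b::{banach, second_countable_topology}"
  assumes [measurable]: "g \<in> borel_measurable borel"
  shows "integral\<^sup>L (empirical n x) g = (1 / real n) *\<^sub>R (\<Sum>t<n. g (x t))"
proof -
  have "integral\<^sup>L (empirical n x) g = integral\<^sup>L (uniform_count_measure {..<n}) (\<lambda>t. g (x t))"
    unfolding empirical_def by (rule integral_distr) (auto simp: uniform_count_measure_def point_measure_def)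
  also have "\<dots> = (\<Sum>t<n. (1 / real n) *\<^sub>R g (x t))"
    unfolding uniform_count_measure_def by (subst lebesgue_integral_point_measure_finite) auto
  finally show ?thesis by (simp add: scaleR_sum_right)
qed

lemma mean_vec_empirical: "mean_vec (empirical n x) $ k = emp_moment n x [Some k]"
  unfolding mean_vec_def by (simp add: integral_empirical emp_moment_def monomial_def coord_def)

lemma sum_centering_coord:
  "(V *v (x t - mean_vec (empirical n x))) $ k = (\<Sum>a\<in>UNIV. centering n x V k a * coord (x t) a)"
  by (simp add: sum_option_UNIV centering_def coord_def matrix_vector_mult_def mean_vec_empirical
      algebra_simps sum_subtractf)

text \<open>The bridge between functionals of laws and the mixed moments that are expanded: centring
  and standardization together are the rows \<open>centering\<close> acting on augmented
  data.\<close>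

lemma integral_standardized_law:
  fixes F :: "(real^'p) measure \<Rightarrow> real^'p^'p"
  shows "(\<integral>y. prod_list (map (\<lambda>k. y$k) ks) \<partial>standardized_law F (empirical n x)) =
    mixed_moment n x (centering n x (F (empirical n x))) ks []"
proof -
  let ?P = "empirical n x"
  have meas: "(\<lambda>y. prod_list (map (\<lambda>k. y$k) ks)) \<in> borel_measurable (borel :: (real^'p) measure)"
    by (induction ks) simp_all
  have lin: "(\<lambda>x. F ?P *v (x - mean_vec ?P)) \<in> borel_measurable borel"
    by (intro borel_measurable_continuous_onI
        continuous_on_compose2[OF matrix_vector_mult_linear_continuous_on[of UNIV]] continuous_intros) auto
  have "(\<integral>y. prod_list (map (\<lambda>k. y$k) ks) \<partial>standardized_law F ?P) =
      (\<integral>v. prod_list (map (\<lambda>k. (F ?P *v (v - mean_vec ?P))$k) ks) \<partial>?P)"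
    unfolding standardized_law_def
    by (rule integral_distr[OF _ meas]) (simp add: lin measurable_cong_sets[OF sets_empirical refl])
  also have "\<dots> = (1 / real n) *\<^sub>R (\<Sum>t<n. prod_list (map (\<lambda>k. (F ?P *v (x t - mean_vec ?P))$k) ks))"
    by (rule integral_empirical) (rule measurable_compose[OF lin meas])
  finally show ?thesis
    by (simp add: sum_centering_coord mixed_moment_def monomial_def)
qed

lemma C3_empirical:
  "C3 (standardized_law F (empirical n x)) $ k $ l = emp_C3 n x (centering n x (F (empirical n x))) k l"
  using integral_standardized_law[where ks = "[j, k, l]" and F = F and n = n and x = x for j]
  by (simp add: C3_def C3i_def emp_C3_def)

lemma C4_empirical:
  "C4 (standardized_law F (empirical n x)) $ k $ l = emp_C4 n x (centering n x (F (empirical n x))) k l"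
  using integral_standardized_law[where ks = "[i, j, k, l]" and F = F and n = n and x = x for i j]
    integral_standardized_law[where ks = "[i, j]" and F = F and n = n and x = x for i j]
  by (simp add: C4_def C4ij_def emp_C4_def mult.assoc)

lemma C3_symmetric: "transpose (C3 Q) = C3 Q"
  by (simp add: C3_def C3i_def transpose_def vec_eq_iff mult.commute)

lemma C4_symmetric: "transpose (C4 Q) = C4 Q"
  by (simp add: C4_def C4ij_def transpose_def vec_eq_iff mult.commute)

lemma cov_mat_empirical:
  assumes "0 < n"
  shows "cov_mat (empirical n x) $ k $ l = emp_moment n x [Some k, Some l] - emp_moment n x [Some k] * emp_moment n x [Some l]"
proof -
  define a b where "a = emp_moment n x [Some k]" and "b = emp_moment n x [Some l]"
  have ab: "(\<Sum>t<n. x t $ k) = real n * a" "(\<Sum>t<n. x t $ l) = real n * b"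
    using assms by (simp_all add: a_def b_def emp_moment_def monomial_def coord_def)
  have "cov_mat (empirical n x) $ k $ l = (1 / real n) * (\<Sum>t<n. (x t $ k - a) * (x t $ l - b))"
    by (simp add: cov_mat_def mean_vec_empirical integral_empirical a_def b_def)
  also have "(\<Sum>t<n. (x t $ k - a) * (x t $ l - b)) = (\<Sum>t<n. x t $ k * x t $ l) - b * (\<Sum>t<n. x t $ k) - a * (\<Sum>t<n. x t $ l) + real n * (a * b)"
    by (simp add: algebra_simps sum.distrib sum_subtractf sum_distrib_left)
  finally show ?thesis
    using assms unfolding ab a_def[symmetric] b_def[symmetric]
    by (simp add: emp_moment_def monomial_def coord_def field_simps)
qed

lemma square_integrable_empirical:
  assumes "0 < n"
  shows "square_integrable_law (empirical n x)"
proof -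
  interpret u: prob_space "uniform_count_measure {..<n}"
    using assms by (intro prob_space_uniform_count_measure) auto
  have [measurable]: "x \<in> borel_measurable (uniform_count_measure {..<n})"
    by (auto simp: uniform_count_measure_def point_measure_def)
  have "prob_space (empirical n x)"
    unfolding empirical_def by (rule u.prob_space_distr) measurable
  moreover have "integrable (empirical n x) (\<lambda>v. (v$k)\<^sup>2)" for k
    unfolding empirical_def
    by (subst integrable_distr_eq) (auto simp: uniform_count_measure_def intro: integrable_point_measure_finite)
  ultimately show ?thesis by (simp add: square_integrable_law_def empirical_def)
qed

text \<open>Commutation of \<open>R\<close> and \<open>S\<close> is avoided: \<open>R ** S\<close>
  is a right inverse of the square matrix \<open>R\<close>, hence also a left inverse.\<close>

lemma inverse_sqrt_whitens:
  assumes "inverse_sqrt_of S R"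
  shows "R ** S ** R = mat 1"
proof -
  have "matrix_inv S ** S = mat 1"
    using assms someI_ex[of "\<lambda>S'. S ** S' = mat 1 \<and> S' ** S = mat 1"]
    unfolding inverse_sqrt_of_def invertible_def matrix_inv_def by blast
  then have "R ** (R ** S) = mat 1"
    using assms by (simp add: inverse_sqrt_of_def matrix_mul_assoc)
  then show ?thesis by (metis matrix_left_right_inverse)
qed

text \<open>The left side is an entry of \<open>F S F\<^sup>T\<close> with \<open>S\<close> the
  sample covariance. As \<open>F = U R\<close> with \<open>U\<close> orthogonal and \<open>R\<close>
  the inverse root of \<open>S\<close>, that product is the identity, without error term.\<close>

lemma mixed_moment_white:
  fixes F :: "(real^'p) measure \<Rightarrow> real^'p^'p"
  assumes F: "ic_functional D F" and n: "0 < n" and inv: "invertible (cov_mat (empirical n x))"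
  shows "mixed_moment n x (centering n x (F (empirical n x))) [k, l] [] = of_bool (k = l)"
proof -
  let ?P = "empirical n x" and ?S = "cov_mat (empirical n x)"
  obtain U R where U: "orthogonal_matrix U" and R: "inverse_sqrt_of ?S R" and FP: "F ?P = U ** R"
    using F square_integrable_empirical[OF n] inv unfolding ic_functional_def by blast
  have "transpose R = R" using R by (simp add: inverse_sqrt_of_def)
  then have "F ?P ** ?S ** transpose (F ?P) = U ** (R ** ?S ** R) ** transpose U"
    by (simp add: FP matrix_transpose_mul matrix_mul_assoc)
  also have "\<dots> = mat 1"
    using U by (simp add: inverse_sqrt_whitens[OF R] orthogonal_matrix_def)
  finally have w: "F ?P ** ?S ** transpose (F ?P) = mat 1" .
  let ?m = "mean_vec ?P"
  have S: "?S $ a $ b = (1 / real n) * (\<Sum>t<n. (x t $ a - ?m $ a) * (x t $ b - ?m $ b))" for a b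
    by (simp add: cov_mat_def integral_empirical)
  have "mixed_moment n x (centering n x (F ?P)) [k, l] [] =
      (1 / real n) * (\<Sum>t<n. (\<Sum>a\<in>UNIV. F ?P $ k $ a * (x t $ a - ?m $ a)) * (\<Sum>b\<in>UNIV. F ?P $ l $ b * (x t $ b - ?m $ b)))"
    unfolding mixed_moment_def by (simp add: sum_centering_coord[symmetric] monomial_def) (simp add: matrix_vector_mult_def)
  also have "\<dots> = (\<Sum>t<n. \<Sum>b\<in>UNIV. \<Sum>a\<in>UNIV. F ?P $ k $ a * ((1 / real n) * ((x t $ a - ?m $ a) * (x t $ b - ?m $ b))) * F ?P $ l $ b)"
    unfolding mult.commute[of "\<Sum>a\<in>UNIV. F ?P $ k $ a * (x _ $ a - ?m $ a)"] sum_product sum_distrib_left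
    by (intro sum.cong refl) (simp add: mult_ac)
  also have "\<dots> = (\<Sum>b\<in>UNIV. \<Sum>a\<in>UNIV. \<Sum>t<n. F ?P $ k $ a * ((1 / real n) * ((x t $ a - ?m $ a) * (x t $ b - ?m $ b))) * F ?P $ l $ b)"
    by (subst sum.swap, intro sum.cong refl, rule sum.swap)
  also have "\<dots> = (F ?P ** ?S ** transpose (F ?P)) $ k $ l"
    by (simp add: matrix_matrix_mult_def transpose_def S sum_distrib_left sum_distrib_right)
  also have "\<dots> = of_bool (k = l)" unfolding w by (simp add: mat_def)
  finally show ?thesis .
qed

lemma borel_measurable_mixed_moment:
  assumes z: "\<And>t. z t \<in> borel_measurable M" and V: "V \<in> borel_measurable M"
  shows "(\<lambda>\<omega>. mixed_moment n (\<lambda>t. z t \<omega>) (centering n (\<lambda>t. z t \<omega>) (V \<omega>)) ks as) \<in> borel_measurable M"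
proof -
  have em: "(\<lambda>\<omega>. emp_moment n (\<lambda>t. z t \<omega>) as) \<in> borel_measurable M" for as
    unfolding emp_moment_def
    by (intro borel_measurable_times borel_measurable_const borel_measurable_sum
        measurable_compose[OF z borel_measurable_monomial])
  have cen: "(\<lambda>\<omega>. centering n (\<lambda>t. z t \<omega>) (V \<omega>) k a) \<in> borel_measurable M" for k a
    using em V by (cases a) (auto simp: centering_def intro!: borel_measurable_vec_nth borel_measurable_times borel_measurable_sum)
  show ?thesis
  proof (induction ks arbitrary: as)
    case Nil
    then show ?case using em by simp
  next
    case (Cons k ks)
    then show ?case unfolding mixed_moment_Cons by (intro borel_measurable_sum borel_measurable_times cen)
  qed
qed

subsection \<open>Asymptotics of the compound cumulant solutions\<close>

lemma tendsto_det:
  fixes A :: "'i \<Rightarrow> real^'n^'n"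
  assumes "\<And>k l. ((\<lambda>i. A i$k$l) \<longlongrightarrow> B$k$l) F"
  shows "((\<lambda>i. det (A i)) \<longlongrightarrow> det B) F"
  unfolding det_def by (intro tendsto_sum tendsto_mult tendsto_const tendsto_prod assms)

lemma tendsto_matrixI:
  fixes A :: "'i \<Rightarrow> real^'n^'m"
  assumes "\<And>k l. ((\<lambda>i. A i$k$l) \<longlongrightarrow> B$k$l) F"
  shows "(A \<longlongrightarrow> B) F"
  by (intro vec_tendstoI assms)

section \<open>The random sample and its tight events\<close>

locale ic_sample = prob_space M for M :: "'a measure" +
  fixes z :: "nat \<Rightarrow> 'a \<Rightarrow> real^'p" and P :: "(real^'p) measure" and D :: "(real^'p) measure set"
    and F :: "(real^'p) measure \<Rightarrow> real^'p^'p" and V :: "nat \<Rightarrow> 'a \<Rightarrow> real^'p^'p" and d :: nat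
  assumes sample_indep: "indep_vars (\<lambda>_. borel) z UNIV"
    and sample_law: "\<And>i. distr M borel (z i) = P"
    and P: "standardized_independent P"
    and F: "ic_functional D F"
    and V_def: "\<And>n \<omega>. V n \<omega> = F (empirical n (\<lambda>i. z i \<omega>))"
    and V_measurable: "\<And>n. V n \<in> borel_measurable M"
    and V_root_n: "OP1 M (\<lambda>n \<omega>. sqrt (real n) *\<^sub>R (V n \<omega> - mat 1))"
    and mom: "\<And>k. integrable P (\<lambda>x. (x$k)^(2*d))" and d3: "3 \<le> d"
begin

lemma z_measurable [measurable]: "z t \<in> borel_measurable M"
  using sample_indep by (auto simp: indep_vars_def)

text \<open>One random variable dominating all scaled errors, so that a single bound controls
  \<open>V\<close> and every sample moment at once. There are finitely many lists of length at most
  \<open>d\<close>, hence it is tight.\<close>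

definition scaled_error :: "nat \<Rightarrow> 'a \<Rightarrow> real" where
  "scaled_error n \<omega> = norm (sqrt (real n) *\<^sub>R (V n \<omega> - mat 1)) +
     (\<Sum>as\<in>{as. length as \<le> d}. norm (sqrt (real n) * (emp_moment n (\<lambda>t. z t \<omega>) as - pop_moment P as)))"

lemma finite_multi_indices: "finite {as :: 'p option list. length as \<le> d}"
  using finite_lists_length_le[of "UNIV :: 'p option set" d] by simp

declare V_measurable [measurable]

lemma emp_moment_measurable [measurable]: "(\<lambda>\<omega>. emp_moment n (\<lambda>t. z t \<omega>) as) \<in> borel_measurable M"
  unfolding emp_moment_def
  by (intro borel_measurable_times borel_measurable_const borel_measurable_sum
      measurable_compose[OF z_measurable borel_measurable_monomial])

lemma scaled_error_measurable: "scaled_error n \<in> borel_measurable M"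
  unfolding scaled_error_def[abs_def] by measurable

lemma scaled_error_tight: "OP1 M scaled_error"
  unfolding scaled_error_def[abs_def]
proof (intro OP1_add OP1_sum OP1_norm V_root_n finite_multi_indices)
  fix as :: "'p option list" assume "as \<in> {as. length as \<le> d}"
  then have "integrable P (\<lambda>v. (monomial v as)\<^sup>2)"
    by (intro integrable_monomial_square[OF P mom]) simp
  from OP1_sample_mean[OF sample_indep sample_law borel_measurable_monomial this]
  show "OP1 M (\<lambda>n \<omega>. sqrt (real n) * (emp_moment n (\<lambda>t. z t \<omega>) as - pop_moment P as))"
    by (simp add: emp_moment_def pop_moment_def)
qed measurable

abbreviation (input) root_scale :: "nat \<times> 'a \<Rightarrow> real" where "root_scale i \<equiv> 1 / sqrt (real (fst i))"
abbreviation (input) data :: "nat \<times> 'a \<Rightarrow> nat \<Rightarrow> real^'p" where "data i \<equiv> \<lambda>t. z t (snd i)"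
abbreviation (input) Vi :: "nat \<times> 'a \<Rightarrow> real^'p^'p" where "Vi i \<equiv> V (fst i) (snd i)"

lemma eventually_pos: "eventually (\<lambda>i. 0 < fst i) (tight_filter M scaled_error K)"
  unfolding eventually_tight_filter by (intro exI[of _ 1]) auto

lemma eventually_le: "eventually (\<lambda>i. scaled_error (fst i) (snd i) \<le> K) (tight_filter M scaled_error K)"
  unfolding eventually_tight_filter by auto

lemma root_scale_small: "root_scale \<in> o[tight_filter M scaled_error K](\<lambda>_. 1)"
proof (rule smalloI_tendsto)
  have "filterlim (\<lambda>i. sqrt (real (fst i))) at_top (tight_filter M scaled_error K)"
    by (intro filterlim_compose[OF sqrt_at_top] filterlim_compose[OF filterlim_real_sequentially filterlim_tight_filter])
  then show "((\<lambda>i. root_scale i / 1) \<longlongrightarrow> 0) (tight_filter M scaled_error K)"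
    using tendsto_inverse_0_at_top by (simp add: inverse_eq_divide)
qed simp

lemma bounded_by_scaled_error:
  assumes "\<And>n \<omega>. \<bar>sqrt (real n) * X (n, \<omega>)\<bar> \<le> scaled_error n \<omega>"
  shows "X \<in> O[tight_filter M scaled_error K](root_scale)"
\<comment> \<open>\<open>K\<close> is an arbitrary real number, whereas the constant has to be
  positive.\<close>
proof (rule landau_o.bigI[of "\<bar>K\<bar> + 1"])
  show "eventually (\<lambda>i. norm (X i) \<le> (\<bar>K\<bar> + 1) * norm (root_scale i)) (tight_filter M scaled_error K)"
    using eventually_pos eventually_le
  proof eventually_elim
    case (elim i)
    have "sqrt (real (fst i)) * \<bar>X i\<bar> \<le> \<bar>K\<bar> + 1"
      using assms[of "fst i" "snd i"] elim(2) by (simp add: abs_mult)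
    then show ?case using elim(1) by (simp add: field_simps)
  qed
qed simp

lemma V_expansion: "(\<lambda>i. Vi i$k$l - of_bool (k = l)) \<in> O[tight_filter M scaled_error K](root_scale)"
proof (rule bounded_by_scaled_error)
  fix n \<omega>
  have "\<bar>sqrt (real n) * (V n \<omega>$k$l - of_bool (k = l))\<bar> = norm ((sqrt (real n) *\<^sub>R (V n \<omega> - mat 1))$k$l)"
    by (simp add: mat_def)
  also have "\<dots> \<le> norm (sqrt (real n) *\<^sub>R (V n \<omega> - mat 1))"
    by (rule order_trans[OF Finite_Cartesian_Product.norm_nth_le Finite_Cartesian_Product.norm_nth_le])
  also have "\<dots> \<le> scaled_error n \<omega>" unfolding scaled_error_def by (simp add: sum_nonneg)
  finally show "\<bar>sqrt (real n) * (Vi (n, \<omega>)$k$l - of_bool (k = l))\<bar> \<le> scaled_error n \<omega>" by simp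
qed

lemma emp_moment_expansion:
  assumes "length as \<le> d"
  shows "(\<lambda>i. emp_moment (fst i) (data i) as - pop_moment P as) \<in> O[tight_filter M scaled_error K](root_scale)"
proof (rule bounded_by_scaled_error)
  fix n \<omega>
  have "norm (sqrt (real n) * (emp_moment n (\<lambda>t. z t \<omega>) as - pop_moment P as)) \<le>
    (\<Sum>as\<in>{as. length as \<le> d}. norm (sqrt (real n) * (emp_moment n (\<lambda>t. z t \<omega>) as - pop_moment P as)))"
    using assms by (intro member_le_sum[where f = "\<lambda>as. norm (sqrt (real n) * (emp_moment n (\<lambda>t. z t \<omega>) as - pop_moment P as))"])
      (auto intro: finite_multi_indices)
  also have "\<dots> \<le> scaled_error n \<omega>" unfolding scaled_error_def by simp
  finally show "\<bar>sqrt (real n) * (emp_moment (fst (n, \<omega>)) (data (n, \<omega>)) as - pop_moment P as)\<bar> \<le> scaled_error n \<omega>" by simp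
qed

lemma bigo_root_scale_tendsto:
  assumes "(\<lambda>i. X i - c) \<in> O[tight_filter M scaled_error K](root_scale)"
  shows "(X \<longlongrightarrow> c) (tight_filter M scaled_error K)"
  using smalloD_tendsto[OF landau_o.big_small_trans[OF assms root_scale_small]] by (simp add: LIM_zero_iff)

text \<open>Along the filter the sample covariance converges entrywise to the identity, so its
  determinant tends to 1. Thus the standardization is eventually well defined on the whole tight
  event.\<close>

lemma eventually_invertible_cov:
  "eventually (\<lambda>i. invertible (cov_mat (empirical (fst i) (data i)))) (tight_filter M scaled_error K)"
proof -
  let ?\<Phi> = "tight_filter M scaled_error K" and ?S = "\<lambda>i. cov_mat (empirical (fst i) (data i))"
  have "((\<lambda>i. ?S i$k$l) \<longlongrightarrow> mat 1$k$l) ?\<Phi>" for k l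
  proof -
    have c: "pop_moment P [Some k, Some l] = of_bool (l = k)"
      by (rule pop_moment_cov[OF P mom]) (use d3 in simp)
    have m: "pop_moment P [Some j] = 0" for j
      by (rule pop_moment_mean[OF P mom]) (use d3 in simp)
    have t: "((\<lambda>i. emp_moment (fst i) (data i) as) \<longlongrightarrow> pop_moment P as) ?\<Phi>" if "length as \<le> d" for as
      by (rule bigo_root_scale_tendsto[OF emp_moment_expansion[OF that]])
    have "((\<lambda>i. emp_moment (fst i) (data i) [Some k, Some l] - emp_moment (fst i) (data i) [Some k] * emp_moment (fst i) (data i) [Some l])
      \<longlongrightarrow> pop_moment P [Some k, Some l] - pop_moment P [Some k] * pop_moment P [Some l]) ?\<Phi>"
      by (intro tendsto_intros t) (use d3 in auto)
    moreover have "eventually (\<lambda>i. emp_moment (fst i) (data i) [Some k, Some l] - emp_moment (fst i) (data i) [Some k] * emp_moment (fst i) (data i) [Some l]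
       = ?S i$k$l) ?\<Phi>"
      using eventually_pos by eventually_elim (simp add: cov_mat_empirical)
    ultimately have "((\<lambda>i. ?S i$k$l) \<longlongrightarrow> pop_moment P [Some k, Some l] - pop_moment P [Some k] * pop_moment P [Some l]) ?\<Phi>"
      by (rule Lim_transform_eventually)
    then show ?thesis using c m by (cases "k = l") (simp_all add: mat_def)
  qed
  then have "((\<lambda>i. det (?S i)) \<longlongrightarrow> det (mat 1 :: real^'p^'p)) ?\<Phi>" by (rule tendsto_det)
  then have "eventually (\<lambda>i. det (?S i) \<noteq> 0) ?\<Phi>"
    by (rule tendsto_imp_eventually_ne) simp
  then show ?thesis by (simp add: invertible_det_nz)
qed

sublocale expansion: moment_expansion P d "tight_filter M scaled_error K" root_scale fst data Vi for K
proof
  show "standardized_independent P" "integrable P (\<lambda>x. (x$k)^(2*d))" "3 \<le> d" for k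
    by (rule P mom d3)+
  show "eventually (\<lambda>i. mixed_moment (fst i) (data i) (centering (fst i) (data i) (Vi i)) [k, l] [] = of_bool (k = l))
      (tight_filter M scaled_error K)" for k l
    using eventually_pos eventually_invertible_cov
    by eventually_elim (simp add: V_def mixed_moment_white[OF F])
qed (rule root_scale_small V_expansion emp_moment_expansion; assumption?)+

section \<open>Estimated cumulant matrices and the measurable maximizer\<close>

definition C3_hat :: "nat \<Rightarrow> 'a \<Rightarrow> real^'p^'p" where
  "C3_hat n \<omega> = C3 (standardized_law F (empirical n (\<lambda>t. z t \<omega>)))"

definition C4_hat :: "nat \<Rightarrow> 'a \<Rightarrow> real^'p^'p" where
  "C4_hat n \<omega> = C4 (standardized_law F (empirical n (\<lambda>t. z t \<omega>)))"

lemma C3_hat_eq: "C3_hat n \<omega> $k$l = emp_C3 n (\<lambda>t. z t \<omega>) (centering n (\<lambda>t. z t \<omega>) (V n \<omega>)) k l"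
  by (simp add: C3_hat_def C3_empirical V_def)

lemma C4_hat_eq: "C4_hat n \<omega> $k$l = emp_C4 n (\<lambda>t. z t \<omega>) (centering n (\<lambda>t. z t \<omega>) (V n \<omega>)) k l"
  by (simp add: C4_hat_def C4_empirical V_def)

lemma cc_objective_caratheodory:
  "caratheodory_on M S (\<lambda>\<omega>. cc_objective \<alpha> (C3_hat n \<omega>) (C4_hat n \<omega>))"
proof -
  have "(\<lambda>\<omega>. C3_hat n \<omega> $k$l) \<in> borel_measurable M" "(\<lambda>\<omega>. C4_hat n \<omega> $k$l) \<in> borel_measurable M" for k l
    unfolding C3_hat_eq C4_hat_eq emp_C3_def emp_C4_def
    by (intro borel_measurable_sum borel_measurable_diff borel_measurable_times
        borel_measurable_mixed_moment z_measurable V_measurable)+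
  then show ?thesis
    unfolding caratheodory_on_def using continuous_on_cc_objective
    unfolding cc_objective_eq[abs_def] bil_eq_sum
    by (auto intro!: borel_measurable_sum borel_measurable_add borel_measurable_times borel_measurable_power)
qed

lemma oP1_root_scaleI:
  assumes "\<And>K. (\<lambda>i. X (fst i) (snd i)) \<in> o[tight_filter M scaled_error K](root_scale)"
  shows "oP1 M (\<lambda>n \<omega>. sqrt (real n) * X n \<omega>)"
proof (rule oP1_tight_filterI[OF scaled_error_measurable scaled_error_tight])
  fix K
  show "((\<lambda>(n, \<omega>). sqrt (real n) * X n \<omega>) \<longlongrightarrow> 0) (tight_filter M scaled_error K)"
    using smalloD_tendsto[OF assms[of K]] by (simp add: case_prod_unfold mult.commute)
qed

definition nearest_maximizer :: "real \<Rightarrow> nat \<Rightarrow> 'a \<Rightarrow> real^'p^'p \<Rightarrow> bool" where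
  "nearest_maximizer \<alpha> n \<omega> U \<longleftrightarrow> orthogonal_matrix U \<and>
     (\<forall>U'. orthogonal_matrix U' \<longrightarrow>
       cc_objective \<alpha> (C3_hat n \<omega>) (C4_hat n \<omega>) U' \<le> cc_objective \<alpha> (C3_hat n \<omega>) (C4_hat n \<omega>) U) \<and>
     (\<forall>U'. orthogonal_matrix U' \<and> (\<forall>U''. orthogonal_matrix U'' \<longrightarrow>
         cc_objective \<alpha> (C3_hat n \<omega>) (C4_hat n \<omega>) U'' \<le> cc_objective \<alpha> (C3_hat n \<omega>) (C4_hat n \<omega>) U') \<longrightarrow>
       norm (U - mat 1) \<le> norm (U' - mat 1))"

lemma measurable_nearest_maximizer:
  "\<exists>U. U \<in> borel_measurable M \<and> (\<forall>\<omega>\<in>space M. nearest_maximizer \<alpha> n \<omega> (U \<omega>))"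
proof (rule measurable_argmax_argmin[OF cc_objective_caratheodory[of "{U. orthogonal_matrix U}" \<alpha> n], of "\<lambda>U. norm (U - mat 1)"])
  show "continuous_on {U. orthogonal_matrix U} (\<lambda>U :: real^'p^'p. norm (U - mat 1))"
    by (intro continuous_intros)
  show "{U :: real^'p^'p. orthogonal_matrix U} \<noteq> {}"
    by (auto intro!: exI[of _ "mat 1"] simp: orthogonal_matrix)
  fix U assume "U \<in> borel_measurable M"
    and "\<And>\<omega>. \<omega> \<in> space M \<Longrightarrow> U \<omega> \<in> {U. orthogonal_matrix U}"
    and "\<And>\<omega> u. \<omega> \<in> space M \<Longrightarrow> u \<in> {U. orthogonal_matrix U} \<Longrightarrow>
      cc_objective \<alpha> (C3_hat n \<omega>) (C4_hat n \<omega>) u \<le> cc_objective \<alpha> (C3_hat n \<omega>) (C4_hat n \<omega>) (U \<omega>)"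
    and "\<And>\<omega> u. \<omega> \<in> space M \<Longrightarrow> u \<in> {U. orthogonal_matrix U} \<Longrightarrow>
      (\<forall>v\<in>{U. orthogonal_matrix U}. cc_objective \<alpha> (C3_hat n \<omega>) (C4_hat n \<omega>) v \<le> cc_objective \<alpha> (C3_hat n \<omega>) (C4_hat n \<omega>) u) \<Longrightarrow>
      norm (U \<omega> - mat 1) \<le> norm (u - mat 1)"
  then show ?thesis by (intro exI[of _ U]) (simp add: nearest_maximizer_def)
qed (rule compact_orthogonal_matrices)

text \<open>The common form of the three cases. The disjunction on \<open>d\<close> admits pure
  skewness with sixth moments, where only \<open>d = 3\<close> is available.\<close>

lemma cc_solution_asymptotics:
  assumes \<alpha>: "0 \<le> \<alpha>" "\<alpha> \<le> 1" and d4: "\<alpha> = 1 \<or> 4 \<le> d"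
    and sep: "\<And>k l. k \<noteq> l \<Longrightarrow> \<alpha> * (skew P k - skew P l)\<^sup>2 + (1 - \<alpha>) * (kurt P k - kurt P l)\<^sup>2 \<noteq> 0"
  shows "\<exists>W. cc_solution_sequence \<alpha> F M z W \<and> tendsto_in_prob M W (mat 1) \<and>
    (\<forall>k. oP1 M (\<lambda>n \<omega>. sqrt n * (W n \<omega> $ k $ k - 1) - (- (1/2) * (sqrt n * (s_hat n (\<lambda>i. z i \<omega>) k k - 1))))) \<and>
    (\<forall>k l. k \<noteq> l \<longrightarrow> oP1 M (\<lambda>n \<omega>. sqrt n * W n \<omega> $ k $ l
       - (\<alpha> * (skew P k - skew P l) * (sqrt n * psi1_hat P n (\<lambda>i. z i \<omega>) k l)
          + (1 - \<alpha>) * (kurt P k - kurt P l) * (sqrt n * psi2_hat P n (\<lambda>i. z i \<omega>) k l))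
         / (\<alpha> * (skew P k - skew P l)^2 + (1 - \<alpha>) * (kurt P k - kurt P l)^2)))"
proof -
  have "\<forall>n. \<exists>U. U \<in> borel_measurable M \<and> (\<forall>\<omega>\<in>space M. nearest_maximizer \<alpha> n \<omega> (U \<omega>))"
    using measurable_nearest_maximizer by blast
  then obtain U where U': "\<forall>n. U n \<in> borel_measurable M \<and> (\<forall>\<omega>\<in>space M. nearest_maximizer \<alpha> n \<omega> (U n \<omega>))"
    by (rule choice[THEN exE])
  then have U: "nearest_maximizer \<alpha> n \<omega> (U n \<omega>)" if "\<omega> \<in> space M" for n \<omega> using that by blast
  have U_meas [measurable]: "U n \<in> borel_measurable M" for n using U' by blast
  define W where "W n \<omega> = U n \<omega> ** V n \<omega>" for n \<omega>
  \<comment> \<open>For \<open>\<alpha> = 1\<close> the kurtosis matrix drops out of the objective, and it need not converge when only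
      sixth moments are finite.\<close>
  define C where "C n \<omega> = (if \<alpha> = 1 then C3_hat n \<omega> else C4_hat n \<omega>)" for n \<omega>
  define \<gamma> where "\<gamma> = skew P"
  \<comment> \<open>This must be the limit of the diagonal of \<open>C\<close>. For
    \<open>\<alpha> = 1\<close> its weight in \<open>\<Lambda>\<close> is 0, so the separation
    constant is unaffected.\<close>
  define \<kappa> where "\<kappa> = (if \<alpha> = 1 then skew P else kurt P)"
  define \<psi> where "\<psi> n \<omega> k l = (if \<alpha> = 1 then psi1_hat P n (\<lambda>i. z i \<omega>) k l else psi2_hat P n (\<lambda>i. z i \<omega>) k l)" for n \<omega> k l
  have obj: "cc_objective \<alpha> (C3_hat n \<omega>) (C4_hat n \<omega>) U' = cc_objective \<alpha> (C3_hat n \<omega>) (C n \<omega>) U'" for n \<omega> U'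
    by (simp add: C_def cc_objective_def)
  define \<Lambda> where "\<Lambda> k l = \<alpha> * (\<gamma> k - \<gamma> l)\<^sup>2 + (1 - \<alpha>) * (\<kappa> k - \<kappa> l)\<^sup>2" for k l
  have \<Lambda>: "\<Lambda> k l \<noteq> 0" if "k \<noteq> l" for k l using sep[OF that] by (cases "\<alpha> = 1") (simp_all add: \<Lambda>_def \<gamma>_def \<kappa>_def)
  let ?\<Phi> = "\<lambda>K. tight_filter M scaled_error K"
  have sp: "eventually (\<lambda>i. snd i \<in> space M) (?\<Phi> K)" for K
    unfolding eventually_tight_filter by auto
  have C3_off: "first_order (?\<Phi> K) root_scale (\<lambda>i. C3_hat (fst i) (snd i) $k$l) 0
      (\<lambda>i. psi1_hat P (fst i) (data i) k l - (\<gamma> k - \<gamma> l) * Vi i$k$l)" if "k \<noteq> l" for K k l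
    using expansion.first_order_C3(2)[OF that] by (simp add: C3_hat_eq \<gamma>_def)
  have C_off: "first_order (?\<Phi> K) root_scale (\<lambda>i. C (fst i) (snd i) $k$l) 0
      (\<lambda>i. \<psi> (fst i) (snd i) k l - (\<kappa> k - \<kappa> l) * Vi i$k$l)" if "k \<noteq> l" for K k l
    using expansion.first_order_C3(2)[OF that] expansion.first_order_C4(2)[OF _ that] d4
    by (auto simp: C3_hat_eq C4_hat_eq C_def \<kappa>_def \<psi>_def)
  have C3_O: "(\<lambda>i. C3_hat (fst i) (snd i) $k$l - of_bool (k = l) * \<gamma> k) \<in> O[?\<Phi> K](root_scale)" for K k l
  proof (cases "k = l")
    case True
    then obtain e where "first_order (?\<Phi> K) root_scale (\<lambda>i. C3_hat (fst i) (snd i) $k$l) (\<gamma> k) e"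
      using expansion.first_order_C3(1)[OF True] by (auto simp: C3_hat_eq \<gamma>_def)
    from first_order_bigo[OF this] show ?thesis using True by simp
  qed (use first_order_bigo[OF C3_off[of k l]] in simp)
  have C_O: "(\<lambda>i. C (fst i) (snd i) $k$l - of_bool (k = l) * \<kappa> k) \<in> O[?\<Phi> K](root_scale)" for K k l
  proof (cases "k = l")
    case True
    have "\<exists>e. first_order (?\<Phi> K) root_scale (\<lambda>i. C (fst i) (snd i) $k$l) (\<kappa> k) e"
    proof (cases "\<alpha> = 1")
      case True
      then show ?thesis using expansion.first_order_C3(1)[OF \<open>k = l\<close>] by (simp add: C_def C3_hat_eq \<kappa>_def)
    next
      case False
      then have "4 \<le> d" using d4 by simp
      from expansion.first_order_C4(1)[OF this \<open>k = l\<close>] show ?thesis using False by (simp add: C_def C4_hat_eq \<kappa>_def)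
    qed
    then obtain e where "first_order (?\<Phi> K) root_scale (\<lambda>i. C (fst i) (snd i) $k$l) (\<kappa> k) e" ..
    from first_order_bigo[OF this] show ?thesis using True by simp
  qed (use first_order_bigo[OF C_off[of k l]] in simp)
  have sym: "transpose (C3_hat n \<omega>) = C3_hat n \<omega>" "transpose (C n \<omega>) = C n \<omega>" for n \<omega>
    by (simp_all add: C_def C3_hat_def C4_hat_def C3_symmetric C4_symmetric)
  have U_orth: "eventually (\<lambda>i. orthogonal_matrix (U (fst i) (snd i))) (?\<Phi> K)" for K
    using sp by eventually_elim (use U in \<open>simp add: nearest_maximizer_def\<close>)
  have U_tendsto: "((\<lambda>i. U (fst i) (snd i)) \<longlongrightarrow> mat 1) (?\<Phi> K)" for K
  proof (rule cc_maximizer_consistent[where A = "\<lambda>i. C3_hat (fst i) (snd i)" and B = "\<lambda>i. C (fst i) (snd i)"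
        and \<gamma> = \<gamma> and \<kappa> = \<kappa>])
    show "(\<lambda>i. C3_hat (fst i) (snd i) $k$l - of_bool (k = l) * \<gamma> k) \<in> o[?\<Phi> K](\<lambda>_. 1)"
      "(\<lambda>i. C (fst i) (snd i) $k$l - of_bool (k = l) * \<kappa> k) \<in> o[?\<Phi> K](\<lambda>_. 1)" for k l
      by (rule landau_o.big_small_trans[OF C3_O root_scale_small] landau_o.big_small_trans[OF C_O root_scale_small])+
    show "\<alpha> * (\<gamma> k - \<gamma> l)\<^sup>2 + (1 - \<alpha>) * (\<kappa> k - \<kappa> l)\<^sup>2 \<noteq> 0" if "k \<noteq> l" for k l
      using \<Lambda>[OF that] by (simp add: \<Lambda>_def)
    show "\<forall>\<^sub>F i in ?\<Phi> K. \<forall>U'. orthogonal_matrix U' \<longrightarrow>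
        cc_objective \<alpha> (C3_hat (fst i) (snd i)) (C (fst i) (snd i)) U' \<le> cc_objective \<alpha> (C3_hat (fst i) (snd i)) (C (fst i) (snd i)) (U (fst i) (snd i))"
      unfolding obj[symmetric] using sp by eventually_elim (use U in \<open>simp add: nearest_maximizer_def\<close>)
    show "\<forall>\<^sub>F i in ?\<Phi> K. \<forall>U'. orthogonal_matrix U' \<and> (\<forall>U''. orthogonal_matrix U'' \<longrightarrow>
          cc_objective \<alpha> (C3_hat (fst i) (snd i)) (C (fst i) (snd i)) U'' \<le> cc_objective \<alpha> (C3_hat (fst i) (snd i)) (C (fst i) (snd i)) U') \<longrightarrow>
        norm (U (fst i) (snd i) - mat 1) \<le> norm (U' - mat 1)"
      unfolding obj[symmetric] using sp by eventually_elim (use U in \<open>simp add: nearest_maximizer_def\<close>)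
  qed (rule \<alpha> U_orth)+
  have U_cons: "(\<lambda>i. U (fst i) (snd i) $k$l - of_bool (k = l)) \<in> o[?\<Phi> K](\<lambda>_. 1)" for K k l
  proof (rule smalloI_tendsto)
    have "((\<lambda>i. U (fst i) (snd i) $k$l) \<longlongrightarrow> mat 1$k$l) (?\<Phi> K)"
      by (intro tendsto_vec_nth U_tendsto)
    then show "((\<lambda>i. (U (fst i) (snd i) $k$l - of_bool (k = l)) / 1) \<longlongrightarrow> 0) (?\<Phi> K)"
      by (cases "k = l") (simp_all add: mat_def LIM_zero_iff)
  qed simp
  have foc: "\<forall>\<^sub>F i in ?\<Phi> K.
      \<alpha> * (bil (C3_hat (fst i) (snd i)) (U (fst i) (snd i) $ k) (U (fst i) (snd i) $ l) *
        (bil (C3_hat (fst i) (snd i)) (U (fst i) (snd i) $ k) (U (fst i) (snd i) $ k) - bil (C3_hat (fst i) (snd i)) (U (fst i) (snd i) $ l) (U (fst i) (snd i) $ l))) +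
      (1 - \<alpha>) * (bil (C (fst i) (snd i)) (U (fst i) (snd i) $ k) (U (fst i) (snd i) $ l) *
        (bil (C (fst i) (snd i)) (U (fst i) (snd i) $ k) (U (fst i) (snd i) $ k) - bil (C (fst i) (snd i)) (U (fst i) (snd i) $ l) (U (fst i) (snd i) $ l))) = 0"
    if kl: "k \<noteq> l" for K k l
    using sp
  proof eventually_elim
    case (elim i)
    show ?case
      by (rule cc_maximizer_stationary[OF _ _ sym kl]) (use U[OF elim] in \<open>auto simp: nearest_maximizer_def simp flip: obj\<close>)
  qed
  define R where "R n \<omega> k l = (\<alpha> * (\<gamma> k - \<gamma> l) * C3_hat n \<omega>$k$l + (1 - \<alpha>) * (\<kappa> k - \<kappa> l) * C n \<omega>$k$l) / \<Lambda> k l" for n \<omega> k l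
  note bootstrap = first_order_matrix_bootstrap[where U = "\<lambda>i. U (fst i) (snd i)" and A = "\<lambda>i. C3_hat (fst i) (snd i)"
      and B = "\<lambda>i. C (fst i) (snd i)" and \<alpha> = \<alpha>, OF root_scale_small C3_O C_O U_orth U_cons foc, folded \<Lambda>_def, OF _ \<Lambda>]
  have U_diag: "(\<lambda>i. U (fst i) (snd i) $k$k - 1) \<in> o[?\<Phi> K](root_scale)" for K k
    using bootstrap(1) by simp
  have U_off: "(\<lambda>i. U (fst i) (snd i) $k$l - R (fst i) (snd i) k l) \<in> o[?\<Phi> K](root_scale)" if "k \<noteq> l" for K k l
    using bootstrap(2)[OF _ _ that] by (simp add: R_def)
  have U_O: "(\<lambda>i. U (fst i) (snd i) $k$l - of_bool (k = l)) \<in> O[?\<Phi> K](root_scale)" for K k l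
  proof (cases "k = l")
    case True
    then show ?thesis using landau_o.small_imp_big[OF U_diag] by simp
  next
    case False
    have "(\<lambda>i. \<alpha> * (\<gamma> k - \<gamma> l) * C3_hat (fst i) (snd i) $k$l + (1 - \<alpha>) * (\<kappa> k - \<kappa> l) * C (fst i) (snd i) $k$l) \<in> O[?\<Phi> K](root_scale)"
      using C3_O[of k l K] C_O[of k l K] False by (intro sum_in_bigo(1)) simp_all
    then have "(\<lambda>i. R (fst i) (snd i) k l) \<in> O[?\<Phi> K](root_scale)"
      using \<Lambda>[OF False] by (simp add: R_def)
    from sum_in_bigo(1)[OF landau_o.small_imp_big[OF U_off[OF False]] this] show ?thesis using False by simp
  qed
  \<comment> \<open>At the identity the differential of a matrix product is the sum of the
    differentials of its factors.\<close>
  have W_exp: "(\<lambda>i. W (fst i) (snd i) $k$l - of_bool (k = l) -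
      ((Vi i$k$l - of_bool (k = l)) + (U (fst i) (snd i) $k$l - of_bool (k = l)))) \<in> o[?\<Phi> K](root_scale)" for K k l
  proof -
    have V': "first_order (?\<Phi> K) root_scale (\<lambda>i. Vi i$a$l) (of_bool (l = a)) (\<lambda>i. Vi i$a$l - of_bool (l = a))" for a
      using first_orderI[OF V_expansion[of a l K]] by (simp add: eq_commute)
    have "first_order (?\<Phi> K) root_scale (\<lambda>i. \<Sum>a\<in>UNIV. U (fst i) (snd i) $k$a * Vi i$a$l) (\<Sum>a\<in>UNIV. of_bool (k = a) * of_bool (l = a))
      (\<lambda>i. \<Sum>a\<in>UNIV. of_bool (k = a) * (Vi i$a$l - of_bool (l = a)) + (U (fst i) (snd i) $k$a - of_bool (k = a)) * of_bool (l = a))"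
      by (intro first_order_sum first_order_mult V' first_orderI[OF U_O] root_scale_small)
    then show ?thesis
      unfolding first_order_def sum.distrib sum_of_bool_pick
      by (simp only: W_def matrix_matrix_mult_def vec_lambda_beta eq_commute[of l k])
  qed
  have W_diag: "(\<lambda>i. W (fst i) (snd i) $k$k - 1 + (s_hat (fst i) (data i) k k - 1) / 2) \<in> o[?\<Phi> K](root_scale)" for K k
    using sum_in_smallo(1)[OF sum_in_smallo(1)[OF W_exp[of k k K] U_diag[of k K]] expansion.first_order_V_diagonal[of k K]]
    by (simp add: algebra_simps)
  define T where "T n \<omega> k l = (\<alpha> * (\<gamma> k - \<gamma> l) * psi1_hat P n (\<lambda>t. z t \<omega>) k l + (1 - \<alpha>) * (\<kappa> k - \<kappa> l) * \<psi> n \<omega> k l) / \<Lambda> k l" for n \<omega> k l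
  have W_off: "(\<lambda>i. W (fst i) (snd i) $k$l - T (fst i) (snd i) k l) \<in> o[?\<Phi> K](root_scale)" if kl: "k \<noteq> l" for K k l
  proof -
    define a where "a i = C3_hat (fst i) (snd i) $k$l - 0 - (psi1_hat P (fst i) (data i) k l - (\<gamma> k - \<gamma> l) * Vi i$k$l)" for i
    define b where "b i = C (fst i) (snd i) $k$l - 0 - (\<psi> (fst i) (snd i) k l - (\<kappa> k - \<kappa> l) * Vi i$k$l)" for i
    have "a \<in> o[?\<Phi> K](root_scale)" "b \<in> o[?\<Phi> K](root_scale)"
      using C3_off[OF kl, of K] C_off[OF kl, of K] by (simp_all add: first_order_def a_def[abs_def] b_def[abs_def])
    then have "(\<lambda>i. \<alpha> * (\<gamma> k - \<gamma> l) * a i + (1 - \<alpha>) * (\<kappa> k - \<kappa> l) * b i) \<in> o[?\<Phi> K](root_scale)"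
      by (intro sum_in_smallo(1)) simp_all
    then have "(\<lambda>i. (\<alpha> * (\<gamma> k - \<gamma> l) * a i + (1 - \<alpha>) * (\<kappa> k - \<kappa> l) * b i) / \<Lambda> k l) \<in> o[?\<Phi> K](root_scale)"
      using \<Lambda>[OF kl] by simp
    from sum_in_smallo(1)[OF sum_in_smallo(1)[OF W_exp[of k l K] U_off[OF kl, of K]] this]
    have s: "(\<lambda>i. W (fst i) (snd i) $k$l - of_bool (k = l) -
        ((Vi i$k$l - of_bool (k = l)) + (U (fst i) (snd i) $k$l - of_bool (k = l))) +
        (U (fst i) (snd i) $k$l - R (fst i) (snd i) k l) +
        (\<alpha> * (\<gamma> k - \<gamma> l) * a i + (1 - \<alpha>) * (\<kappa> k - \<kappa> l) * b i) / \<Lambda> k l) \<in> o[?\<Phi> K](root_scale)" .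
    \<comment> \<open>The cancellation of \<open>V\<close>: its coefficients in the two cumulant
      expansions combine, after weighting, to \<open>\<Lambda> k l\<close>, and division leaves
      \<open>Vi i$k$l\<close> itself, which offsets the same entry in \<open>W_exp\<close>.\<close>
    have v: "(\<alpha> * (\<gamma> k - \<gamma> l) * a i + (1 - \<alpha>) * (\<kappa> k - \<kappa> l) * b i) / \<Lambda> k l =
        R (fst i) (snd i) k l - T (fst i) (snd i) k l + Vi i$k$l" for i
    proof -
      have "\<alpha> * (\<gamma> k - \<gamma> l) * a i + (1 - \<alpha>) * (\<kappa> k - \<kappa> l) * b i =
        \<alpha> * (\<gamma> k - \<gamma> l) * C3_hat (fst i) (snd i) $k$l + (1 - \<alpha>) * (\<kappa> k - \<kappa> l) * C (fst i) (snd i) $k$l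
        - (\<alpha> * (\<gamma> k - \<gamma> l) * psi1_hat P (fst i) (data i) k l + (1 - \<alpha>) * (\<kappa> k - \<kappa> l) * \<psi> (fst i) (snd i) k l)
        + \<Lambda> k l * Vi i$k$l"
        by (simp add: a_def b_def \<Lambda>_def power2_eq_square algebra_simps)
      then show ?thesis using \<Lambda>[OF kl] by (simp add: R_def T_def add_divide_distrib diff_divide_distrib)
    qed
    show ?thesis using s kl unfolding v by simp
  qed
  have W_meas: "W n \<in> borel_measurable M" for n
    unfolding W_def[abs_def]
    by (rule borel_measurable_continuous_Pair[OF U_meas V_measurable])
       (simp add: matrix_matrix_mult_def, intro continuous_intros)
  show ?thesis
  proof (intro exI[of _ W] conjI allI impI)
    show "cc_solution_sequence \<alpha> F M z W"
      unfolding cc_solution_sequence_def compound_cumulant_solution_def Let_def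
        C3_hat_def[symmetric] C4_hat_def[symmetric] V_def[symmetric]
      using W_meas U unfolding nearest_maximizer_def W_def by blast
    show "tendsto_in_prob M W (mat 1)"
      unfolding tendsto_in_prob_def
    proof (rule oP1_tight_filterI[OF scaled_error_measurable scaled_error_tight])
      fix K
      have "((\<lambda>i. W (fst i) (snd i) $k$l) \<longlongrightarrow> mat 1$k$l) (?\<Phi> K)" for k l
      proof -
        have "((\<lambda>i. \<Sum>a\<in>UNIV. U (fst i) (snd i) $k$a * Vi i$a$l) \<longlongrightarrow> (\<Sum>a\<in>UNIV. mat 1$k$a * of_bool (a = l))) (?\<Phi> K)"
          by (intro tendsto_sum tendsto_mult tendsto_vec_nth U_tendsto bigo_root_scale_tendsto V_expansion)
        moreover have "(mat 1 :: real^'p^'p)$k$a = of_bool (k = a)" for k a by (simp add: mat_def)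
        ultimately show ?thesis by (simp only: sum_of_bool_pick W_def matrix_matrix_mult_def vec_lambda_beta)
      qed
      then have "((\<lambda>i. W (fst i) (snd i)) \<longlongrightarrow> mat 1) (?\<Phi> K)" by (rule tendsto_matrixI)
      then show "((\<lambda>(n, \<omega>). W n \<omega> - mat 1) \<longlongrightarrow> 0) (?\<Phi> K)" by (simp add: case_prod_unfold LIM_zero_iff)
    qed
    show "oP1 M (\<lambda>n \<omega>. sqrt n * (W n \<omega> $ k $ k - 1) - (- (1/2) * (sqrt n * (s_hat n (\<lambda>i. z i \<omega>) k k - 1))))" for k
    proof -
      have "oP1 M (\<lambda>n \<omega>. sqrt n * (W n \<omega> $k$k - 1 + (s_hat n (\<lambda>t. z t \<omega>) k k - 1) / 2))"
        using W_diag by (rule oP1_root_scaleI)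
      moreover have "sqrt n * (W n \<omega> $k$k - 1 + (s_hat n (\<lambda>t. z t \<omega>) k k - 1) / 2) =
          sqrt n * (W n \<omega> $ k $ k - 1) - (- (1/2) * (sqrt n * (s_hat n (\<lambda>i. z i \<omega>) k k - 1)))" for n \<omega>
        by (simp add: distrib_left)
      ultimately show ?thesis by (simp only:)
    qed
    show "oP1 M (\<lambda>n \<omega>. sqrt n * W n \<omega> $ k $ l
       - (\<alpha> * (skew P k - skew P l) * (sqrt n * psi1_hat P n (\<lambda>i. z i \<omega>) k l)
          + (1 - \<alpha>) * (kurt P k - kurt P l) * (sqrt n * psi2_hat P n (\<lambda>i. z i \<omega>) k l))
         / (\<alpha> * (skew P k - skew P l)^2 + (1 - \<alpha>) * (kurt P k - kurt P l)^2))" if kl: "k \<noteq> l" for k l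
    proof -
      have "oP1 M (\<lambda>n \<omega>. sqrt n * (W n \<omega> $k$l - T n \<omega> k l))"
        using W_off[OF kl] by (rule oP1_root_scaleI)
      moreover have "sqrt n * (W n \<omega> $k$l - T n \<omega> k l) = sqrt n * W n \<omega> $ k $ l
       - (\<alpha> * (skew P k - skew P l) * (sqrt n * psi1_hat P n (\<lambda>i. z i \<omega>) k l)
          + (1 - \<alpha>) * (kurt P k - kurt P l) * (sqrt n * psi2_hat P n (\<lambda>i. z i \<omega>) k l))
         / (\<alpha> * (skew P k - skew P l)^2 + (1 - \<alpha>) * (kurt P k - kurt P l)^2)" for n \<omega>
      proof (cases "\<alpha> = 1")
        case True
        then show ?thesis by (simp add: T_def \<Lambda>_def \<gamma>_def right_diff_distrib mult_ac)
      next
        case False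
        then show ?thesis
          by (simp add: T_def \<Lambda>_def \<gamma>_def \<kappa>_def \<psi>_def right_diff_distrib distrib_left mult.left_commute[of "sqrt n"])
      qed
      ultimately show ?thesis by simp
    qed
  qed
qed

end

theorem theorem5p1p1:
  fixes M :: "'a measure"
    and z :: "nat \<Rightarrow> 'a \<Rightarrow> real^'p"
    and P :: "(real^'p) measure"
    and D :: "(real^'p) measure set"
    and F :: "(real^'p) measure \<Rightarrow> real^'p^'p"
    and V :: "nat \<Rightarrow> 'a \<Rightarrow> real^'p^'p"
  assumes M: "prob_space M"
    and sample_indep: "prob_space.indep_vars M (\<lambda>_. borel) z UNIV"
    and sample_law: "\<And>i. distr M borel (z i) = P"
    and P: "standardized_independent P"
    and F: "ic_functional D F" "P \<in> D"
    and V_def: "\<And>n \<omega>. V n \<omega> = F (empirical n (\<lambda>i. z i \<omega>))"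
    and V_measurable: "\<And>n. V n \<in> borel_measurable M"
    and V_root_n: "OP1 M (\<lambda>n \<omega>. sqrt (real n) *\<^sub>R (V n \<omega> - mat 1))"
  shows
   "((\<forall>k. integrable P (\<lambda>x. (x$k)^6)) \<and> inj (skew P) \<longrightarrow>
      (\<exists>W. cc_solution_sequence 1 F M z W \<and> tendsto_in_prob M W (mat 1) \<and>
        (\<forall>k. oP1 M (\<lambda>n \<omega>. sqrt n * (W n \<omega> $ k $ k - 1)
               - (- (1/2) * (sqrt n * (s_hat n (\<lambda>i. z i \<omega>) k k - 1))))) \<and>
        (\<forall>k l. k \<noteq> l \<longrightarrow> oP1 M (\<lambda>n \<omega>. sqrt n * W n \<omega> $ k $ l
               - sqrt n * psi1_hat P n (\<lambda>i. z i \<omega>) k l / (skew P k - skew P l)))))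
    \<and>
    ((\<forall>k. integrable P (\<lambda>x. (x$k)^8)) \<and> inj (kurt P) \<longrightarrow>
      (\<exists>W. cc_solution_sequence 0 F M z W \<and> tendsto_in_prob M W (mat 1) \<and>
        (\<forall>k. oP1 M (\<lambda>n \<omega>. sqrt n * (W n \<omega> $ k $ k - 1)
               - (- (1/2) * (sqrt n * (s_hat n (\<lambda>i. z i \<omega>) k k - 1))))) \<and>
        (\<forall>k l. k \<noteq> l \<longrightarrow> oP1 M (\<lambda>n \<omega>. sqrt n * W n \<omega> $ k $ l
               - sqrt n * psi2_hat P n (\<lambda>i. z i \<omega>) k l / (kurt P k - kurt P l)))))
    \<and>
    ((\<forall>k. integrable P (\<lambda>x. (x$k)^8)) \<and>
     \<not> (\<exists>k l. k \<noteq> l \<and> skew P k = skew P l \<and> kurt P k = kurt P l) \<longrightarrow>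
      (\<forall>\<alpha>\<in>{0..1}.
        (\<forall>k l. k \<noteq> l \<longrightarrow>
           \<alpha> * (skew P k - skew P l)^2 + (1 - \<alpha>) * (kurt P k - kurt P l)^2 \<noteq> 0) \<longrightarrow>
        (\<exists>W. cc_solution_sequence \<alpha> F M z W \<and> tendsto_in_prob M W (mat 1) \<and>
          (\<forall>k. oP1 M (\<lambda>n \<omega>. sqrt n * (W n \<omega> $ k $ k - 1)
                 - (- (1/2) * (sqrt n * (s_hat n (\<lambda>i. z i \<omega>) k k - 1))))) \<and>
          (\<forall>k l. k \<noteq> l \<longrightarrow> oP1 M (\<lambda>n \<omega>. sqrt n * W n \<omega> $ k $ l
                 - (\<alpha> * (skew P k - skew P l) * (sqrt n * psi1_hat P n (\<lambda>i. z i \<omega>) k l)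
                    + (1 - \<alpha>) * (kurt P k - kurt P l) * (sqrt n * psi2_hat P n (\<lambda>i. z i \<omega>) k l))
                   / (\<alpha> * (skew P k - skew P l)^2
                      + (1 - \<alpha>) * (kurt P k - kurt P l)^2))))))"
proof (intro conjI impI ballI)
  assume A: "(\<forall>k. integrable P (\<lambda>x. (x$k)^6)) \<and> inj (skew P)"
  \<comment> \<open>Sixth moments have order \<open>2*d\<close> for \<open>d = 3\<close>.\<close>
  have "ic_sample M z P D F V 3"
    using assms A by (intro ic_sample.intro ic_sample_axioms.intro) auto
  \<comment> \<open>With all weight on skewness, separation means that the skewness values are
    distinct, and the general fraction reduces by the common factor
    \<open>skew P k - skew P l\<close>.\<close>
  from ic_sample.cc_solution_asymptotics[OF this, of 1] A
  show "\<exists>W. cc_solution_sequence 1 F M z W \<and> tendsto_in_prob M W (mat 1) \<and>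
        (\<forall>k. oP1 M (\<lambda>n \<omega>. sqrt n * (W n \<omega> $ k $ k - 1)
               - (- (1/2) * (sqrt n * (s_hat n (\<lambda>i. z i \<omega>) k k - 1))))) \<and>
        (\<forall>k l. k \<noteq> l \<longrightarrow> oP1 M (\<lambda>n \<omega>. sqrt n * W n \<omega> $ k $ l
               - sqrt n * psi1_hat P n (\<lambda>i. z i \<omega>) k l / (skew P k - skew P l)))"
    by (simp add: inj_eq power2_eq_square)
next
  assume A: "(\<forall>k. integrable P (\<lambda>x. (x$k)^8)) \<and> inj (kurt P)"
  have "ic_sample M z P D F V 4"
    using assms A by (intro ic_sample.intro ic_sample_axioms.intro) auto
  from ic_sample.cc_solution_asymptotics[OF this, of 0] A
  show "\<exists>W. cc_solution_sequence 0 F M z W \<and> tendsto_in_prob M W (mat 1) \<and>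
        (\<forall>k. oP1 M (\<lambda>n \<omega>. sqrt n * (W n \<omega> $ k $ k - 1)
               - (- (1/2) * (sqrt n * (s_hat n (\<lambda>i. z i \<omega>) k k - 1))))) \<and>
        (\<forall>k l. k \<noteq> l \<longrightarrow> oP1 M (\<lambda>n \<omega>. sqrt n * W n \<omega> $ k $ l
               - sqrt n * psi2_hat P n (\<lambda>i. z i \<omega>) k l / (kurt P k - kurt P l)))"
    by (simp add: inj_eq power2_eq_square)
next
  fix \<alpha> :: real
  assume A: "(\<forall>k. integrable P (\<lambda>x. (x$k)^8)) \<and>
     \<not> (\<exists>k l. k \<noteq> l \<and> skew P k = skew P l \<and> kurt P k = kurt P l)"
    and \<alpha>: "\<alpha> \<in> {0..1}"
    and sep: "\<forall>k l. k \<noteq> l \<longrightarrow> \<alpha> * (skew P k - skew P l)^2 + (1 - \<alpha>) * (kurt P k - kurt P l)^2 \<noteq> 0"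
  \<comment> \<open>For \<open>0 < \<alpha> < 1\<close> the condition \<open>sep\<close> expresses
    the absence of ties; at an end point it says that the single cumulant with positive weight is
    distinct across components.\<close>
  have "ic_sample M z P D F V 4"
    using assms A by (intro ic_sample.intro ic_sample_axioms.intro) auto
  from ic_sample.cc_solution_asymptotics[OF this, of \<alpha>] \<alpha> sep
  show "\<exists>W. cc_solution_sequence \<alpha> F M z W \<and> tendsto_in_prob M W (mat 1) \<and>
          (\<forall>k. oP1 M (\<lambda>n \<omega>. sqrt n * (W n \<omega> $ k $ k - 1)
                 - (- (1/2) * (sqrt n * (s_hat n (\<lambda>i. z i \<omega>) k k - 1))))) \<and>
          (\<forall>k l. k \<noteq> l \<longrightarrow> oP1 M (\<lambda>n \<omega>. sqrt n * W n \<omega> $ k $ l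
                 - (\<alpha> * (skew P k - skew P l) * (sqrt n * psi1_hat P n (\<lambda>i. z i \<omega>) k l)
                    + (1 - \<alpha>) * (kurt P k - kurt P l) * (sqrt n * psi2_hat P n (\<lambda>i. z i \<omega>) k l))
                   / (\<alpha> * (skew P k - skew P l)^2
                      + (1 - \<alpha>) * (kurt P k - kurt P l)^2)))"
    by simp
qed

end
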